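(* Let $0<q<1$ and consider the functional $$S_{sph}(\beta)=\sum_{(jk)}\big(F(\beta_j-\beta_k)-F(\beta_j+\beta_k)\big)+\sum_j\Phi_j\beta_j,$$ where the first sum is over all pairs of neighboring vertices (edges) of $G$ and the second over all vertices of $G$. The critical points $\beta$ of $S_{sph}$ with all $\beta_j\in[0,2K]$ and with $$\Phi_j=2\pi\ \text{ for inner rings},$$ $$\Phi_j=\pi V(j)-\Theta(j)\ \text{ for positively oriented boundary rings},$$ $$\Phi_j=-\Theta(j)\ \text{ for negatively oriented boundary rings},$$ correspond to spherical orthogonal ring patterns with all $R_j\le\frac{\pi}{2}$. Here $V(j)$ and $\Theta(j)$ are the number of rings neighboring to the $j$-th boundary ring and the nominal angle covered by these rings, respectively. The second derivative of $S_{sph}$ is the quadratic form $$D^2S_{sph}=\frac12\sum_{(jk)}\Big[\big(\operatorname{dn}(\beta_j-\beta_k)+q\operatorname{cn}(\beta_j-\beta_k)\big)(d\beta_j-d\beta_k)^2-\big(\operatorname{dn}(\beta_j+\beta_k)+q\operatorname{cn}(\beta_j+\beta_k)\big)(d\beta_j+d\beta_k)^2\Big],$$ where the sum is over pairs of neighboring rings.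
   Context: Combinatorics: $\Pi\subset\mathbb{Z}^2$ is a simply connected (finite) cell complex defined by a set of elementary squares of the $\mathbb{Z}^2$ lattice, identified with its vertex set. $G=\{(m,n)\in\Pi: m+n\text{ even}\}$, $G^*=\{(m,n)\in\Pi:m+n\text{ odd}\}$. Vertices $v_{m,n}$ and $v_{m\pm1,n\pm1}$ of $G$ are called neighboring. A vertex of $G$ is internal (inner) if it has four neighbors in $G$, and a boundary vertex if it has fewer than four. Rings: a spherical ring is a pair of concentric circles on $S^2$: the inner circle $c$ with signed spherical radius $r$ (positive for counter-clockwise, negative for clockwise orientation) and the outer circle $C$ with spherical radius $R>0$, $|r|\le R$. The ring is positively (negatively) oriented if $r>0$ ($r<0$). An orthogonal ring pattern with combinatorics $\Pi$ assigns rings $(C_{m,n},c_{m,n})$ to the vertices of $G$ and points $\ell\in S^2$ to the vertices of $G^*$ such that: (1) the rings at neighboring vertices $v_i,v_j$ intersect orthogonally: $C_i$ intersects $c_j$ orthogonally and $C_j$ intersects $c_i$ orthogonally; (2) for any four consecutively neighboring rings at $v_{m,n},v_{m+1,n-1},v_{m+2,n},v_{m+1,n+1}$ ($m+n$ even) the inner circles $c_{m,n},c_{m+2,n}$ and the outer circles $C_{m+1,n-1},C_{m+1,n+1}$ pass through one point $\ell_{m+1,n}$ (so the two inner circles touch there, and so do the two outer circles); (3) for any ring the four touching points $\ell_{m+1,n}=c_{m,n}\cap c_{m+2,n}$, $\ell_{m,n+1}=C_{m,n}\cap C_{m,n+2}$, $\ell_{m-1,n}=c_{m,n}\cap c_{m-2,n}$,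 $\ell_{m,n-1}=C_{m,n}\cap C_{m,n-2}$ are in counter-clockwise order if $r_{m,n}>0$ and in clockwise order if $r_{m,n}<0$. Uniformization (the correspondence between $\beta$ and rings): all rings of a pattern satisfy $q\cos r=\cos R$ with a common constant $q$, and the ring corresponding to $\beta$ is given by $\cos r=\operatorname{sn}(\beta,q)$, $\sin r=\operatorname{cn}(\beta,q)$, $\sin R=\operatorname{dn}(\beta,q)$. Here $\operatorname{sn},\operatorname{cn},\operatorname{dn}$ are the Jacobi elliptic functions of modulus $q$ with complete elliptic integrals $K,K'$. Functions: $g:\mathbb{R}\to\mathbb{R}$ is the smooth function $g(x)=\frac{\pi}{2}-\arg\operatorname{sn}\big(\frac{x+iK'}{2},q\big)$ with the continuous branch normalized by $g(0)=0$, and $F(x)=\int_0^xg(u)\,du$. Angles: the opening angle at a ring $(r,R)$ towards a neighboring ring $(r_k,R_k)$ is $\theta_k=\varphi_k+\psi_k$, $\varphi_k=\arctan\frac{\tan R_k}{\sin r}$, $\psi_k=\arctan\frac{\tan r_k}{\sin R}$; the nominal (cone) angle is $\Theta=\sum_k\theta_k$ over all neighbors. In terms of $\beta$, the prescription of $\Theta(j)$ at a boundary ring means $\pi V(j)+\sum_k(g(\beta_j-\beta_k)-g(\beta_j+\beta_k))=\Theta(j)$ for a positively oriented ring and $\sum_k(g(\beta_j-\beta_k)-g(\beta_j+\beta_k))=\Theta(j)$ for a negatively oriented ring.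
   Formalization: Neighboring vertices must be opposite corners of a square of the complex; the cyclic order of four touching points, non-strict, is required at inner rings only, and at all rings circles must touch with orientation matching the sign of r; uniqueness up to rotation is for connected interior. *)

theory Defs
  imports "HOL-Analysis.Analysis"
begin

section \<open>Jacobi elliptic functions of modulus q\<close>

definition ell_int :: "real \<Rightarrow> real \<Rightarrow> real" where
  "ell_int q \<phi> = (LBINT t=0..\<phi>. 1 / sqrt (1 - q\<^sup>2 * (sin t)\<^sup>2))"

definition ell_K :: "real \<Rightarrow> real" where
  "ell_K q = ell_int q (pi / 2)"

definition compl_modulus :: "real \<Rightarrow> real" where
  "compl_modulus q = sqrt (1 - q\<^sup>2)"

definition ell_K' :: "real \<Rightarrow> real" where
  "ell_K' q = ell_K (compl_modulus q)"

definition jacobi_am :: "real \<Rightarrow> real \<Rightarrow> real" where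
  "jacobi_am q = inv (ell_int q)"

definition jacobi_sn :: "real \<Rightarrow> real \<Rightarrow> real" where
  "jacobi_sn q u = sin (jacobi_am q u)"

definition jacobi_cn :: "real \<Rightarrow> real \<Rightarrow> real" where
  "jacobi_cn q u = cos (jacobi_am q u)"

definition jacobi_dn :: "real \<Rightarrow> real \<Rightarrow> real" where
  "jacobi_dn q u = sqrt (1 - q\<^sup>2 * (jacobi_sn q u)\<^sup>2)"

(* sn at a complex argument u + i v: the addition theorem for sn combined with Jacobi's imaginary
   transformation sn(iv,q) = i sn(v,k)/cn(v,k), cn(iv,q) = 1/cn(v,k), dn(iv,q) = dn(v,k)/cn(v,k),
   where k is the complementary modulus; the fraction is multiplied out by cn(v,k)^2. *)
definition jacobi_sn_complex :: "real \<Rightarrow> complex \<Rightarrow> complex" where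
  "jacobi_sn_complex q z =
     (let k = compl_modulus q; u = Re z; v = Im z
      in Complex (jacobi_sn q u * jacobi_dn k v)
                 (jacobi_cn q u * jacobi_dn q u * jacobi_sn k v * jacobi_cn k v)
         / of_real ((jacobi_cn k v)\<^sup>2 + q\<^sup>2 * (jacobi_sn q u)\<^sup>2 * (jacobi_sn k v)\<^sup>2))"

(* pi/2 - g is the continuous branch of the argument of sn((x + iK')/2) with g(0) = 0. *)
definition ring_g :: "real \<Rightarrow> real \<Rightarrow> real" where
  "ring_g q = (THE g. continuous_on UNIV g \<and> g 0 = 0 \<and>
     (\<forall>x. let s = jacobi_sn_complex q (Complex x (ell_K' q) / 2)
          in s = of_real (norm s) * cis (pi / 2 - g x)))"

definition ring_F :: "real \<Rightarrow> real \<Rightarrow> real" where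
  "ring_F q x = (LBINT u=0..x. ring_g q u)"


section \<open>Combinatorics\<close>

(* A cell complex is given by the set of its elementary squares, each square represented by its
   lower left corner. *)
definition corners :: "int \<times> int \<Rightarrow> (int \<times> int) set" where
  "corners s = {fst s, fst s + 1} \<times> {snd s, snd s + 1}"

definition realization :: "(int \<times> int) set \<Rightarrow> (real \<times> real) set" where
  "realization Q = (\<Union>(m,n)\<in>Q. {of_int m .. of_int m + 1} \<times> {of_int n .. of_int n + 1})"

definition G_vertices :: "(int \<times> int) set \<Rightarrow> (int \<times> int) set" where
  "G_vertices Q = {(m,n). (m,n) \<in> (\<Union>s\<in>Q. corners s) \<and> even (m + n)}"

definition Gstar_vertices :: "(int \<times> int) set \<Rightarrow> (int \<times> int) set" where
  "Gstar_vertices Q = {(m,n). (m,n) \<in> (\<Union>s\<in>Q. corners s) \<and> odd (m + n)}"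

definition share_square :: "(int \<times> int) set \<Rightarrow> int \<times> int \<Rightarrow> int \<times> int \<Rightarrow> bool" where
  "share_square Q v w \<longleftrightarrow> (\<exists>s\<in>Q. v \<in> corners s \<and> w \<in> corners s)"

(* The edges of G are the diagonals of the squares of the complex. *)
definition neighboring :: "(int \<times> int) set \<Rightarrow> int \<times> int \<Rightarrow> int \<times> int \<Rightarrow> bool" where
  "neighboring Q v w \<longleftrightarrow> v \<in> G_vertices Q \<and> w \<in> G_vertices Q \<and>
     \<bar>fst v - fst w\<bar> = 1 \<and> \<bar>snd v - snd w\<bar> = 1 \<and> share_square Q v w"

definition neighbors :: "(int \<times> int) set \<Rightarrow> int \<times> int \<Rightarrow> (int \<times> int) set" where
  "neighbors Q v = {w. neighboring Q v w}"

definition inner_vertices :: "(int \<times> int) set \<Rightarrow> (int \<times> int) set" where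
  "inner_vertices Q = {v \<in> G_vertices Q. card (neighbors Q v) = 4}"

definition boundary_vertices :: "(int \<times> int) set \<Rightarrow> (int \<times> int) set" where
  "boundary_vertices Q = {v \<in> G_vertices Q. card (neighbors Q v) < 4}"

(* Each unordered pair of neighbors is listed once, from left to right. *)
definition G_edges :: "(int \<times> int) set \<Rightarrow> ((int \<times> int) \<times> (int \<times> int)) set" where
  "G_edges Q = {(v,w). neighboring Q v w \<and> fst v < fst w}"


section \<open>Spherical rings and orthogonal ring patterns\<close>

definition sph_circle :: "real^3 \<Rightarrow> real \<Rightarrow> (real^3) set" where
  "sph_circle p \<rho> = {x \<in> sphere 0 1. arccos (p \<bullet> x) = \<bar>\<rho>\<bar>}"

(* The tangent of a circle with center p at its point x has direction p \<times> x.  For radius 0 the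
   circle is the point p and the condition says that the other circle passes through p. *)
definition orthogonal_circles :: "real^3 \<Rightarrow> real \<Rightarrow> real^3 \<Rightarrow> real \<Rightarrow> bool" where
  "orthogonal_circles p \<rho> p' \<rho>' \<longleftrightarrow>
     (\<exists>x \<in> sph_circle p \<rho> \<inter> sph_circle p' \<rho>'. cross3 p x \<bullet> cross3 p' x = 0)"

definition spherical_ring :: "real^3 \<Rightarrow> real \<Rightarrow> real \<Rightarrow> bool" where
  "spherical_ring p r R \<longleftrightarrow> p \<in> sphere 0 1 \<and> 0 < R \<and> R < pi \<and> \<bar>r\<bar> \<le> R"

(* The point at signed distance \<rho> from x on the geodesic with unit initial direction u. *)
definition sph_exp :: "real^3 \<Rightarrow> real \<Rightarrow> real^3 \<Rightarrow> real^3" where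
  "sph_exp x \<rho> u = cos \<rho> *\<^sub>R x + sin \<rho> *\<^sub>R u"

definition unit_tangent :: "real^3 \<Rightarrow> real^3 \<Rightarrow> bool" where
  "unit_tangent x u \<longleftrightarrow> norm u = 1 \<and> u \<bullet> x = 0"

(* Counter-clockwise (seen from outside the sphere) rotation in the tangent plane at p. *)
definition tangent_rot :: "real^3 \<Rightarrow> real^3 \<Rightarrow> real \<Rightarrow> real^3" where
  "tangent_rot p u a = cos a *\<^sub>R u + sin a *\<^sub>R cross3 p u"

(* Four directions at p in counter-clockwise cyclic order.  The order is not strict: next to a ring
   with r = -pi/2 a positively oriented ring has two touching points in the same direction. *)
definition ccw_order :: "real^3 \<Rightarrow> real^3 \<Rightarrow> real^3 \<Rightarrow> real^3 \<Rightarrow> real^3 \<Rightarrow> bool" where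
  "ccw_order p u0 u1 u2 u3 \<longleftrightarrow> \<not> (u1 = u0 \<and> u2 = u0 \<and> u3 = u0) \<and>
     (\<exists>a b c. 0 \<le> a \<and> a \<le> b \<and> b \<le> c \<and> c \<le> 2 * pi \<and>
        u1 = tangent_rot p u0 a \<and> u2 = tangent_rot p u0 b \<and> u3 = tangent_rot p u0 c)"

definition rings_orthogonal ::
  "(int \<times> int) set \<Rightarrow> (int \<times> int \<Rightarrow> real^3) \<Rightarrow> (int \<times> int \<Rightarrow> real) \<Rightarrow> (int \<times> int \<Rightarrow> real) \<Rightarrow> bool" where
  "rings_orthogonal Q p r R \<longleftrightarrow> (\<forall>v w. neighboring Q v w \<longrightarrow>
     orthogonal_circles (p v) (R v) (p w) (r w) \<and> orthogonal_circles (p w) (R w) (p v) (r v))"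

(* The point l at (m,n) lies on the inner circles of the left and right rings and on the outer
   circles of the lower and upper rings of the squares containing (m,n). *)
definition rings_incident ::
  "(int \<times> int) set \<Rightarrow> (int \<times> int \<Rightarrow> real^3) \<Rightarrow> (int \<times> int \<Rightarrow> real) \<Rightarrow> (int \<times> int \<Rightarrow> real) \<Rightarrow>
   (int \<times> int \<Rightarrow> real^3) \<Rightarrow> bool" where
  "rings_incident Q p r R l \<longleftrightarrow> (\<forall>m n. (m,n) \<in> Gstar_vertices Q \<longrightarrow>
     (\<forall>v \<in> {(m+1,n), (m-1,n)}. share_square Q (m,n) v \<longrightarrow> l (m,n) \<in> sph_circle (p v) (r v)) \<and>
     (\<forall>v \<in> {(m,n+1), (m,n-1)}. share_square Q (m,n) v \<longrightarrow> l (m,n) \<in> sph_circle (p v) (R v)))"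

(* Touching of the oriented circles at l(m,n): the outer circles touch each other from opposite
   sides, and so do the inner ones, where a signed radius r < 0 puts the center on the other side.
   With the positively oriented frame t, l \<times> t at l this makes the sign of r agree with the
   (counter-)clockwise order, around each ring, of the two touching points that belong to a
   common neighbor; it is the part of the order condition that concerns boundary rings too. *)
definition rings_touch ::
  "(int \<times> int) set \<Rightarrow> (int \<times> int \<Rightarrow> real^3) \<Rightarrow> (int \<times> int \<Rightarrow> real) \<Rightarrow> (int \<times> int \<Rightarrow> real) \<Rightarrow>
   (int \<times> int \<Rightarrow> real^3) \<Rightarrow> (int \<times> int \<Rightarrow> real^3) \<Rightarrow> bool" where
  "rings_touch Q p r R l t \<longleftrightarrow> (\<forall>m n. (m,n) \<in> Gstar_vertices Q \<longrightarrow>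
     (let x = l (m,n); u = t (m,n); u' = cross3 x u in
        unit_tangent x u \<and>
        (share_square Q (m,n) (m+1,n) \<longrightarrow> p (m+1,n) = sph_exp x (r (m+1,n)) u) \<and>
        (share_square Q (m,n) (m-1,n) \<longrightarrow> p (m-1,n) = sph_exp x (r (m-1,n)) (- u)) \<and>
        (share_square Q (m,n) (m,n+1) \<longrightarrow> p (m,n+1) = sph_exp x (R (m,n+1)) u') \<and>
        (share_square Q (m,n) (m,n-1) \<longrightarrow> p (m,n-1) = sph_exp x (R (m,n-1)) (- u'))))"

(* u is the direction in which the ring center p sees its touching point x at distance \<rho>; when the
   inner circle is a point (\<rho> = 0, x = p), it is replaced by the common tangent direction d of
   the outer circles touching at x. *)
definition touching_direction :: "real^3 \<Rightarrow> real \<Rightarrow> real^3 \<Rightarrow> real^3 \<Rightarrow> real^3 \<Rightarrow> bool" where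
  "touching_direction p \<rho> x d u \<longleftrightarrow>
     (if \<rho> = 0 then u = d else unit_tangent p u \<and> x = sph_exp p \<rho> u)"

(* For r > 0 (r < 0) the four touching points are in counter-clockwise (clockwise) order; r = 0 is
   treated as the limit r > 0, the limit r < 0 giving the same condition. *)
definition touching_points_ordered ::
  "(int \<times> int) set \<Rightarrow> (int \<times> int \<Rightarrow> real^3) \<Rightarrow> (int \<times> int \<Rightarrow> real) \<Rightarrow> (int \<times> int \<Rightarrow> real) \<Rightarrow>
   (int \<times> int \<Rightarrow> real^3) \<Rightarrow> (int \<times> int \<Rightarrow> real^3) \<Rightarrow> bool" where
  "touching_points_ordered Q p r R l t \<longleftrightarrow> (\<forall>m n. (m,n) \<in> inner_vertices Q \<longrightarrow>
     (\<exists>u0 u1 u2 u3.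
        touching_direction (p (m,n)) \<bar>r (m,n)\<bar> (l (m+1,n)) (t (m+1,n)) u0 \<and>
        touching_direction (p (m,n)) (R (m,n)) (l (m,n+1)) 0 u1 \<and>
        touching_direction (p (m,n)) \<bar>r (m,n)\<bar> (l (m-1,n)) (- t (m-1,n)) u2 \<and>
        touching_direction (p (m,n)) (R (m,n)) (l (m,n-1)) 0 u3 \<and>
        (if r (m,n) \<ge> 0 then ccw_order (p (m,n)) u0 u1 u2 u3
         else ccw_order (p (m,n)) u3 u2 u1 u0)))"

definition orthogonal_ring_pattern ::
  "(int \<times> int) set \<Rightarrow> (int \<times> int \<Rightarrow> real^3) \<Rightarrow> (int \<times> int \<Rightarrow> real) \<Rightarrow> (int \<times> int \<Rightarrow> real) \<Rightarrow>
   (int \<times> int \<Rightarrow> real^3) \<Rightarrow> bool" where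
  "orthogonal_ring_pattern Q p r R l \<longleftrightarrow>
     (\<forall>v \<in> G_vertices Q. spherical_ring (p v) (r v) (R v)) \<and>
     (\<forall>x \<in> Gstar_vertices Q. l x \<in> sphere 0 1) \<and>
     rings_orthogonal Q p r R \<and>
     rings_incident Q p r R l \<and>
     (\<exists>t. rings_touch Q p r R l t \<and> touching_points_ordered Q p r R l t)"


section \<open>Opening angles, uniformization and the functional\<close>

(* arctan (tan \<rho> / s), read as its limit when \<rho> = pi/2 or \<rho> = -pi/2, where the library's tan is 0. *)
definition arctan_tan_over :: "real \<Rightarrow> real \<Rightarrow> real" where
  "arctan_tan_over \<rho> s =
     (if cos \<rho> = 0 then sgn (sin \<rho> * s) * (pi / 2) else arctan (tan \<rho> / s))"

definition opening_angle :: "real \<Rightarrow> real \<Rightarrow> real \<Rightarrow> real \<Rightarrow> real" where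
  "opening_angle r R rk Rk = arctan_tan_over Rk (sin r) + arctan_tan_over rk (sin R)"

definition nominal_angle ::
  "(int \<times> int) set \<Rightarrow> (int \<times> int \<Rightarrow> real) \<Rightarrow> (int \<times> int \<Rightarrow> real) \<Rightarrow> int \<times> int \<Rightarrow> real" where
  "nominal_angle Q r R v = (\<Sum>w\<in>neighbors Q v. opening_angle (r v) (R v) (r w) (R w))"

definition ring_of_beta :: "real \<Rightarrow> real \<Rightarrow> real \<Rightarrow> real \<Rightarrow> bool" where
  "ring_of_beta q b r R \<longleftrightarrow>
     cos r = jacobi_sn q b \<and> sin r = jacobi_cn q b \<and> sin R = jacobi_dn q b \<and> q * cos r = cos R"

definition S_sph ::
  "real \<Rightarrow> (int \<times> int) set \<Rightarrow> (int \<times> int \<Rightarrow> real) \<Rightarrow> (int \<times> int \<Rightarrow> real) \<Rightarrow> real" where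
  "S_sph q Q \<Phi> \<beta> =
     (\<Sum>(v,w)\<in>G_edges Q. ring_F q (\<beta> v - \<beta> w) - ring_F q (\<beta> v + \<beta> w))
     + (\<Sum>v\<in>G_vertices Q. \<Phi> v * \<beta> v)"

(* Differentials are expressed by derivatives along lines: the vertex values form a function on
   int \<times> int, of which S_sph uses only finitely many, in a smooth way. *)
definition critical_point :: "((int \<times> int \<Rightarrow> real) \<Rightarrow> real) \<Rightarrow> (int \<times> int \<Rightarrow> real) \<Rightarrow> bool" where
  "critical_point f \<beta> \<longleftrightarrow>
     (\<forall>h. ((\<lambda>s. f (\<lambda>v. \<beta> v + s * h v)) has_real_derivative 0) (at 0))"

(* d is the value at h of the quadratic form D^2 f at \<beta>. *)
definition has_second_derivative ::
  "((int \<times> int \<Rightarrow> real) \<Rightarrow> real) \<Rightarrow> (int \<times> int \<Rightarrow> real) \<Rightarrow> (int \<times> int \<Rightarrow> real) \<Rightarrow> real \<Rightarrow> bool" where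
  "has_second_derivative f \<beta> h d \<longleftrightarrow>
     (\<exists>f'. (\<forall>s. ((\<lambda>s. f (\<lambda>v. \<beta> v + s * h v)) has_real_derivative f' s) (at s)) \<and>
           (f' has_real_derivative d) (at 0))"

(* The sign of jacobi_cn q (\<beta> v) = sin (r v) is the orientation of the ring at v. *)
definition prescribed_data ::
  "real \<Rightarrow> (int \<times> int) set \<Rightarrow> (int \<times> int \<Rightarrow> real) \<Rightarrow> (int \<times> int \<Rightarrow> real) \<Rightarrow> (int \<times> int \<Rightarrow> real) \<Rightarrow> bool"
where
  "prescribed_data q Q \<Theta> \<beta> \<Phi> \<longleftrightarrow>
     (\<forall>v \<in> inner_vertices Q. \<Phi> v = 2 * pi) \<and>
     (\<forall>v \<in> boundary_vertices Q.
        (jacobi_cn q (\<beta> v) > 0 \<and> \<Phi> v = pi * real (card (neighbors Q v)) - \<Theta> v) \<or>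
        (jacobi_cn q (\<beta> v) < 0 \<and> \<Phi> v = - \<Theta> v))"

end

theory Submission
  imports Defs
begin

text \<open>Two neighboring rings with the parameters \<open>a\<close> and \<open>b\<close> and their two touching points span a spherical
  kite with right angles at the touching points. The proof computes the angle \<open>\<theta>\<close> of this kite at the
  first ring in two ways. The diagonal cuts the kite into two right triangles, so \<open>\<theta>\<close> is the opening
  angle, up to \<open>\<pi>\<close> if the ring is negatively oriented (\<open>opening_angle_eq\<close>). In terms of the parameters
  it is \<open>\<pi> + g(a - b) - g(a + b)\<close>, because both expressions have the same derivative with respect to
  \<open>a\<close> by the addition theorems of the Jacobi functions, and they agree at \<open>a = 0\<close>
  (\<open>kite_angle_eq_ring_g\<close>). What makes this possible is the closed form
  \<open>g(x) = (am x + arcsin (q sn x)) / 2\<close> (\<open>ring_g_eq\<close>). It also gives \<open>g' = (dn + q cn) / 2\<close>, hence the second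
  derivative of the functional. As \<open>g\<close> is odd, the partial derivative of the functional at a ring is the sum of
  \<open>g(a - b) - g(a + b)\<close> over its neighbors plus \<open>\<Phi>\<close>. So the critical points are the parameters for which
  the kite angles around every inner ring add up to \<open>2\<pi>\<close> and every boundary ring has the prescribed nominal
  angle (\<open>critical_point_iff_angles\<close>).

  A pattern is a consistent choice of moving frames at the centers and touching points. Walking along a side of
  a kite and turning by one of its angles are rigid motions of the frame, and that a kite closes up is an
  identity between them (\<open>kite_closes\<close>). In a pattern, the directions from a center to successive touching
  points differ by the kite angles (\<open>center_frame_step\<close>). Around an inner ring the angles therefore add up to
  a multiple of \<open>2\<pi>\<close>. Each of them lies between \<open>0\<close> and \<open>\<pi>\<close>, and among the possible values \<open>0\<close>, \<open>2\<pi>\<close>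
  and \<open>4\<pi>\<close> the cyclic order of the touching points singles out \<open>2\<pi>\<close> (\<open>ccw_order_iff_sum\<close>).

  Conversely, if the angles add up to \<open>2\<pi>\<close>, one can choose directions at every center that differ by the kite
  angles. They turn every edge between a center and a touching point into a rigid motion, with trivial
  composition around each square. On a simply connected complex the composition is then trivial along every
  closed walk (\<open>closed_walk_transport\<close>), so a frame at one vertex spreads over the whole complex and yields
  the pattern.

  For uniqueness, the frame at a touching point is determined by the two centers that it sees at right
  angles in a square (\<open>frame_from_two_points\<close>). A rotation that matches two patterns at one
  touching point thus matches them in all squares that are connected through edges.\<close>

section \<open>Jacobi elliptic functions\<close>

lemma delta_pos:
  assumes "0 < q" "q < (1::real)"
  shows "0 < 1 - q\<^sup>2 * (sin t)\<^sup>2"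
proof -
  have "q\<^sup>2 * (sin t)\<^sup>2 \<le> q\<^sup>2 * 1" by (intro mult_left_mono) (auto simp: abs_square_le_1)
  moreover have "q\<^sup>2 < 1" using assms by (simp add: power_less_one_iff)
  ultimately show ?thesis by linarith
qed

lemma has_real_derivative_ell_int:
  assumes "0 < q" "q < (1::real)"
  shows "(ell_int q has_real_derivative 1 / sqrt (1 - q\<^sup>2 * (sin x)\<^sup>2)) (at x)"
proof -
  let ?f = "\<lambda>t::real. 1 / sqrt (1 - q\<^sup>2 * (sin t)\<^sup>2)"
  define a where "a = - \<bar>x\<bar> - 1"
  define b where "b = \<bar>x\<bar> + 1"
  have ne: "sqrt (1 - q\<^sup>2 * (sin t)\<^sup>2) \<noteq> 0" for t using delta_pos[OF assms, of t] by simp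
  have c: "continuous_on {a..b} ?f"
    using ne by (intro continuous_intros) auto
  have "((\<lambda>u. LBINT y=ereal 0..u. ?f y) has_vector_derivative ?f x) (at x within {a..b})"
    by (rule interval_integral_FTC2[OF _ _ c]) (auto simp: a_def b_def)
  moreover have "at x within {a..b} = at x"
    by (rule at_within_Icc_at) (auto simp: a_def b_def)
  ultimately show ?thesis
    by (simp add: ell_int_def[abs_def] has_real_derivative_iff_has_vector_derivative zero_ereal_def)
qed

lemma ell_int_0 [simp]: "ell_int q 0 = 0"
  by (simp add: ell_int_def zero_ereal_def)

context
  fixes q :: real
  assumes q: "0 < q" "q < 1"
begin

text \<open>The integrand is at least \<open>1\<close>, so the integral is strictly increasing and unbounded in both
  directions, hence invertible.\<close>

lemma ell_int_ge: "x \<le> y \<Longrightarrow> y - x \<le> ell_int q y - ell_int q x"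
proof -
  assume "x \<le> y"
  have "(\<lambda>t. ell_int q t - t) x \<le> (\<lambda>t. ell_int q t - t) y"
  proof (rule DERIV_nonneg_imp_nondecreasing[OF \<open>x \<le> y\<close>])
    fix t
    have "((\<lambda>t. ell_int q t - t) has_real_derivative 1 / sqrt (1 - q\<^sup>2 * (sin t)\<^sup>2) - 1) (at t)"
      by (intro derivative_intros has_real_derivative_ell_int q)
    moreover have "1 / sqrt (1 - q\<^sup>2 * (sin t)\<^sup>2) - 1 \<ge> 0"
      using delta_pos[OF q, of t] by (simp add: field_simps)
    ultimately show "\<exists>y. ((\<lambda>t. ell_int q t - t) has_real_derivative y) (at t) \<and> 0 \<le> y" by blast
  qed
  then show ?thesis by simp
qed

lemma strict_mono_ell_int: "strict_mono (ell_int q)"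
proof (rule strict_monoI)
  fix x y :: real assume "x < y"
  then show "ell_int q x < ell_int q y" using ell_int_ge[of x y] by linarith
qed

lemma bij_ell_int: "bij (ell_int q)"
proof (rule bijI)
  show "inj (ell_int q)" by (rule strict_mono_imp_inj_on[OF strict_mono_ell_int])
  show "surj (ell_int q)"
  proof (rule surjI)
    fix y :: real
    have c: "isCont (ell_int q) x" for x by (rule DERIV_isCont[OF has_real_derivative_ell_int[OF q]])
    have "\<exists>x. - \<bar>y\<bar> \<le> x \<and> x \<le> \<bar>y\<bar> \<and> ell_int q x = y"
      by (rule IVT) (use c ell_int_ge[of 0 "\<bar>y\<bar>"] ell_int_ge[of "-\<bar>y\<bar>" 0] in auto)
    then show "ell_int q (SOME x. ell_int q x = y) = y" by (metis (mono_tags, lifting) someI_ex)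
  qed
qed

lemma ell_int_am [simp]: "ell_int q (jacobi_am q u) = u"
  unfolding jacobi_am_def using bij_ell_int by (simp add: bij_is_surj surj_f_inv_f)

lemma am_ell_int [simp]: "jacobi_am q (ell_int q u) = u"
  unfolding jacobi_am_def using bij_ell_int by (simp add: bij_is_inj)

lemma jacobi_am_0 [simp]: "jacobi_am q 0 = 0"
  using am_ell_int[of 0] by simp

lemma has_derivative_am: "(jacobi_am q has_real_derivative jacobi_dn q u) (at u)"
proof -
  let ?d = "1 / sqrt (1 - q\<^sup>2 * (sin (jacobi_am q u))\<^sup>2)"
  have "isCont (jacobi_am q) (ell_int q (jacobi_am q u))"
    by (rule isCont_inverse_function[where d = 1])
      (auto intro: DERIV_isCont[OF has_real_derivative_ell_int[OF q]])
  then have c: "isCont (jacobi_am q) u" by simp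
  have "(jacobi_am q has_real_derivative inverse ?d) (at u)"
    by (rule DERIV_inverse_function[where f = "ell_int q" and a = "u - 1" and b = "u + 1"])
      (use has_real_derivative_ell_int[OF q] c delta_pos[OF q, of "jacobi_am q u"] in auto)
  then show ?thesis by (simp add: jacobi_dn_def jacobi_sn_def)
qed

lemma jacobi_am_strict_mono: "strict_mono (jacobi_am q)"
proof (rule strict_monoI)
  fix u v :: real assume "u < v"
  then show "jacobi_am q u < jacobi_am q v"
    using strict_mono_less[OF strict_mono_ell_int, of "jacobi_am q u" "jacobi_am q v"] by simp
qed

lemma ell_int_minus: "ell_int q (- x) = - ell_int q x"
proof -
  have "((\<lambda>t. ell_int q (- t) + ell_int q t) has_real_derivative 0) (at t)" for t
    by (rule derivative_eq_intros DERIV_chain'[where g = "ell_int q" and f = uminus]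
        has_real_derivative_ell_int[OF q] refl)+ auto
  from DERIV_isconst_all[OF allI[OF this], of x 0]
  show ?thesis by simp
qed

lemma jacobi_am_minus: "jacobi_am q (- u) = - jacobi_am q u"
  by (metis am_ell_int ell_int_am ell_int_minus)

lemma ell_int_pi: "ell_int q pi = 2 * ell_K q"
proof -
  have "((\<lambda>t. ell_int q (pi - t) + ell_int q t) has_real_derivative 0) (at t)" for t
    by (rule derivative_eq_intros DERIV_chain'[where g = "ell_int q" and f = "\<lambda>t. pi - t"]
        has_real_derivative_ell_int[OF q] refl)+ auto
  from DERIV_isconst_all[OF allI[OF this], of 0 "pi/2"]
  show ?thesis by (simp add: ell_K_def)
qed

lemma jacobi_am_2K: "jacobi_am q (2 * ell_K q) = pi"
  by (metis am_ell_int ell_int_pi)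

lemma jacobi_am_range_iff: "u \<in> {0 .. 2 * ell_K q} \<longleftrightarrow> jacobi_am q u \<in> {0 .. pi}"
  using strict_mono_less_eq[OF jacobi_am_strict_mono, of 0 u]
    strict_mono_less_eq[OF jacobi_am_strict_mono, of u "2 * ell_K q"]
  by (simp add: jacobi_am_2K)

lemma sn_cn_sq: "(jacobi_sn q u)\<^sup>2 + (jacobi_cn q u)\<^sup>2 = 1"
  by (simp add: jacobi_sn_def jacobi_cn_def)

lemma dn_sq: "(jacobi_dn q u)\<^sup>2 = 1 - q\<^sup>2 * (jacobi_sn q u)\<^sup>2"
  using delta_pos[OF q, of "jacobi_am q u"] by (simp add: jacobi_dn_def jacobi_sn_def)

lemma dn_pos: "jacobi_dn q u > 0"
  using delta_pos[OF q, of "jacobi_am q u"] by (simp add: jacobi_dn_def jacobi_sn_def)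

lemma has_derivative_sn:
  "(jacobi_sn q has_real_derivative jacobi_cn q u * jacobi_dn q u) (at u)"
  unfolding jacobi_sn_def[abs_def] jacobi_cn_def
  by (rule derivative_eq_intros has_derivative_am refl)+

lemma has_derivative_cn:
  "(jacobi_cn q has_real_derivative - jacobi_sn q u * jacobi_dn q u) (at u)"
  unfolding jacobi_sn_def jacobi_cn_def[abs_def]
  by (rule derivative_eq_intros has_derivative_am refl)+

lemma has_derivative_dn:
  "(jacobi_dn q has_real_derivative - q\<^sup>2 * jacobi_sn q u * jacobi_cn q u) (at u)"
proof -
  have p: "0 < 1 - q\<^sup>2 * (jacobi_sn q u)\<^sup>2"
    using delta_pos[OF q, of "jacobi_am q u"] by (simp add: jacobi_sn_def)
  have "((\<lambda>u. 1 - q\<^sup>2 * (jacobi_sn q u)\<^sup>2) has_real_derivative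
      - 2 * q\<^sup>2 * jacobi_sn q u * (jacobi_cn q u * jacobi_dn q u)) (at u)"
    by (rule derivative_eq_intros has_derivative_sn refl)+ simp
  from DERIV_chain'[OF this DERIV_real_sqrt[OF p]] show ?thesis
    using dn_pos[of u] by (simp add: jacobi_dn_def[abs_def] field_simps)
qed

lemma jacobi_0 [simp]: "jacobi_sn q 0 = 0" "jacobi_cn q 0 = 1" "jacobi_dn q 0 = 1"
  by (simp_all add: jacobi_sn_def jacobi_cn_def jacobi_dn_def)

lemma jacobi_minus [simp]:
  "jacobi_sn q (- u) = - jacobi_sn q u" "jacobi_cn q (- u) = jacobi_cn q u"
  "jacobi_dn q (- u) = jacobi_dn q u"
  by (simp_all add: jacobi_sn_def jacobi_cn_def jacobi_dn_def jacobi_am_minus)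

lemmas jacobi_DERIV_chain =
  DERIV_chain'[OF _ has_derivative_sn] DERIV_chain'[OF _ has_derivative_cn]
  DERIV_chain'[OF _ has_derivative_dn]

lemma sn_mult_bound: "0 < 1 - q\<^sup>2 * (jacobi_sn q u)\<^sup>2 * (jacobi_sn q v)\<^sup>2"
proof -
  have "q\<^sup>2 * (jacobi_sn q u)\<^sup>2 < 1" using delta_pos[OF q, of "jacobi_am q u"] by (simp add: jacobi_sn_def)
  moreover have "(jacobi_sn q v)\<^sup>2 \<le> 1" by (simp add: jacobi_sn_def abs_square_le_1)
  ultimately have "q\<^sup>2 * (jacobi_sn q u)\<^sup>2 * (jacobi_sn q v)\<^sup>2 < 1"
    by (smt (verit) mult_left_le zero_le_power2 mult_nonneg_nonneg)
  then show ?thesis by simp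
qed

lemma DERIV_divide_zero:
  fixes N D :: "real \<Rightarrow> real"
  assumes "(N has_real_derivative N') (at t)" "(D has_real_derivative D') (at t)"
    and "D t \<noteq> 0" "N' * D t = N t * D'"
  shows "((\<lambda>t. N t / D t) has_real_derivative 0) (at t)"
  using DERIV_divide[OF assms(1,2,3)] assms(3,4) by simp

text \<open>For a fixed sum of the arguments, the right-hand sides do not depend on \<open>u\<close>: the algebraic
  relations between \<open>sn\<close>, \<open>cn\<close> and \<open>dn\<close> make their derivatives vanish. At \<open>v = 0\<close> they reduce to
  the left-hand sides.\<close>

lemma cn_dn_add:
  "jacobi_cn q (u + v) =
     (jacobi_cn q u * jacobi_cn q v - jacobi_sn q u * jacobi_sn q v * jacobi_dn q u * jacobi_dn q v)
     / (1 - q\<^sup>2 * (jacobi_sn q u)\<^sup>2 * (jacobi_sn q v)\<^sup>2)" (is ?thesis1)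
  "jacobi_dn q (u + v) =
     (jacobi_dn q u * jacobi_dn q v - q\<^sup>2 * jacobi_sn q u * jacobi_sn q v * jacobi_cn q u * jacobi_cn q v)
     / (1 - q\<^sup>2 * (jacobi_sn q u)\<^sup>2 * (jacobi_sn q v)\<^sup>2)" (is ?thesis2)
proof -
  define w where "w = u + v"
  let ?den = "\<lambda>u. 1 - q\<^sup>2 * (jacobi_sn q u)\<^sup>2 * (jacobi_sn q (w - u))\<^sup>2"
  let ?nc = "\<lambda>u. jacobi_cn q u * jacobi_cn q (w - u)
       - jacobi_sn q u * jacobi_sn q (w - u) * jacobi_dn q u * jacobi_dn q (w - u)"
  let ?nd = "\<lambda>u. jacobi_dn q u * jacobi_dn q (w - u)
       - q\<^sup>2 * jacobi_sn q u * jacobi_sn q (w - u) * jacobi_cn q u * jacobi_cn q (w - u)"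
  have zero: "((\<lambda>u. ?nc u / ?den u) has_real_derivative 0) (at t)"
    "((\<lambda>u. ?nd u / ?den u) has_real_derivative 0) (at t)" for t
  proof -
    define s c d S C D where
      "s = jacobi_sn q t" and "c = jacobi_cn q t" and "d = jacobi_dn q t" and
      "S = jacobi_sn q (w - t)" and "C = jacobi_cn q (w - t)" and "D = jacobi_dn q (w - t)"
    note abbr = s_def[symmetric] c_def[symmetric] d_def[symmetric]
      S_def[symmetric] C_def[symmetric] D_def[symmetric]
    have e: "c * c = 1 - s * s" "d * d = 1 - q\<^sup>2 * s * s" "C * C = 1 - S * S" "D * D = 1 - q\<^sup>2 * S * S"
      using sn_cn_sq[of t] sn_cn_sq[of "w - t"] dn_sq[of t] dn_sq[of "w - t"]
      by (auto simp: s_def c_def d_def S_def C_def D_def power2_eq_square)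
    have ne: "?den t \<noteq> 0" using sn_mult_bound[of t "w - t"] by simp
    note at_t = has_derivative_sn has_derivative_cn has_derivative_dn jacobi_DERIV_chain
    have den: "(?den has_real_derivative - 2 * q\<^sup>2 * s * S * (c * d * S - s * C * D)) (at t)"
      apply (rule derivative_eq_intros at_t refl)+
      unfolding abbr by (simp add: algebra_simps power2_eq_square)
    have nc: "(?nc has_real_derivative 2 * q\<^sup>2 * s * S * (s * c * D - d * C * S)) (at t)"
    proof -
      have "(?nc has_real_derivative - s * d * C + c * (S * D)
         - (c * d * S * d * D - s * C * D * d * D - s * S * (q\<^sup>2 * s * c) * D
             + s * S * d * (q\<^sup>2 * S * C))) (at t)"
        apply (rule derivative_eq_intros at_t refl)+
        unfolding abbr by (simp add: algebra_simps)
      also have "- s * d * C + c * (S * D) - (c * d * S * d * D - s * C * D * d * D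
           - s * S * (q\<^sup>2 * s * c) * D + s * S * d * (q\<^sup>2 * S * C))
         = s * d * C * (D * D - 1 - q\<^sup>2 * S * S) + c * S * D * (1 - d * d + q\<^sup>2 * s * s)"
        by (simp add: algebra_simps)
      also have "\<dots> = 2 * q\<^sup>2 * s * S * (s * c * D - d * C * S)"
        unfolding e by (simp add: algebra_simps)
      finally show ?thesis .
    qed
    have nd: "(?nd has_real_derivative 2 * q\<^sup>2 * s * S * (s * d * C - c * D * S)) (at t)"
    proof -
      have "(?nd has_real_derivative - (q\<^sup>2 * s * c * D) + d * (q\<^sup>2 * S * C)
         - q\<^sup>2 * (c * d * S * c * C - s * C * D * c * C - s * S * (s * d) * C
             + s * S * c * (S * D))) (at t)"
        apply (rule derivative_eq_intros at_t refl)+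
        unfolding abbr by (simp add: algebra_simps)
      also have "- (q\<^sup>2 * s * c * D) + d * (q\<^sup>2 * S * C)
         - q\<^sup>2 * (c * d * S * c * C - s * C * D * c * C - s * S * (s * d) * C
             + s * S * c * (S * D))
         = q\<^sup>2 * (s * c * D * (C * C - 1 - S * S) + d * S * C * (1 - c * c + s * s))"
        by (simp add: algebra_simps)
      also have "\<dots> = 2 * q\<^sup>2 * s * S * (s * d * C - c * D * S)"
        unfolding e by (simp add: algebra_simps)
      finally show ?thesis .
    qed
    have kc: "(s * c * D - d * C * S) * (1 - q\<^sup>2 * s * s * S * S)
        = - (c * d * S - s * C * D) * (c * C - s * S * d * D)"
    proof -
      have "- (c * d * S - s * C * D) * (c * C - s * S * d * D)
          = s * c * D * (C * C + S * S * (d * d)) - d * S * C * (c * c + s * s * (D * D))"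
        by (simp add: algebra_simps)
      also have "\<dots> = (s * c * D - d * C * S) * (1 - q\<^sup>2 * s * s * S * S)"
        unfolding e by (simp add: algebra_simps)
      finally show ?thesis by simp
    qed
    have kd: "(s * d * C - c * D * S) * (1 - q\<^sup>2 * s * s * S * S)
        = - (c * d * S - s * C * D) * (d * D - q\<^sup>2 * s * S * c * C)"
    proof -
      have "- (c * d * S - s * C * D) * (d * D - q\<^sup>2 * s * S * c * C)
          = s * d * C * (D * D + q\<^sup>2 * S * S * (c * c)) - c * S * D * (d * d + q\<^sup>2 * s * s * (C * C))"
        by (simp add: algebra_simps)
      also have "\<dots> = (s * d * C - c * D * S) * (1 - q\<^sup>2 * s * s * S * S)"
        unfolding e by (simp add: algebra_simps)
      finally show ?thesis by simp
    qed
    have "2 * q\<^sup>2 * s * S * (s * c * D - d * C * S) * ?den t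
        = ?nc t * (- 2 * q\<^sup>2 * s * S * (c * d * S - s * C * D))"
    proof -
      have "2 * q\<^sup>2 * s * S * (s * c * D - d * C * S) * ?den t
          = 2 * q\<^sup>2 * s * S * ((s * c * D - d * C * S) * (1 - q\<^sup>2 * s * s * S * S))"
        unfolding abbr by (simp add: power2_eq_square mult.assoc)
      also have "\<dots> = ?nc t * (- 2 * q\<^sup>2 * s * S * (c * d * S - s * C * D))"
        unfolding kc abbr
        by (simp only: mult_minus_left mult_minus_right mult.assoc mult.commute mult.left_commute
              power2_eq_square)
      finally show ?thesis .
    qed
    then show "((\<lambda>u. ?nc u / ?den u) has_real_derivative 0) (at t)"
      by (rule DERIV_divide_zero[OF nc den ne])
    have "2 * q\<^sup>2 * s * S * (s * d * C - c * D * S) * ?den t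
        = ?nd t * (- 2 * q\<^sup>2 * s * S * (c * d * S - s * C * D))"
    proof -
      have "2 * q\<^sup>2 * s * S * (s * d * C - c * D * S) * ?den t
          = 2 * q\<^sup>2 * s * S * ((s * d * C - c * D * S) * (1 - q\<^sup>2 * s * s * S * S))"
        unfolding abbr by (simp add: power2_eq_square mult.assoc)
      also have "\<dots> = ?nd t * (- 2 * q\<^sup>2 * s * S * (c * d * S - s * C * D))"
        unfolding kd abbr
        by (simp only: mult_minus_left mult_minus_right mult.assoc mult.commute mult.left_commute
              power2_eq_square)
      finally show ?thesis .
    qed
    then show "((\<lambda>u. ?nd u / ?den u) has_real_derivative 0) (at t)"
      by (rule DERIV_divide_zero[OF nd den ne])
  qed
  from DERIV_isconst_all[OF allI[OF zero(1)], of w u] show ?thesis1 by (simp add: w_def)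
  from DERIV_isconst_all[OF allI[OF zero(2)], of w u] show ?thesis2 by (simp add: w_def)
qed

text \<open>This is the derivative of \<open>g(a - b) - g(a + b)\<close> with respect to \<open>a\<close>.\<close>

lemma g_rate_diff:
  "(jacobi_dn q (a - b) + q * jacobi_cn q (a - b)) / 2
     - (jacobi_dn q (a + b) + q * jacobi_cn q (a + b)) / 2
   = q * jacobi_sn q a * jacobi_sn q b
       * (jacobi_dn q a * jacobi_dn q b + q * jacobi_cn q a * jacobi_cn q b)
     / (1 - q\<^sup>2 * (jacobi_sn q a)\<^sup>2 * (jacobi_sn q b)\<^sup>2)"
proof -
  let ?D = "1 - q\<^sup>2 * (jacobi_sn q a)\<^sup>2 * (jacobi_sn q b)\<^sup>2"
  define A where "A = jacobi_dn q a * jacobi_dn q b"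
  define B where "B = q\<^sup>2 * jacobi_sn q a * jacobi_sn q b * jacobi_cn q a * jacobi_cn q b"
  define C where "C = jacobi_cn q a * jacobi_cn q b"
  define E where "E = jacobi_sn q a * jacobi_sn q b * jacobi_dn q a * jacobi_dn q b"
  have combine: "((A + B) / D + q * ((C + E) / D)) / 2 - ((A - B) / D + q * ((C - E) / D)) / 2
      = ((A + B) + q * (C + E) - (A - B) - q * (C - E)) / 2 / D" for D :: real
    by (simp add: add_divide_distrib diff_divide_distrib algebra_simps)
  have "jacobi_dn q (a + b) = (A - B) / ?D" "jacobi_cn q (a + b) = (C - E) / ?D"
    "jacobi_dn q (a - b) = (A + B) / ?D" "jacobi_cn q (a - b) = (C + E) / ?D"
    using cn_dn_add[of a b] cn_dn_add[of a "- b"] by (simp_all add: A_def B_def C_def E_def)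
  then have "(jacobi_dn q (a - b) + q * jacobi_cn q (a - b)) / 2
      - (jacobi_dn q (a + b) + q * jacobi_cn q (a + b)) / 2
      = ((A + B) + q * (C + E) - (A - B) - q * (C - E)) / 2 / ?D"
    by (simp only: combine)
  also have "((A + B) + q * (C + E) - (A - B) - q * (C - E)) / 2 = q * jacobi_sn q a * jacobi_sn q b
       * (jacobi_dn q a * jacobi_dn q b + q * jacobi_cn q a * jacobi_cn q b)"
    by (simp add: B_def E_def algebra_simps power2_eq_square)
  finally show ?thesis .
qed

text \<open>The right-hand side is the angular speed of the point with the coordinates \<open>cn dn\<close> and
  \<open>(1 + q) sn\<close>, divided by \<open>1 + q sn\<^sup>2\<close>, on the unit circle.\<close>

lemma g_rate_double:
  "jacobi_dn q (2 * u) + q * jacobi_cn q (2 * u)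
   = (1 + q) * (1 - q * (jacobi_sn q u)\<^sup>2) / (1 + q * (jacobi_sn q u)\<^sup>2)"
proof -
  define s where "s = jacobi_sn q u"
  have den: "1 - q\<^sup>2 * s\<^sup>2 * s\<^sup>2 = (1 - q * s\<^sup>2) * (1 + q * s\<^sup>2)"
    by (simp add: algebra_simps power2_eq_square)
  have "0 < (1 - q * s\<^sup>2) * (1 + q * s\<^sup>2)"
    by (fact sn_mult_bound[of u u, folded s_def, unfolded den])
  then have ne: "1 - q * s\<^sup>2 \<noteq> 0" "1 + q * s\<^sup>2 \<noteq> 0" by force+
  have e: "(jacobi_cn q u)\<^sup>2 = 1 - s\<^sup>2" "(jacobi_dn q u)\<^sup>2 = 1 - q\<^sup>2 * s\<^sup>2"
    using sn_cn_sq[of u] dn_sq[of u] by (auto simp: s_def)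
  define c2 d2 where "c2 = (jacobi_cn q u)\<^sup>2" and "d2 = (jacobi_dn q u)\<^sup>2"
  have "jacobi_cn q (u + u) = (c2 - s\<^sup>2 * d2) / (1 - q\<^sup>2 * s\<^sup>2 * s\<^sup>2)"
    "jacobi_dn q (u + u) = (d2 - q\<^sup>2 * s\<^sup>2 * c2) / (1 - q\<^sup>2 * s\<^sup>2 * s\<^sup>2)"
    unfolding cn_dn_add[of u u] s_def c2_def d2_def by (simp_all only: power2_eq_square mult.assoc mult.left_commute)
  then have "jacobi_dn q (u + u) + q * jacobi_cn q (u + u)
     = ((d2 - q\<^sup>2 * s\<^sup>2 * c2) + q * (c2 - s\<^sup>2 * d2)) / (1 - q\<^sup>2 * s\<^sup>2 * s\<^sup>2)"
    by (simp only: add_divide_distrib[of "d2 - q\<^sup>2 * s\<^sup>2 * c2"] times_divide_eq_right)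
  also have "(d2 - q\<^sup>2 * s\<^sup>2 * c2) + q * (c2 - s\<^sup>2 * d2)
      = (1 + q) * (1 - q * s\<^sup>2) * (1 - q * s\<^sup>2)"
    unfolding c2_def d2_def e by (simp add: algebra_simps power2_eq_square)
  finally have "jacobi_dn q (u + u) + q * jacobi_cn q (u + u)
      = (1 + q) * (1 - q * s\<^sup>2) * (1 - q * s\<^sup>2) / ((1 - q * s\<^sup>2) * (1 + q * s\<^sup>2))"
    by (simp only: den)
  also have "(1 + q) * (1 - q * s\<^sup>2) * (1 - q * s\<^sup>2) / ((1 - q * s\<^sup>2) * (1 + q * s\<^sup>2))
      = (1 + q) * (1 - q * s\<^sup>2) / (1 + q * s\<^sup>2)"
    using ne by simp
  finally show ?thesis unfolding s_def mult_2[of u] .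
qed

text \<open>The closed form of \<open>g\<close>.\<close>

definition ring_angle :: "real \<Rightarrow> real" where
  "ring_angle x = (jacobi_am q x + arcsin (q * jacobi_sn q x)) / 2"

lemma q_sn_bounds: "- 1 < q * jacobi_sn q x" "q * jacobi_sn q x < 1"
proof -
  have "\<bar>q * jacobi_sn q x\<bar> \<le> q * 1"
    unfolding abs_mult by (rule mult_mono) (use q in \<open>auto simp: jacobi_sn_def\<close>)
  then show "- 1 < q * jacobi_sn q x" "q * jacobi_sn q x < 1" using q by auto
qed

lemma ring_angle_0 [simp]: "ring_angle 0 = 0"
  by (simp add: ring_angle_def)

lemma has_derivative_ring_angle:
  "(ring_angle has_real_derivative (jacobi_dn q x + q * jacobi_cn q x) / 2) (at x)"
proof -
  have "((\<lambda>x. q * jacobi_sn q x) has_real_derivative q * (jacobi_cn q x * jacobi_dn q x)) (at x)"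
    by (intro DERIV_cmult has_derivative_sn)
  from DERIV_chain'[OF this DERIV_arcsin[OF q_sn_bounds]]
  have "((\<lambda>x. arcsin (q * jacobi_sn q x)) has_real_derivative
      q * (jacobi_cn q x * jacobi_dn q x) * inverse (jacobi_dn q x)) (at x)"
    by (simp only: power_mult_distrib jacobi_dn_def mult_ac)
  then have "((\<lambda>x. arcsin (q * jacobi_sn q x)) has_real_derivative q * jacobi_cn q x) (at x)"
    by (rule DERIV_cong) (use dn_pos[of x] in simp)
  from DERIV_cdivide[OF DERIV_add[OF has_derivative_am this], of 2] show ?thesis
    by (simp add: ring_angle_def[abs_def])
qed

text \<open>Both sides describe points that move on the unit circle with the same angular speed and start at
  the same point.\<close>

lemma cis_ring_angle:
  "cos (ring_angle (2 * u)) = jacobi_cn q u * jacobi_dn q u / (1 + q * (jacobi_sn q u)\<^sup>2)"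
  "sin (ring_angle (2 * u)) = (1 + q) * jacobi_sn q u / (1 + q * (jacobi_sn q u)\<^sup>2)"
proof -
  define N where "N = (\<lambda>u. 1 + q * (jacobi_sn q u)\<^sup>2)"
  define C where "C = (\<lambda>u. jacobi_cn q u * jacobi_dn q u / N u)"
  define S where "S = (\<lambda>u. (1 + q) * jacobi_sn q u / N u)"
  define w where "w = (\<lambda>u. (1 + q) * (1 - q * (jacobi_sn q u)\<^sup>2) / N u)"
  have N: "N t > 0" for t using q by (simp add: N_def add_pos_nonneg)
  have dN: "(N has_real_derivative 2 * q * jacobi_sn q t * (jacobi_cn q t * jacobi_dn q t)) (at t)" for t
    unfolding N_def by (rule derivative_eq_intros has_derivative_sn refl)+ simp
  have e: "jacobi_cn q t * jacobi_cn q t = 1 - jacobi_sn q t * jacobi_sn q t"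
     "jacobi_dn q t * jacobi_dn q t = 1 - q\<^sup>2 * (jacobi_sn q t * jacobi_sn q t)" for t
    using sn_cn_sq[of t] dn_sq[of t] by (auto simp: power2_eq_square)
  have dC: "(C has_real_derivative - w t * S t) (at t)" for t
  proof -
    define s c d where "s = jacobi_sn q t" and "c = jacobi_cn q t" and "d = jacobi_dn q t"
    have n: "N t = 1 + q * (s * s)" by (simp add: N_def s_def power2_eq_square)
    have e': "c * c = 1 - s * s" "d * d = 1 - q * q * (s * s)"
      using e[of t] by (auto simp: s_def c_def d_def power2_eq_square)
    have "((- s * d) * d + c * (- q\<^sup>2 * s * c)) * N t - (c * d) * (2 * q * s * (c * d))
        = - s * (d * d + q * q * (c * c)) * N t - 2 * q * s * (c * c) * (d * d)"
      by (simp add: algebra_simps power2_eq_square)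
    also have "\<dots> = - (1 + q) * (1 - q * (s * s)) * ((1 + q) * s)"
      unfolding e' n by (simp add: algebra_simps)
    finally have k: "((- s * d) * d + c * (- q\<^sup>2 * s * c)) * N t - (c * d) * (2 * q * s * (c * d))
      = - (1 + q) * (1 - q * (s * s)) * ((1 + q) * s)" .
    have "(C has_real_derivative
       (((- s * d) * d + c * (- q\<^sup>2 * s * c)) * N t - (c * d) * (2 * q * s * (c * d))) / (N t * N t)) (at t)"
      unfolding C_def s_def c_def d_def
      by (rule DERIV_divide[OF DERIV_cong[OF DERIV_mult[OF has_derivative_cn has_derivative_dn]] dN])
        (use N[of t] in \<open>simp_all add: mult.commute\<close>)
    moreover have "- (1 + q) * (1 - q * (s * s)) * ((1 + q) * s) / (N t * N t) = - w t * S t"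
      by (simp add: w_def S_def s_def power2_eq_square minus_divide_left[symmetric] del: minus_add_distrib)
    ultimately show ?thesis unfolding k by simp
  qed
  have dS: "(S has_real_derivative w t * C t) (at t)" for t
  proof -
    have "(S has_real_derivative ((1 + q) * (jacobi_cn q t * jacobi_dn q t) * N t
         - (1 + q) * jacobi_sn q t * (2 * q * jacobi_sn q t * (jacobi_cn q t * jacobi_dn q t))) / (N t * N t)) (at t)"
      unfolding S_def
      by (rule DERIV_divide[OF DERIV_cmult[OF has_derivative_sn] dN]) (use N[of t] in auto)
    moreover have "(1 + q) * (jacobi_cn q t * jacobi_dn q t) * N t
         - (1 + q) * jacobi_sn q t * (2 * q * jacobi_sn q t * (jacobi_cn q t * jacobi_dn q t))
       = (1 + q) * (1 - q * (jacobi_sn q t)\<^sup>2) * (jacobi_cn q t * jacobi_dn q t)"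
      by (simp add: N_def algebra_simps power2_eq_square)
    ultimately show ?thesis by (simp add: w_def C_def)
  qed
  have da: "((\<lambda>t. ring_angle (2 * t)) has_real_derivative w t) (at t)" for t
    by (rule DERIV_cong[OF DERIV_chain'[OF DERIV_cmult[OF DERIV_ident, of 2] has_derivative_ring_angle]])
      (simp only: w_def N_def g_rate_double[symmetric], simp)
  have "((\<lambda>t. C t * cos (ring_angle (2 * t)) + S t * sin (ring_angle (2 * t))) has_real_derivative 0) (at t)" for t
    by (rule derivative_eq_intros dC dS da refl)+ (simp add: algebra_simps)
  from DERIV_isconst_all[OF allI[OF this], of u 0]
  have dot: "C u * cos (ring_angle (2 * u)) + S u * sin (ring_angle (2 * u)) = 1"
    by (simp add: C_def S_def N_def)
  have "(C u)\<^sup>2 + (S u)\<^sup>2 = 1"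
  proof -
    have "(jacobi_cn q u * jacobi_dn q u)\<^sup>2 + ((1 + q) * jacobi_sn q u)\<^sup>2
      = (jacobi_cn q u * jacobi_cn q u) * (jacobi_dn q u * jacobi_dn q u) + ((1 + q) * jacobi_sn q u)\<^sup>2"
      by (simp add: power2_eq_square mult_ac)
    also have "\<dots> = (N u)\<^sup>2"
      unfolding e N_def by (simp add: algebra_simps power2_eq_square)
    finally show ?thesis using N[of u]
      by (simp add: C_def S_def power_divide add_divide_distrib[symmetric])
  qed
  moreover have "(C u - cos (ring_angle (2 * u)))\<^sup>2 + (S u - sin (ring_angle (2 * u)))\<^sup>2
     = ((C u)\<^sup>2 + (S u)\<^sup>2) + ((cos (ring_angle (2 * u)))\<^sup>2 + (sin (ring_angle (2 * u)))\<^sup>2)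
       - 2 * (C u * cos (ring_angle (2 * u)) + S u * sin (ring_angle (2 * u)))"
    by (simp add: power2_eq_square algebra_simps)
  ultimately have "(C u - cos (ring_angle (2 * u)))\<^sup>2 + (S u - sin (ring_angle (2 * u)))\<^sup>2 = 0"
    using dot by simp
  then show "cos (ring_angle (2 * u)) = jacobi_cn q u * jacobi_dn q u / (1 + q * (jacobi_sn q u)\<^sup>2)"
    "sin (ring_angle (2 * u)) = (1 + q) * jacobi_sn q u / (1 + q * (jacobi_sn q u)\<^sup>2)"
    by (auto simp: sum_power2_eq_zero_iff C_def S_def N_def)
qed

end

lemma compl_modulus_props:
  assumes "0 < q" "q < (1::real)"
  shows "0 < compl_modulus q" "compl_modulus q < 1" "(compl_modulus q)\<^sup>2 = 1 - q\<^sup>2"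
proof -
  have "q\<^sup>2 < 1" "0 < q\<^sup>2" using assms by (auto simp: power_less_one_iff)
  then show "0 < compl_modulus q" "compl_modulus q < 1" "(compl_modulus q)\<^sup>2 = 1 - q\<^sup>2"
    by (auto simp: compl_modulus_def)
qed

text \<open>The duplication formula for \<open>cn\<close>, which vanishes at the quarter period, is a quadratic equation
  for the square \<open>s\<^sup>2\<close> of \<open>sn\<close> at half of it. Its other root \<open>1 / (1 - q)\<close> exceeds \<open>1\<close>.\<close>

lemma jacobi_half_period:
  assumes "0 < q" "q < (1::real)"
  shows "(jacobi_sn (compl_modulus q) (ell_K' q / 2))\<^sup>2 = 1 / (1 + q)"
    "(jacobi_cn (compl_modulus q) (ell_K' q / 2))\<^sup>2 = q / (1 + q)"
    "(jacobi_dn (compl_modulus q) (ell_K' q / 2))\<^sup>2 = q"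
    "jacobi_sn (compl_modulus q) (ell_K' q / 2) > 0"
    "jacobi_cn (compl_modulus q) (ell_K' q / 2) > 0"
proof -
  define k where "k = compl_modulus q"
  note k = compl_modulus_props[OF assms, folded k_def]
  define v where "v = ell_K k / 2"
  define s c d where "s = jacobi_sn k v" and "c = jacobi_cn k v" and "d = jacobi_dn k v"
  have am: "jacobi_am k (ell_K k) = pi / 2"
    unfolding ell_K_def by (rule am_ell_int[OF k(1,2)])
  have "0 < ell_K k" using strict_mono_less[OF jacobi_am_strict_mono[OF k(1,2)], of 0 "ell_K k"]
    by (simp add: am jacobi_am_0[OF k(1,2)])
  then have "0 < jacobi_am k v" "jacobi_am k v < pi / 2"
    using strict_mono_less[OF jacobi_am_strict_mono[OF k(1,2)], of 0 v]
      strict_mono_less[OF jacobi_am_strict_mono[OF k(1,2)], of v "ell_K k"]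
    by (auto simp: v_def am jacobi_am_0[OF k(1,2)])
  then have pos: "s > 0" "c > 0"
    by (auto simp: s_def c_def jacobi_sn_def jacobi_cn_def intro!: sin_gt_zero cos_gt_zero_pi)
  have "jacobi_cn k (v + v) = 0" by (simp add: jacobi_cn_def v_def am)
  then have "c * c = s * s * (d * d)"
    using cn_dn_add(1)[OF k(1,2), of v v] sn_mult_bound[OF k(1,2), of v v]
    by (simp add: s_def c_def d_def mult_ac)
  moreover have cs: "c * c = 1 - s * s" and ds: "d * d = 1 - k\<^sup>2 * (s * s)"
    using sn_cn_sq[OF k(1,2), of v] dn_sq[OF k(1,2), of v]
    by (auto simp: s_def c_def d_def power2_eq_square)
  ultimately have "1 - s * s = s * s * (1 - (1 - q\<^sup>2) * (s * s))" by (simp add: k(3))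
  then have "(1 - (1 + q) * (s * s)) * (1 - (1 - q) * (s * s)) = 0"
    by (simp add: algebra_simps power2_eq_square)
  then have "1 - (1 + q) * (s * s) = 0 \<or> 1 - (1 - q) * (s * s) = 0"
    by (simp only: mult_eq_0_iff)
  moreover have "1 - (1 - q) * (s * s) > 0"
  proof -
    have "s * s < 1" using cs pos by (smt (verit) mult_pos_pos)
    then have "(1 - q) * (s * s) < 1 * 1" using assms pos by (intro mult_strict_mono) auto
    then show ?thesis by simp
  qed
  ultimately have "(1 + q) * (s * s) = 1" by linarith
  then have s2: "s * s = 1 / (1 + q)" using assms by (simp add: field_simps)
  have c2: "c * c = q / (1 + q)" unfolding cs s2 using assms by (simp add: field_simps)
  have "d * d = 1 - (1 - q) * (1 + q) / (1 + q)" unfolding ds s2 k(3)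
    by (simp add: power2_eq_square algebra_simps)
  then have d2: "d * d = q" using assms by simp
  have v': "ell_K' q / 2 = v" by (simp add: v_def ell_K'_def k_def)
  show "(jacobi_sn (compl_modulus q) (ell_K' q / 2))\<^sup>2 = 1 / (1 + q)"
    "(jacobi_cn (compl_modulus q) (ell_K' q / 2))\<^sup>2 = q / (1 + q)"
    "(jacobi_dn (compl_modulus q) (ell_K' q / 2))\<^sup>2 = q"
    "jacobi_sn (compl_modulus q) (ell_K' q / 2) > 0"
    "jacobi_cn (compl_modulus q) (ell_K' q / 2) > 0"
    unfolding v' k_def[symmetric] using s2 c2 d2 pos
    by (auto simp: s_def c_def d_def power2_eq_square)
qed

text \<open>A continuous logarithm of a constant on a connected set cannot move between the isolated
  solutions of \<open>exp z = c\<close>.\<close>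

lemma continuous_exp_const_imp_const:
  fixes f :: "'a::topological_space \<Rightarrow> complex"
  assumes "connected S" "continuous_on S f" "\<And>x. x \<in> S \<Longrightarrow> exp (f x) = c" "x \<in> S" "y \<in> S"
  shows "f x = f y"
proof -
  have "f constant_on S"
  proof (rule continuous_discrete_range_constant[OF assms(1,2)])
    fix x assume x: "x \<in> S"
    have "2 * pi \<le> norm (f y - f x)" if "y \<in> S" "f y \<noteq> f x" for y
    proof -
      have "exp (f y) = exp (f x)" using assms(3) x that by simp
      then obtain n :: int where n: "f y = f x + complex_of_real (2 * of_int n * pi) * \<i>"
        by (auto simp: exp_eq)
      then have "n \<noteq> 0" using that by auto
      then have "1 \<le> \<bar>real_of_int n\<bar>" by linarith
      then show ?thesis using n by (simp add: norm_mult abs_mult)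
    qed
    then show "\<exists>e>0. \<forall>y. y \<in> S \<and> f y \<noteq> f x \<longrightarrow> e \<le> norm (f y - f x)"
      by (intro exI[of _ "2 * pi"]) auto
  qed
  then show ?thesis using assms(4,5) by (auto simp: constant_on_def)
qed

text \<open>On the line with imaginary part \<open>K' / 2\<close> the modulus of \<open>sn\<close> is the constant \<open>1 / sqrt q\<close>, and
  its argument can be read off from the sine and cosine of the closed form. Two continuous branches
  of the argument differ by a constant.\<close>

lemma ring_g_eq:
  assumes "0 < q" "q < (1::real)"
  shows "ring_g q = ring_angle q"
  unfolding ring_g_def
proof (rule the_equality)
  let ?s = "\<lambda>x. jacobi_sn_complex q (Complex x (ell_K' q) / 2)"
  have val: "?s x = of_real (1 / sqrt q) * cis (pi / 2 - ring_angle q x)" for x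
  proof -
    define k u v where "k = compl_modulus q" and "u = x / 2" and "v = ell_K' q / 2"
    note h = jacobi_half_period[OF assms, folded k_def v_def]
    have sq: "sqrt q * sqrt q = q" using assms by simp
    have dn: "jacobi_dn k v = sqrt q"
      using h(3) dn_pos[OF compl_modulus_props(1,2)[OF assms], of v]
      by (simp add: k_def real_sqrt_unique)
    have sc: "jacobi_sn k v * jacobi_cn k v = sqrt q / (1 + q)"
    proof -
      have "(jacobi_sn k v * jacobi_cn k v)\<^sup>2 = q / (1 + q)\<^sup>2"
        by (simp only: power_mult_distrib h) (simp add: power2_eq_square)
      then have "jacobi_sn k v * jacobi_cn k v = sqrt (q / (1 + q)\<^sup>2)"
        using h(4,5) by (intro real_sqrt_unique[symmetric]) auto
      then show ?thesis using assms by (simp add: real_sqrt_divide)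
    qed
    have pos: "0 < 1 + q * (jacobi_sn q u)\<^sup>2" using assms by (simp add: add_pos_nonneg)
    have den: "(jacobi_cn k v)\<^sup>2 + q\<^sup>2 * (jacobi_sn q u)\<^sup>2 * (jacobi_sn k v)\<^sup>2
        = q * (1 + q * (jacobi_sn q u)\<^sup>2) / (1 + q)"
      unfolding h by (simp add: add_divide_distrib power2_eq_square algebra_simps)
    have "?s x = Complex (jacobi_sn q u * sqrt q)
          (jacobi_cn q u * jacobi_dn q u * (sqrt q / (1 + q)))
         / of_real (q * (1 + q * (jacobi_sn q u)\<^sup>2) / (1 + q))"
      unfolding jacobi_sn_complex_def Let_def k_def[symmetric]
      using dn sc den by (simp add: u_def v_def mult.assoc)
    also have "\<dots> = of_real (1 / sqrt q) * Complex (sin (ring_angle q (2 * u))) (cos (ring_angle q (2 * u)))"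
    proof -
      have e: "1 / sqrt q = sqrt q / q" using sq assms by (simp add: field_simps)
      have "x * sqrt q / (q * w / (1 + q)) = 1 / sqrt q * ((1 + q) * x / w)"
        "y * (sqrt q / (1 + q)) / (q * w / (1 + q)) = 1 / sqrt q * (y / w)"
        if "w \<noteq> 0" for x y w :: real
        unfolding e using that assms by (auto simp: divide_simps)
      note r = this[of "1 + q * (jacobi_sn q u)\<^sup>2"]
      have c: "Complex a b / of_real z = of_real k * Complex a' b'"
        if "a / z = k * a'" "b / z = k * b'" for a b a' b' z k :: real
        using that by (simp add: complex_eq_iff Re_divide_of_real Im_divide_of_real)
      show ?thesis
        unfolding cis_ring_angle[OF assms]
        by (rule c) (rule r, use pos in simp)+
    qed
    also have "Complex (sin (ring_angle q (2 * u))) (cos (ring_angle q (2 * u))) = cis (pi / 2 - ring_angle q x)"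
      by (simp add: u_def complex_eq_iff cos_diff sin_diff)
    finally show ?thesis .
  qed
  have nrm: "norm (?s x) = 1 / sqrt q" for x
    unfolding val using assms by (simp add: norm_mult norm_divide)
  have cont: "continuous_on UNIV (ring_angle q)"
    using has_derivative_ring_angle[OF assms] DERIV_isCont continuous_at_imp_continuous_on by blast
  show "continuous_on UNIV (ring_angle q) \<and> ring_angle q 0 = 0 \<and>
      (\<forall>x. let s = ?s x in s = of_real (norm s) * cis (pi / 2 - ring_angle q x))"
    using cont ring_angle_0[OF assms] nrm val by (simp add: Let_def)
  fix g assume g: "continuous_on UNIV g \<and> g 0 = 0 \<and>
      (\<forall>x. let s = ?s x in s = of_real (norm s) * cis (pi / 2 - g x))"
  have "exp (\<i> * of_real (g x - ring_angle q x)) = 1" for x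
  proof -
    have "of_real (1 / sqrt q) * cis (pi / 2 - g x) = of_real (1 / sqrt q) * cis (pi / 2 - ring_angle q x)"
      using g val[of x] nrm[of x] by (metis (no_types, lifting))
    then have "cis (pi / 2 - ring_angle q x) = cis (pi / 2 - g x)" using assms by simp
    then have "cis (pi / 2 - ring_angle q x) / cis (pi / 2 - g x) = 1" by simp
    then have "cis (g x - ring_angle q x) = 1" by (simp add: cis_divide)
    then show ?thesis by (simp add: cis_conv_exp)
  qed
  then have "\<i> * of_real (g x - ring_angle q x) = \<i> * of_real (g 0 - ring_angle q 0)" for x
    by (intro continuous_exp_const_imp_const[of UNIV "\<lambda>x. \<i> * complex_of_real (g x - ring_angle q x)" 1])
      (use g cont in \<open>auto intro!: continuous_intros simp del: of_real_diff\<close>)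
  then show "g = ring_angle q"
    using g ring_angle_0[OF assms] by (auto simp: fun_eq_iff simp del: of_real_diff)
qed

section \<open>The functional and its derivatives\<close>

context
  fixes q :: real
  assumes q: "0 < q" "q < 1"
begin

lemma has_derivative_ring_g:
  "(ring_g q has_real_derivative (jacobi_dn q x + q * jacobi_cn q x) / 2) (at x)"
  unfolding ring_g_eq[OF q] by (rule has_derivative_ring_angle[OF q])

lemma ring_g_minus: "ring_g q (- x) = - ring_g q x"
  unfolding ring_g_eq[OF q] ring_angle_def[OF q]
  using q_sn_bounds[OF q, of x]
  by (simp add: jacobi_am_minus[OF q] jacobi_minus[OF q] arcsin_minus add_divide_distrib)

lemma has_derivative_ring_F: "(ring_F q has_real_derivative ring_g q x) (at x)"
proof -
  define a where "a = - \<bar>x\<bar> - 1"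
  define b where "b = \<bar>x\<bar> + 1"
  have c: "continuous_on {a..b} (ring_g q)"
    by (intro continuous_at_imp_continuous_on ballI DERIV_isCont[OF has_derivative_ring_g])
  have "((\<lambda>u. LBINT y=ereal 0..u. ring_g q y) has_vector_derivative ring_g q x) (at x within {a..b})"
    by (rule interval_integral_FTC2[OF _ _ c]) (auto simp: a_def b_def)
  moreover have "at x within {a..b} = at x"
    by (rule at_within_Icc_at) (auto simp: a_def b_def)
  ultimately show ?thesis
    by (simp add: ring_F_def[abs_def] has_real_derivative_iff_has_vector_derivative zero_ereal_def)
qed

end

lemma finite_G_vertices: "finite Q \<Longrightarrow> finite (G_vertices Q)"
  by (rule finite_subset[of _ "\<Union>s\<in>Q. corners s"]) (auto simp: G_vertices_def corners_def)

lemma finite_G_edges: "finite Q \<Longrightarrow> finite (G_edges Q)"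
  by (rule finite_subset[of _ "G_vertices Q \<times> G_vertices Q"])
    (auto simp: G_edges_def neighboring_def finite_G_vertices)

lemma finite_neighbors: "finite Q \<Longrightarrow> finite (neighbors Q v)"
  by (rule finite_subset[of _ "G_vertices Q"])
    (auto simp: neighbors_def neighboring_def finite_G_vertices)

lemma neighboring_sym: "neighboring Q v w \<Longrightarrow> neighboring Q w v"
  by (auto simp: neighboring_def share_square_def abs_minus_commute)

text \<open>An edge is listed once but contributes to the gradient at both of its ends.\<close>

lemma sum_edges_both_directions:
  assumes "finite Q"
  shows "(\<Sum>(v, w)\<in>G_edges Q. f v w + f w v) = (\<Sum>v\<in>G_vertices Q. \<Sum>w\<in>neighbors Q v. f v (w :: int \<times> int) :: real)"
proof -
  have "(\<Sum>v\<in>G_vertices Q. \<Sum>w\<in>neighbors Q v. f v w)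
      = (\<Sum>(v, w)\<in>(SIGMA v:G_vertices Q. neighbors Q v). f v w)"
    using assms by (intro sum.Sigma) (auto simp: finite_G_vertices finite_neighbors)
  also have "(SIGMA v:G_vertices Q. neighbors Q v) = G_edges Q \<union> prod.swap ` G_edges Q"
  proof (intro set_eqI iffI)
    fix e assume "e \<in> (SIGMA v:G_vertices Q. neighbors Q v)"
    then obtain v w where e: "e = (v, w)" "neighboring Q v w" by (auto simp: neighbors_def)
    then have "fst v \<noteq> fst w" by (auto simp: neighboring_def)
    then consider "fst v < fst w" | "fst w < fst v" by linarith
    then show "e \<in> G_edges Q \<union> prod.swap ` G_edges Q"
    proof cases
      case 1
      then show ?thesis using e by (simp add: G_edges_def)
    next
      case 2
      then have "(w, v) \<in> G_edges Q" using e neighboring_sym by (simp add: G_edges_def)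
      then have "prod.swap (w, v) \<in> prod.swap ` G_edges Q" by (rule imageI)
      then show ?thesis using e by simp
    qed
  next
    fix e assume "e \<in> G_edges Q \<union> prod.swap ` G_edges Q"
    then show "e \<in> (SIGMA v:G_vertices Q. neighbors Q v)"
      by (auto simp: G_edges_def neighbors_def neighboring_sym) (auto simp: neighboring_def)
  qed
  also have "(\<Sum>(v, w)\<in>G_edges Q \<union> prod.swap ` G_edges Q. f v w)
      = (\<Sum>(v, w)\<in>G_edges Q. f v w) + (\<Sum>(v, w)\<in>prod.swap ` G_edges Q. f v w)"
    by (rule sum.union_disjoint) (auto simp: finite_G_edges assms, auto simp: G_edges_def)
  also have "(\<Sum>(v, w)\<in>prod.swap ` G_edges Q. f v w) = (\<Sum>(v, w)\<in>G_edges Q. f w v)"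
    by (subst sum.reindex) (auto simp: case_prod_unfold)
  finally show ?thesis by (simp add: sum.distrib case_prod_unfold)
qed

context
  fixes q :: real and Q :: "(int \<times> int) set"
  assumes q: "0 < q" "q < 1"
begin

lemma has_derivative_S_sph_line:
  "((\<lambda>s. S_sph q Q \<Phi> (\<lambda>v. \<beta> v + s * h v)) has_real_derivative
     (\<Sum>(v, w)\<in>G_edges Q.
        ring_g q (\<beta> v - \<beta> w + s * (h v - h w)) * (h v - h w)
        - ring_g q (\<beta> v + \<beta> w + s * (h v + h w)) * (h v + h w))
     + (\<Sum>v\<in>G_vertices Q. \<Phi> v * h v)) (at s)"
proof -
  have F: "((\<lambda>s. ring_F q (a + s * b)) has_real_derivative ring_g q (a + s * b) * b) (at s)" for a b s
    by (rule DERIV_cong[OF DERIV_chain'[OF _ has_derivative_ring_F[OF q]], of _ b])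
      (auto intro!: derivative_eq_intros)
  have lin: "x + s * a - (y + s * b) = x - y + s * (a - b)"
    "x + s * a + (y + s * b) = x + y + s * (a + b)" for x y s a b :: real
    by (simp_all add: algebra_simps)
  show ?thesis
    unfolding S_sph_def lin case_prod_unfold
    by (intro DERIV_add DERIV_sum DERIV_diff F) (auto intro!: derivative_eq_intros)
qed

lemma S_sph_second_derivative:
  "has_second_derivative (S_sph q Q \<Phi>) \<beta> h
        (1/2 * (\<Sum>(v,w)\<in>G_edges Q.
            (jacobi_dn q (\<beta> v - \<beta> w) + q * jacobi_cn q (\<beta> v - \<beta> w)) * (h v - h w)\<^sup>2
          - (jacobi_dn q (\<beta> v + \<beta> w) + q * jacobi_cn q (\<beta> v + \<beta> w)) * (h v + h w)\<^sup>2))"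
  unfolding has_second_derivative_def
proof (intro exI conjI allI, rule has_derivative_S_sph_line)
  have G: "((\<lambda>s. ring_g q (a + s * b) * b) has_real_derivative
      1/2 * ((jacobi_dn q a + q * jacobi_cn q a) * b\<^sup>2)) (at 0)" for a b
  proof -
    have "((\<lambda>s. a + s * b) has_real_derivative b) (at 0)" by (auto intro!: derivative_eq_intros)
    from DERIV_cmult_right[OF DERIV_chain'[OF this has_derivative_ring_g[OF q]], of b]
    show ?thesis by (rule DERIV_cong) (simp add: power2_eq_square)
  qed
  show "((\<lambda>s. (\<Sum>(v, w)\<in>G_edges Q.
        ring_g q (\<beta> v - \<beta> w + s * (h v - h w)) * (h v - h w)
        - ring_g q (\<beta> v + \<beta> w + s * (h v + h w)) * (h v + h w))
     + (\<Sum>v\<in>G_vertices Q. \<Phi> v * h v)) has_real_derivative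
      1/2 * (\<Sum>(v,w)\<in>G_edges Q.
            (jacobi_dn q (\<beta> v - \<beta> w) + q * jacobi_cn q (\<beta> v - \<beta> w)) * (h v - h w)\<^sup>2
          - (jacobi_dn q (\<beta> v + \<beta> w) + q * jacobi_cn q (\<beta> v + \<beta> w)) * (h v + h w)\<^sup>2)) (at 0)"
    unfolding case_prod_unfold sum_distrib_left right_diff_distrib[of "1/2"]
    by (rule DERIV_cong[OF DERIV_add[OF DERIV_sum[OF DERIV_diff[OF G G]] DERIV_const]]) simp
qed

text \<open>The derivative along \<open>h\<close> is linear in \<open>h\<close>, and since \<open>g\<close> is odd its coefficients are the left-hand
  sides. They are separated by those \<open>h\<close> that are supported at a single vertex.\<close>

lemma critical_point_S_sph_iff:
  assumes "finite Q"
  shows "critical_point (S_sph q Q \<Phi>) \<beta> \<longleftrightarrow>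
    (\<forall>v\<in>G_vertices Q. (\<Sum>w\<in>neighbors Q v. ring_g q (\<beta> v - \<beta> w) - ring_g q (\<beta> v + \<beta> w)) + \<Phi> v = 0)"
proof -
  define a where "a = (\<lambda>v w. ring_g q (\<beta> v - \<beta> w) - ring_g q (\<beta> v + \<beta> w))"
  define D where "D = (\<lambda>h. \<Sum>v\<in>G_vertices Q. h v * ((\<Sum>w\<in>neighbors Q v. a v w) + \<Phi> v))"
  have deriv: "((\<lambda>s. S_sph q Q \<Phi> (\<lambda>v. \<beta> v + s * h v)) has_real_derivative D h) (at 0)" for h
  proof -
    have edge: "ring_g q (x - y) * (b - c) - ring_g q (x + y) * (b + c)
        = b * (ring_g q (x - y) - ring_g q (x + y)) + c * (ring_g q (y - x) - ring_g q (y + x))"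
      for x y b c
    proof -
      have "ring_g q (y - x) = - ring_g q (x - y)" using ring_g_minus[OF q, of "x - y"] by simp
      moreover have "ring_g q (y + x) = ring_g q (x + y)" by (simp add: add.commute)
      ultimately show ?thesis by (simp only:) (simp add: algebra_simps)
    qed
    have "(\<Sum>(v, w)\<in>G_edges Q. ring_g q (\<beta> v - \<beta> w) * (h v - h w) - ring_g q (\<beta> v + \<beta> w) * (h v + h w))
        = (\<Sum>(v, w)\<in>G_edges Q. h v * a v w + h w * a w v)"
      unfolding case_prod_unfold a_def edge ..
    also have "\<dots> = (\<Sum>v\<in>G_vertices Q. \<Sum>w\<in>neighbors Q v. h v * a v w)"
      by (rule sum_edges_both_directions[OF assms])
    finally have edges: "(\<Sum>(v, w)\<in>G_edges Q. ring_g q (\<beta> v - \<beta> w) * (h v - h w) - ring_g q (\<beta> v + \<beta> w) * (h v + h w))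
        = (\<Sum>v\<in>G_vertices Q. \<Sum>w\<in>neighbors Q v. h v * a v w)" .
    have "D h = (\<Sum>v\<in>G_vertices Q. (\<Sum>w\<in>neighbors Q v. h v * a v w) + \<Phi> v * h v)"
      unfolding D_def by (intro sum.cong refl) (simp add: distrib_left sum_distrib_left mult.commute)
    then have "(\<Sum>(v, w)\<in>G_edges Q. ring_g q (\<beta> v - \<beta> w) * (h v - h w) - ring_g q (\<beta> v + \<beta> w) * (h v + h w))
       + (\<Sum>v\<in>G_vertices Q. \<Phi> v * h v) = D h"
      unfolding edges by (simp only: sum.distrib)
    then show ?thesis using has_derivative_S_sph_line[of \<Phi> \<beta> h 0] by simp
  qed
  have "critical_point (S_sph q Q \<Phi>) \<beta> \<longleftrightarrow> (\<forall>h. D h = 0)"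
    unfolding critical_point_def
  proof (intro iff_allI iffI)
    fix h assume "((\<lambda>s. S_sph q Q \<Phi> (\<lambda>v. \<beta> v + s * h v)) has_real_derivative 0) (at 0)"
    then show "D h = 0" by (rule DERIV_unique[OF deriv])
  next
    fix h assume "D h = 0"
    then show "((\<lambda>s. S_sph q Q \<Phi> (\<lambda>v. \<beta> v + s * h v)) has_real_derivative 0) (at 0)"
      using deriv[of h] by simp
  qed
  also have "\<dots> \<longleftrightarrow> (\<forall>v\<in>G_vertices Q. (\<Sum>w\<in>neighbors Q v. a v w) + \<Phi> v = 0)"
  proof (intro iffI allI ballI)
    fix v assume D0: "\<forall>h. D h = 0" and v: "v \<in> G_vertices Q"
    have "D (\<lambda>u. if u = v then 1 else 0) = (\<Sum>w\<in>neighbors Q v. a v w) + \<Phi> v"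
      using v finite_G_vertices[OF assms] unfolding D_def
      by (simp add: if_distrib[of "\<lambda>x. x * _"] sum.delta cong: if_cong)
    then show "(\<Sum>w\<in>neighbors Q v. a v w) + \<Phi> v = 0" using D0 by simp
  qed (auto simp: D_def)
  finally show ?thesis by (simp add: a_def)
qed

end

section \<open>Angles of kites\<close>

text \<open>For \<open>r > 0\<close> this is \<open>arctan (tan Rk / sin r)\<close>. In the present form it stays continuous when \<open>r\<close>
  changes its sign and takes values between \<open>0\<close> and \<open>\<pi>\<close>.\<close>

definition inner_kite_angle :: "real \<Rightarrow> real \<Rightarrow> real" where
  "inner_kite_angle r Rk = pi / 2 - arctan (sin r * cos Rk / sin Rk)"

definition kite_angle :: "real \<Rightarrow> real \<Rightarrow> real \<Rightarrow> real \<Rightarrow> real" where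
  "kite_angle r R rk Rk = inner_kite_angle r Rk + arctan_tan_over rk (sin R)"

lemma opening_angle_eq:
  assumes "0 < Rk" "Rk \<le> pi / 2"
  shows "sin r > 0 \<Longrightarrow> opening_angle r R rk Rk = kite_angle r R rk Rk"
    "sin r < 0 \<Longrightarrow> opening_angle r R rk Rk = kite_angle r R rk Rk - pi"
proof -
  have s: "sin Rk > 0" using assms by (intro sin_gt_zero) auto
  have "arctan_tan_over Rk (sin r) = sgn (sin r) * pi / 2 - arctan (sin r * cos Rk / sin Rk)"
    if "sin r \<noteq> 0"
  proof (cases "cos Rk = 0")
    case True
    then show ?thesis using s by (simp add: arctan_tan_over_def sgn_mult)
  next
    case False
    then have c: "cos Rk > 0" using assms cos_gt_zero_pi[of Rk] by (cases "Rk = pi / 2") auto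
    define x where "x = sin r * cos Rk / sin Rk"
    have "x \<noteq> 0" using that c s by (simp add: x_def)
    have "sgn x = sgn (sin r)" using s c by (simp add: x_def sgn_mult sgn_divide)
    moreover have "tan Rk / sin r = 1 / x" by (simp add: x_def tan_def)
    ultimately show ?thesis
      using Transcendental.arctan_inverse[OF \<open>x \<noteq> 0\<close>] False by (simp add: arctan_tan_over_def x_def)
  qed
  then show "sin r > 0 \<Longrightarrow> opening_angle r R rk Rk = kite_angle r R rk Rk"
    "sin r < 0 \<Longrightarrow> opening_angle r R rk Rk = kite_angle r R rk Rk - pi"
    by (auto simp: opening_angle_def kite_angle_def inner_kite_angle_def)
qed

lemma arctan_tan_over_range: "arctan_tan_over \<rho> s \<in> {- pi / 2 .. pi / 2}"
  using arctan_bounded[of "tan \<rho> / s"] by (auto simp: arctan_tan_over_def sgn_real_def)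

text \<open>In a right triangle with the legs \<open>\<rho>\<close> and \<open>P\<close>, where \<open>s = sin P\<close>, the number \<open>N\<close> is the sine of the
  hypotenuse.\<close>

lemma arctan_tan_over_cos_sin:
  assumes "\<bar>\<rho>\<bar> \<le> pi / 2" "s > 0" "N > 0" "N\<^sup>2 = (sin \<rho>)\<^sup>2 + (s * cos \<rho>)\<^sup>2"
  shows "N * cos (arctan_tan_over \<rho> s) = s * cos \<rho>" "N * sin (arctan_tan_over \<rho> s) = sin \<rho>"
proof -
  have "N * cos (arctan_tan_over \<rho> s) = s * cos \<rho> \<and> N * sin (arctan_tan_over \<rho> s) = sin \<rho>"
  proof (cases "cos \<rho> = 0")
    case True
    have "N\<^sup>2 = (sin \<rho>)\<^sup>2" using assms(4) True by simp
    then have "N = \<bar>sin \<rho>\<bar>" using assms(3) by (metis abs_of_pos power2_eq_iff abs_minus_cancel)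
    then have "sin \<rho> = N \<or> sin \<rho> = - N" by linarith
    then show ?thesis using assms(2,3) True
      by (auto simp: arctan_tan_over_def sgn_mult)
  next
    case False
    then have c: "cos \<rho> > 0" using assms(1) cos_ge_zero[of \<rho>] by (auto simp: abs_le_iff less_le)
    define x where "x = tan \<rho> / s"
    have sx: "s * cos \<rho> * x = sin \<rho>" using assms(2) c by (simp add: x_def tan_def)
    have "N\<^sup>2 = (s * cos \<rho>)\<^sup>2 * (1 + x\<^sup>2)"
      unfolding assms(4) sx[symmetric] by (simp add: algebra_simps power_mult_distrib)
    then have "sqrt (N\<^sup>2) = s * cos \<rho> * sqrt (1 + x\<^sup>2)"
      using assms(2) c by (simp add: real_sqrt_mult)
    then have N: "N = s * cos \<rho> * sqrt (1 + x\<^sup>2)" using assms(3) by simp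
    have "sqrt (1 + x\<^sup>2) > 0" by (simp add: add_pos_nonneg)
    then show ?thesis
      using False sx unfolding arctan_tan_over_def x_def[symmetric] N
      by (simp add: cos_arctan sin_arctan)
  qed
  then show "N * cos (arctan_tan_over \<rho> s) = s * cos \<rho>" "N * sin (arctan_tan_over \<rho> s) = sin \<rho>" by auto
qed

lemma inner_kite_angle_cos_sin:
  assumes "sin Rk > 0" "N > 0" "N\<^sup>2 = (sin Rk)\<^sup>2 + (sin r * cos Rk)\<^sup>2"
  shows "N * cos (inner_kite_angle r Rk) = sin r * cos Rk" "N * sin (inner_kite_angle r Rk) = sin Rk"
proof -
  define x where "x = sin r * cos Rk / sin Rk"
  have sx: "sin Rk * x = sin r * cos Rk" using assms(1) by (simp add: x_def)
  have "N\<^sup>2 = (sin Rk)\<^sup>2 * (1 + x\<^sup>2)"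
    unfolding assms(3) sx[symmetric] by (simp add: algebra_simps power_mult_distrib)
  then have "sqrt (N\<^sup>2) = sin Rk * sqrt (1 + x\<^sup>2)" using assms(1) by (simp add: real_sqrt_mult)
  then have N: "N = sin Rk * sqrt (1 + x\<^sup>2)" using assms(2) by simp
  have "sqrt (1 + x\<^sup>2) > 0" by (simp add: add_pos_nonneg)
  then show "N * cos (inner_kite_angle r Rk) = sin r * cos Rk" "N * sin (inner_kite_angle r Rk) = sin Rk"
    using sx unfolding inner_kite_angle_def x_def[symmetric] N
    by (simp_all add: cos_diff sin_diff cos_arctan sin_arctan)
qed

text \<open>For \<open>0 < q < 1\<close> these conditions entail \<open>\<bar>r\<bar> \<le> R\<close>, since \<open>cos R = q cos r \<le> cos r\<close>.\<close>

definition ring_radii :: "real \<Rightarrow> real \<Rightarrow> real \<Rightarrow> bool" where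
  "ring_radii q r R \<longleftrightarrow> \<bar>r\<bar> \<le> pi / 2 \<and> 0 < R \<and> R \<le> pi / 2 \<and> q * cos r = cos R"

text \<open>By the spherical theorem of Pythagoras, the cosine of the diagonal is \<open>cos r cos Rk\<close> as well as
  \<open>cos R cos rk\<close>; for radii with the common constant \<open>q\<close> the two agree.\<close>

definition kite_diagonal :: "real \<Rightarrow> real \<Rightarrow> real \<Rightarrow> real" where
  "kite_diagonal q r rk = arccos (q * cos r * cos rk)"

context
  fixes q r R rk Rk :: real
  assumes q: "0 < q" "q < 1" and rR: "ring_radii q r R" and rRk: "ring_radii q rk Rk"
begin

lemma radii_pos: "sin R > 0" "sin Rk > 0" "cos r \<ge> 0" "cos rk \<ge> 0"
  using rR rRk by (auto simp: ring_radii_def abs_le_iff intro!: sin_gt_zero cos_ge_zero)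

lemma q_cos_cos_bounds: "0 \<le> q * cos r * cos rk" "q * cos r * cos rk < 1"
proof -
  have "cos r * cos rk \<le> 1 * 1" using radii_pos by (intro mult_mono) auto
  then have "q * (cos r * cos rk) \<le> q * 1" using q by (intro mult_left_mono) auto
  then show "q * cos r * cos rk < 1" using q by (simp only: mult.assoc)
qed (use radii_pos q in auto)

lemma cos_kite_diagonal: "cos (kite_diagonal q r rk) = cos r * cos Rk"
  "cos (kite_diagonal q r rk) = cos R * cos rk"
proof -
  have "cos (kite_diagonal q r rk) = q * cos r * cos rk"
    unfolding kite_diagonal_def using q_cos_cos_bounds by (intro cos_arccos) auto
  then show "cos (kite_diagonal q r rk) = cos r * cos Rk" "cos (kite_diagonal q r rk) = cos R * cos rk"
    using rR rRk by (auto simp: ring_radii_def mult_ac)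
qed

lemma sin_kite_diagonal: "sin (kite_diagonal q r rk) > 0"
proof -
  have "kite_diagonal q r rk > 0"
    unfolding kite_diagonal_def using q_cos_cos_bounds arccos_less_arccos[of "q * cos r * cos rk" 1] by simp
  moreover have "kite_diagonal q r rk \<le> pi / 2"
    unfolding kite_diagonal_def using q_cos_cos_bounds by (intro arccos_le_pi2) auto
  ultimately show ?thesis using pi_gt_zero by (intro sin_gt_zero) auto
qed

lemma sin_kite_diagonal_sq:
  "(sin (kite_diagonal q r rk))\<^sup>2 = (sin Rk)\<^sup>2 + (sin r * cos Rk)\<^sup>2"
  "(sin (kite_diagonal q r rk))\<^sup>2 = (sin rk)\<^sup>2 + (sin R * cos rk)\<^sup>2"
proof -
  have "(sin D)\<^sup>2 = (sin b)\<^sup>2 + (sin a * cos b)\<^sup>2" if "cos D = cos a * cos b" for D a b :: real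
    unfolding sin_squared_eq[of D] that by (simp add: power_mult_distrib sin_squared_eq algebra_simps)
  then show "(sin (kite_diagonal q r rk))\<^sup>2 = (sin Rk)\<^sup>2 + (sin r * cos Rk)\<^sup>2"
    "(sin (kite_diagonal q r rk))\<^sup>2 = (sin rk)\<^sup>2 + (sin R * cos rk)\<^sup>2"
    using cos_kite_diagonal by blast+
qed

lemma kite_angle_parts:
  "sin (kite_diagonal q r rk) * cos (inner_kite_angle r Rk) = sin r * cos Rk"
  "sin (kite_diagonal q r rk) * sin (inner_kite_angle r Rk) = sin Rk"
  "sin (kite_diagonal q r rk) * cos (arctan_tan_over rk (sin R)) = sin R * cos rk"
  "sin (kite_diagonal q r rk) * sin (arctan_tan_over rk (sin R)) = sin rk"
  using inner_kite_angle_cos_sin[OF radii_pos(2) sin_kite_diagonal sin_kite_diagonal_sq(1)]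
    arctan_tan_over_cos_sin[OF _ radii_pos(1) sin_kite_diagonal sin_kite_diagonal_sq(2)] rRk
  by (auto simp: ring_radii_def)

text \<open>The two parts confine the angle between \<open>- \<pi>/2\<close> and \<open>3\<pi>/2\<close>; its sine is not negative because
  \<open>\<bar>sin r\<bar> \<le> sin R\<close> for every ring.\<close>

lemma kite_angle_range: "kite_angle r R rk Rk \<in> {0..pi}"
proof -
  let ?N = "sin (kite_diagonal q r rk)"
  let ?\<phi> = "inner_kite_angle r Rk" and ?\<psi> = "arctan_tan_over rk (sin R)"
  have "?\<phi> \<in> {0<..<pi}"
    using arctan_bounded[of "sin r * cos Rk / sin Rk"] by (auto simp: inner_kite_angle_def)
  then have range: "- pi / 2 < ?\<phi> + ?\<psi>" "?\<phi> + ?\<psi> < 3 * pi / 2"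
    using arctan_tan_over_range[of rk "sin R"] by auto
  have "?N * ?N * sin (?\<phi> + ?\<psi>) = (?N * sin ?\<phi>) * (?N * cos ?\<psi>) + (?N * cos ?\<phi>) * (?N * sin ?\<psi>)"
    by (simp add: sin_add algebra_simps)
  also have "\<dots> = cos rk * (sin Rk * sin R + q * (sin r * sin rk))"
    unfolding kite_angle_parts using rRk by (simp add: ring_radii_def algebra_simps)
  also have "\<dots> \<ge> 0"
  proof -
    have le: "\<bar>sin \<rho>\<bar> \<le> sin P" if "q * cos \<rho> = cos P" "sin P > 0" for \<rho> P
    proof -
      have "(cos P)\<^sup>2 \<le> 1 * (cos \<rho>)\<^sup>2"
        unfolding that(1)[symmetric] power_mult_distrib using q by (intro mult_right_mono) (auto simp: power_le_one)
      then have "(sin \<rho>)\<^sup>2 \<le> (sin P)\<^sup>2" by (simp add: sin_squared_eq)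
      then show ?thesis using that(2) by (metis abs_le_square_iff abs_of_pos)
    qed
    have "\<bar>sin r\<bar> \<le> sin R" "\<bar>sin rk\<bar> \<le> sin Rk"
      using le[of r R] le[of rk Rk] rR rRk radii_pos by (auto simp: ring_radii_def)
    then have "\<bar>sin r * sin rk\<bar> \<le> sin R * sin Rk"
      unfolding abs_mult by (rule mult_mono) (use radii_pos in auto)
    then have "q * \<bar>sin r * sin rk\<bar> \<le> 1 * (sin R * sin Rk)"
      using q by (intro mult_mono) auto
    moreover have "\<bar>q * (sin r * sin rk)\<bar> = q * \<bar>sin r * sin rk\<bar>" using q by (simp add: abs_mult)
    ultimately have "0 \<le> sin Rk * sin R + q * (sin r * sin rk)" by (simp add: mult.commute)
    then show ?thesis using radii_pos by simp
  qed
  finally have s: "sin (?\<phi> + ?\<psi>) \<ge> 0"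
    using mult_pos_pos[OF sin_kite_diagonal sin_kite_diagonal] by (simp only: zero_le_mult_iff) linarith
  have "0 \<le> ?\<phi> + ?\<psi>"
  proof (rule ccontr)
    assume "\<not> 0 \<le> ?\<phi> + ?\<psi>"
    then have "sin (- (?\<phi> + ?\<psi>)) > 0" using range by (intro sin_gt_zero) auto
    then show False using s sin_minus[of "?\<phi> + ?\<psi>"] by linarith
  qed
  moreover have "?\<phi> + ?\<psi> \<le> pi"
  proof (rule ccontr)
    assume "\<not> ?\<phi> + ?\<psi> \<le> pi"
    then have "sin (?\<phi> + ?\<psi> - pi) > 0" using range by (intro sin_gt_zero) auto
    then show False using s by (simp add: sin_diff)
  qed
  ultimately show ?thesis by (simp add: kite_angle_def)
qed

end

lemma ring_of_beta_radii:
  assumes q: "0 < q" "q < 1" and b: "b \<in> {0..2 * ell_K q}"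
    and ring: "ring_of_beta q b r R" and "\<bar>r\<bar> \<le> R" "0 < R" "R \<le> pi / 2"
  shows "ring_radii q r R" "r = pi / 2 - jacobi_am q b" "R = arccos (q * jacobi_sn q b)"
proof -
  show "ring_radii q r R" using assms by (auto simp: ring_radii_def ring_of_beta_def)
  have am: "jacobi_am q b \<in> {0..pi}" using jacobi_am_range_iff[OF q, of b] b by simp
  have "sin (pi / 2 - jacobi_am q b) = sin r"
    using ring by (simp add: ring_of_beta_def jacobi_cn_def sin_diff)
  then show "r = pi / 2 - jacobi_am q b"
    using am assms by (subst sin_inj_pi[of r "pi / 2 - jacobi_am q b"]) auto
  have "cos R = q * jacobi_sn q b" using ring by (auto simp: ring_of_beta_def)
  then show "R = arccos (q * jacobi_sn q b)" using assms arccos_cos[of R] by simp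
qed

lemma ring_of_beta_exists:
  assumes q: "0 < q" "q < 1" and b: "b \<in> {0..2 * ell_K q}"
  defines "r \<equiv> pi / 2 - jacobi_am q b" and "R \<equiv> arccos (q * jacobi_sn q b)"
  shows "ring_of_beta q b r R" "ring_radii q r R" "\<bar>r\<bar> \<le> R"
proof -
  have am: "jacobi_am q b \<in> {0..pi}" using jacobi_am_range_iff[OF q, of b] b by simp
  then have sn: "0 \<le> jacobi_sn q b" unfolding jacobi_sn_def by (auto intro: sin_ge_zero)
  note bounds = q_sn_bounds[OF q, of b]
  have r: "cos r = jacobi_sn q b" "sin r = jacobi_cn q b"
    by (simp_all add: r_def jacobi_sn_def jacobi_cn_def cos_diff sin_diff)
  have R: "cos R = q * jacobi_sn q b" using bounds by (simp add: R_def)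
  have "sin R = jacobi_dn q b"
    using bounds by (simp add: R_def sin_arccos_abs jacobi_dn_def power_mult_distrib)
  then show "ring_of_beta q b r R" using r R by (simp add: ring_of_beta_def)
  have R0: "0 < R" "R \<le> pi / 2"
    using bounds sn q arccos_less_arccos[of "q * jacobi_sn q b" 1] arccos_le_pi2[of "q * jacobi_sn q b"]
    by (auto simp: R_def)
  moreover have ra: "\<bar>r\<bar> \<le> pi / 2" using am unfolding r_def atLeastAtMost_iff by linarith
  ultimately show "ring_radii q r R" using r R by (simp add: ring_radii_def)
  have "cos R \<le> cos \<bar>r\<bar>" using r R sn q by (simp add: mult_left_le_one_le)
  moreover have "cos \<bar>r\<bar> < cos R" if "R < \<bar>r\<bar>"
    by (rule cos_monotone_0_pi) (use R0 ra that pi_gt_zero in linarith)+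
  ultimately show "\<bar>r\<bar> \<le> R" by linarith
qed

text \<open>Both sides are differentiable in \<open>a\<close>, with the same derivative by the addition theorems. At
  \<open>a = 0\<close> the right triangles degenerate and both sides are \<open>\<pi> - am b - arcsin (q sn b)\<close>.\<close>

lemma kite_angle_eq_ring_g:
  assumes q: "0 < q" "q < 1" and b: "b \<in> {0..2 * ell_K q}"
    and ring: "sin r = jacobi_cn q a" "sin R = jacobi_dn q a"
    and ringb: "cos rk = jacobi_sn q b" "sin rk = jacobi_cn q b" "rk = pi / 2 - jacobi_am q b"
      "cos Rk = q * jacobi_sn q b" "sin Rk = jacobi_dn q b"
  shows "kite_angle r R rk Rk = pi + (ring_g q (a - b) - ring_g q (a + b))"
proof -
  define S C D where "S = jacobi_sn q b" and "C = jacobi_cn q b" and "D = jacobi_dn q b"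
  have am: "jacobi_am q b \<in> {0..pi}" using jacobi_am_range_iff[OF q, of b] b by simp
  then have S0: "S \<ge> 0" unfolding S_def jacobi_sn_def by (auto intro: sin_ge_zero)
  have D0: "D > 0" unfolding D_def by (rule dn_pos[OF q])
  define P where "P = (\<lambda>t. pi / 2 - arctan (jacobi_cn q t * (q * S) / D))"
  define W where "W = (\<lambda>t. arctan_tan_over rk (jacobi_dn q t))"
  have eS: "C\<^sup>2 = 1 - S\<^sup>2" "D\<^sup>2 = 1 - q\<^sup>2 * S\<^sup>2"
    using sn_cn_sq[OF q, of b] dn_sq[OF q, of b] by (auto simp: S_def C_def D_def)
  have dP: "(P has_real_derivative q * S * D * (jacobi_sn q t * jacobi_dn q t)
      / (1 - q\<^sup>2 * (jacobi_sn q t)\<^sup>2 * S\<^sup>2)) (at t)" for t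
  proof -
    define s c d where "s = jacobi_sn q t" and "c = jacobi_cn q t" and "d = jacobi_dn q t"
    have "((\<lambda>t. jacobi_cn q t * (q * S) / D) has_real_derivative - s * d * (q * S) / D) (at t)"
      unfolding s_def d_def by (intro DERIV_cdivide DERIV_cmult_right has_derivative_cn[OF q])
    from DERIV_diff[OF DERIV_const DERIV_chain'[OF this DERIV_arctan], of "pi / 2"]
    have "(P has_real_derivative 0 - inverse (1 + (c * (q * S) / D)\<^sup>2) * (- s * d * (q * S) / D)) (at t)"
      unfolding P_def c_def by (simp add: mult.commute)
    moreover have "0 - inverse (1 + (c * (q * S) / D)\<^sup>2) * (- s * d * (q * S) / D)
      = q * S * D * (s * d) / (D\<^sup>2 + c\<^sup>2 * (q * S)\<^sup>2)"
    proof -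
      have cancel: "0 - inverse (X / D\<^sup>2) * (- s * d * (q * S) / D) = q * S * D * (s * d) / X"
        if "X > 0" for X using that D0 by (simp add: power2_eq_square)
      have "1 + (c * (q * S) / D)\<^sup>2 = (D\<^sup>2 + c\<^sup>2 * (q * S)\<^sup>2) / D\<^sup>2"
        using D0 by (simp add: power_divide add_divide_distrib power_mult_distrib)
      moreover have "D\<^sup>2 + c\<^sup>2 * (q * S)\<^sup>2 > 0" using D0 by (simp add: add_pos_nonneg)
      ultimately show ?thesis by (simp only: cancel)
    qed
    moreover have "D\<^sup>2 + c\<^sup>2 * (q * S)\<^sup>2 = 1 - q\<^sup>2 * s\<^sup>2 * S\<^sup>2"
    proof -
      have c2: "c\<^sup>2 = 1 - s\<^sup>2" using sn_cn_sq[OF q, of t] by (simp add: s_def c_def)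
      show ?thesis unfolding eS power_mult_distrib c2 by (simp add: algebra_simps)
    qed
    ultimately show ?thesis by (simp add: s_def d_def)
  qed
  have dW: "(W has_real_derivative q\<^sup>2 * S * C * (jacobi_sn q t * jacobi_cn q t)
      / (1 - q\<^sup>2 * (jacobi_sn q t)\<^sup>2 * S\<^sup>2)) (at t)" for t
  proof (cases "S = 0")
    case True
    have "W = (\<lambda>t. sgn (sin rk) * (pi / 2))"
      unfolding W_def arctan_tan_over_def using True ringb(1) dn_pos[OF q]
      by (auto simp: S_def sgn_mult)
    then show ?thesis using True by simp
  next
    case False
    then have S: "S > 0" using S0 by simp
    define s c d where "s = jacobi_sn q t" and "c = jacobi_cn q t" and "d = jacobi_dn q t"
    have d0: "d > 0" unfolding d_def by (rule dn_pos[OF q])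
    have W: "W = (\<lambda>t. arctan (C / S / jacobi_dn q t))"
      unfolding W_def arctan_tan_over_def using False ringb(1,2)
      by (auto simp: S_def C_def tan_def)
    have "((\<lambda>t. C / S / jacobi_dn q t) has_real_derivative
        (0 * d - C / S * (- q\<^sup>2 * s * c)) / (d * d)) (at t)"
      unfolding s_def c_def d_def
      by (rule DERIV_divide[OF DERIV_const has_derivative_dn[OF q]]) (use d0 d_def in simp)
    from DERIV_chain'[OF this DERIV_arctan]
    have "(W has_real_derivative inverse (1 + (C / S / d)\<^sup>2) * ((0 * d - C / S * (- q\<^sup>2 * s * c)) / (d * d))) (at t)"
      unfolding W d_def by (simp add: mult.commute)
    moreover have "inverse (1 + (C / S / d)\<^sup>2) * ((0 * d - C / S * (- q\<^sup>2 * s * c)) / (d * d))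
        = q\<^sup>2 * S * C * (s * c) / (S\<^sup>2 * d\<^sup>2 + C\<^sup>2)"
    proof -
      have cancel: "inverse (X / (S\<^sup>2 * d\<^sup>2)) * ((0 * d - C / S * (- q\<^sup>2 * s * c)) / (d * d))
          = q\<^sup>2 * S * C * (s * c) / X" if "X > 0" for X
        using that S d0 by (simp add: power2_eq_square)
      have "1 + (C / S / d)\<^sup>2 = (S\<^sup>2 * d\<^sup>2 + C\<^sup>2) / (S\<^sup>2 * d\<^sup>2)"
        using S d0 by (simp add: power_divide add_divide_distrib power_mult_distrib)
      moreover have "S\<^sup>2 * d\<^sup>2 + C\<^sup>2 > 0" using S d0 by (simp add: add_pos_nonneg)
      ultimately show ?thesis by (simp only: cancel)
    qed
    moreover have "S\<^sup>2 * d\<^sup>2 + C\<^sup>2 = 1 - q\<^sup>2 * s\<^sup>2 * S\<^sup>2"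
      unfolding eS d_def s_def dn_sq[OF q] by (simp add: algebra_simps)
    ultimately show ?thesis by (simp add: s_def c_def)
  qed
  have dg: "((\<lambda>t. ring_g q (t - b) - ring_g q (t + b)) has_real_derivative
      q * jacobi_sn q t * S * (jacobi_dn q t * D + q * jacobi_cn q t * C)
     / (1 - q\<^sup>2 * (jacobi_sn q t)\<^sup>2 * S\<^sup>2)) (at t)" for t
  proof -
    have "((\<lambda>t. ring_g q (t - b)) has_real_derivative (jacobi_dn q (t - b) + q * jacobi_cn q (t - b)) / 2) (at t)"
      "((\<lambda>t. ring_g q (t + b)) has_real_derivative (jacobi_dn q (t + b) + q * jacobi_cn q (t + b)) / 2) (at t)"
      by (rule DERIV_cong[OF DERIV_chain'[OF _ has_derivative_ring_g[OF q]], of _ 1];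
          auto intro!: derivative_eq_intros)+
    from DERIV_diff[OF this] show ?thesis
      unfolding g_rate_diff[OF q] S_def C_def D_def .
  qed
  have "((\<lambda>t. P t + W t - (ring_g q (t - b) - ring_g q (t + b))) has_real_derivative 0) (at t)" for t
    by (rule DERIV_cong[OF DERIV_diff[OF DERIV_add[OF dP dW] dg]])
      (simp only: add_divide_distrib[symmetric] diff_divide_distrib[symmetric],
        simp add: algebra_simps power2_eq_square)
  from DERIV_isconst_all[OF allI[OF this], of a 0]
  have "P a + W a - (ring_g q (a - b) - ring_g q (a + b)) = P 0 + W 0 - (ring_g q (- b) - ring_g q b)"
    by simp
  moreover have "P 0 = pi / 2 - arcsin (q * S)"
    using q_sn_bounds[OF q, of b] jacobi_0[OF q]
    by (simp add: P_def arcsin_arctan S_def D_def jacobi_dn_def power_mult_distrib)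
  moreover have "W 0 = rk"
  proof (cases "cos rk = 0")
    case True
    have r: "- pi / 2 \<le> rk" "rk \<le> pi / 2" using am ringb(3) by auto
    have "rk = pi / 2 \<or> rk = - pi / 2"
      using True r cos_gt_zero_pi[of rk] by fastforce
    then show ?thesis
    proof
      assume r: "rk = pi / 2"
      show ?thesis unfolding W_def arctan_tan_over_def jacobi_0(3)[OF q] r by simp
    next
      assume r: "rk = - pi / 2"
      show ?thesis unfolding W_def arctan_tan_over_def jacobi_0(3)[OF q] r by simp
    qed
  next
    case False
    have "cos (pi / 2) = (0::real)" "cos (- pi / 2) = (0::real)" by simp_all
    with False have "rk \<noteq> pi / 2" "rk \<noteq> - pi / 2" by metis+
    then have "- (pi / 2) < rk" "rk < pi / 2" using am ringb(3) by (auto simp: less_le)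
    then show ?thesis using False jacobi_0[OF q] by (simp add: W_def arctan_tan_over_def arctan_tan)
  qed
  moreover have "2 * ring_g q b = jacobi_am q b + arcsin (q * S)"
    by (simp add: ring_g_eq[OF q] ring_angle_def[OF q] S_def)
  ultimately have "P a + W a = pi + (ring_g q (a - b) - ring_g q (a + b))"
    using ringb(3) ring_g_minus[OF q, of b] by simp
  moreover have "kite_angle r R rk Rk = P a + W a"
    unfolding kite_angle_def inner_kite_angle_def P_def W_def ring ringb(4,5) S_def D_def by simp
  ultimately show ?thesis by simp
qed

section \<open>Transport along closed walks\<close>

definition lattice_edge :: "(int \<times> int) set \<Rightarrow> int \<times> int \<Rightarrow> int \<times> int \<Rightarrow> bool" where
  "lattice_edge Q a b \<longleftrightarrow> \<bar>fst a - fst b\<bar> + \<bar>snd a - snd b\<bar> = 1 \<and> share_square Q a b"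

lemma share_square_commute: "share_square Q a b \<longleftrightarrow> share_square Q b a"
  by (auto simp: share_square_def)

lemma lattice_edge_sym: "lattice_edge Q a b \<Longrightarrow> lattice_edge Q b a"
  by (auto simp: lattice_edge_def share_square_commute)

lemma square_subset_realization:
  "(m, n) \<in> Q \<Longrightarrow> {of_int m..of_int m + 1} \<times> {of_int n..of_int n + 1} \<subseteq> realization Q"
  unfolding realization_def by blast

lemma lattice_edge_subset_realization:
  assumes "share_square Q a b"
  shows "closed_segment (of_int (fst a), of_int (snd a)) (of_int (fst b), of_int (snd b)) \<subseteq> realization Q"
proof -
  from assms obtain m n where s: "(m, n) \<in> Q" "a \<in> corners (m, n)" "b \<in> corners (m, n)"
    by (auto simp: share_square_def)
  have "closed_segment (of_int (fst a), of_int (snd a)) (of_int (fst b), of_int (snd b))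
      \<subseteq> {real_of_int m..real_of_int m + 1} \<times> {real_of_int n..real_of_int n + 1}"
    by (rule closed_segment_subset)
      (use s in \<open>auto simp: corners_def intro!: convex_Times\<close>)
  then show ?thesis using square_subset_realization[OF s(1)] by blast
qed

lemma locally_path_connected_realization:
  assumes "finite Q"
  shows "locally path_connected (realization Q)"
proof (rule ANR_imp_locally_path_connected)
  have "realization Q = \<Union> ((\<lambda>(m, n). {real_of_int m..real_of_int m + 1} \<times> {real_of_int n..real_of_int n + 1}) ` Q)"
    by (simp add: realization_def)
  moreover have "ANR \<dots>"
    by (rule ANR_finite_Union_convex_closed) (use assms in \<open>auto intro!: closed_Times convex_Times\<close>)
  ultimately show "ANR (realization Q)" by simp
qed

text \<open>The position relative to the center of a missing square does not vanish on the complex, so it has a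
  continuous logarithm there by simple connectivity. Compared with the branch of the logarithm that is
  cut along the ray to the right, this gives a function of the lattice points that changes only along
  the edges crossing the ray.\<close>

lemma crossing_potential:
  assumes "finite Q" "simply_connected (realization Q)" "(m, n) \<notin> Q"
  obtains \<kappa> :: "int \<times> int \<Rightarrow> real" where
    "\<And>i j. lattice_edge Q (i, j) (i + 1, j) \<Longrightarrow> \<kappa> (i + 1, j) = \<kappa> (i, j)"
    "\<And>i j. lattice_edge Q (i, j) (i, j + 1) \<Longrightarrow>
       \<kappa> (i, j + 1) = \<kappa> (i, j) + (if j = n \<and> m < i then 1 else 0)"
proof -
  define f where "f = (\<lambda>p. Complex (fst p - (of_int m + 1/2)) (snd p - (of_int n + 1/2)))"
  have cf: "continuous_on A f" for A unfolding f_def complex_eq_0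
    by (simp add: Complex_eq) (intro continuous_intros)
  have f0: "f p \<noteq> 0" if "p \<in> realization Q" for p
  proof
    assume "f p = 0"
    then have p: "p = (of_int m + 1/2, of_int n + 1/2)"
      by (auto simp: f_def complex_eq_iff prod_eq_iff)
    from that obtain a b where ab: "(a, b) \<in> Q" "of_int a \<le> fst p" "fst p \<le> of_int a + 1"
       "of_int b \<le> snd p" "snd p \<le> of_int b + 1"
      by (auto simp: realization_def)
    then have "a = m" "b = n" unfolding p by auto
    then show False using ab assms(3) by simp
  qed
  obtain L where cL: "continuous_on (realization Q) L" and L: "\<And>p. p \<in> realization Q \<Longrightarrow> f p = exp (L p)"
    using continuous_logarithm_on_simply_connected[OF cf assms(2) locally_path_connected_realization[OF assms(1)] f0]
    by blast
  define P where "P = (\<lambda>a::int\<times>int. (real_of_int (fst a), real_of_int (snd a)))"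
  \<comment> \<open>Along an edge, any two continuous branches of the logarithm differ by a constant.\<close>
  have branch: "L (P a) - B (f (P a)) = L (P b) - B (f (P b))"
    if e: "lattice_edge Q a b" and cB: "continuous_on (f ` closed_segment (P a) (P b)) B"
      and c: "\<And>p. p \<in> closed_segment (P a) (P b) \<Longrightarrow> exp (B (f p)) = c * f p" "c \<noteq> 0" for a b B c
  proof -
    let ?S = "closed_segment (P a) (P b)"
    have sub: "?S \<subseteq> realization Q"
      using lattice_edge_subset_realization[of Q a b] e by (auto simp: lattice_edge_def P_def)
    show ?thesis
    proof (rule continuous_exp_const_imp_const[of ?S "\<lambda>p. L p - B (f p)" "1 / c"])
      show "continuous_on ?S (\<lambda>p. L p - B (f p))"
        by (intro continuous_on_diff continuous_on_subset[OF cL sub]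
            continuous_on_compose2[OF cB cf] subset_refl)
      fix p assume "p \<in> ?S"
      then show "exp (L p - B (f p)) = 1 / c"
        using c sub L[of p] f0[of p] by (auto simp: exp_diff)
    qed auto
  qed
  define \<kappa> where "\<kappa> = (\<lambda>a. Im (L (P a) - Ln (- f (P a))) / (2 * pi))"
  have avoid: "\<kappa> a = \<kappa> b"
    if e: "lattice_edge Q a b"
      and z: "\<And>p. p \<in> closed_segment (P a) (P b) \<Longrightarrow> snd p \<noteq> of_int n + 1/2 \<or> fst p < of_int m + 1/2"
    for a b
  proof -
    have "L (P a) - Ln (- f (P a)) = L (P b) - Ln (- f (P b))"
    proof (rule branch[OF e, of "\<lambda>z. Ln (- z)" "- 1"])
      have "- z \<notin> \<real>\<^sub>\<le>\<^sub>0" if zz: "z \<in> f ` closed_segment (P a) (P b)" for z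
      proof -
        obtain p where p: "p \<in> closed_segment (P a) (P b)" "z = f p" using zz by blast
        show ?thesis using z[OF p(1)] by (auto simp: p(2) f_def complex_nonpos_Reals_iff)
      qed
      then show "continuous_on (f ` closed_segment (P a) (P b)) (\<lambda>z. Ln (- z))"
        by (intro continuous_intros) auto
      fix p assume "p \<in> closed_segment (P a) (P b)"
      then have "f p \<noteq> 0" using z[of p] by (auto simp: f_def complex_eq_iff)
      then show "exp (Ln (- f p)) = - 1 * f p" by simp
    qed auto
    then show ?thesis by (simp only: \<kappa>_def)
  qed
  show thesis
  proof (rule that[of \<kappa>])
    fix i j assume e: "lattice_edge Q (i, j) (i + 1, j)"
    have "\<kappa> (i, j) = \<kappa> (i + 1, j)"
    proof (rule avoid[OF e])
      fix p assume "p \<in> closed_segment (P (i, j)) (P (i + 1, j))"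
      then have "snd p = of_int j"
        by (auto simp: P_def closed_segment_def algebra_simps)
      moreover have "real_of_int (2 * j) \<noteq> real_of_int (2 * n + 1)"
        unfolding of_int_eq_iff by presburger
      ultimately show "snd p \<noteq> of_int n + 1/2 \<or> fst p < of_int m + 1/2" by auto
    qed
    then show "\<kappa> (i + 1, j) = \<kappa> (i, j)" by simp
  next
    fix i j assume e: "lattice_edge Q (i, j) (i, j + 1)"
    have seg: "fst p = of_int i" "of_int j \<le> snd p" "snd p \<le> of_int j + 1"
      if "p \<in> closed_segment (P (i, j)) (P (i, j + 1))" for p
      using that by (auto simp: P_def closed_segment_def algebra_simps)
    show "\<kappa> (i, j + 1) = \<kappa> (i, j) + (if j = n \<and> m < i then 1 else 0)"
    proof (cases "j = n \<and> m < i")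
      case False
      have "\<kappa> (i, j) = \<kappa> (i, j + 1)"
      proof (rule avoid[OF e])
        fix p assume "p \<in> closed_segment (P (i, j)) (P (i, j + 1))"
        note s = seg[OF this]
        from False consider "j < n" | "n < j" | "i \<le> m" by linarith
        then show "snd p \<noteq> of_int n + 1/2 \<or> fst p < of_int m + 1/2"
        proof cases
          case 1
          then have "real_of_int j + 1 \<le> of_int n" by linarith
          then show ?thesis using s by linarith
        next
          case 2
          then have "of_int n + 1 \<le> real_of_int j" by linarith
          then show ?thesis using s by linarith
        next
          case 3
          then have "real_of_int i \<le> of_int m" by linarith
          then show ?thesis using s by linarith
        qed
      qed
      then show ?thesis using False by simp
    next
      case True
      then have im: "real_of_int i \<ge> of_int m + 1" by linarith
      have re: "Re (f p) > 0" if "p \<in> closed_segment (P (i, j)) (P (i, j + 1))" for p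
        using seg[OF that] im by (simp add: f_def)
      have "L (P (i, j)) - Ln (f (P (i, j))) = L (P (i, j + 1)) - Ln (f (P (i, j + 1)))"
      proof (rule branch[OF e, of Ln 1])
        have "z \<notin> \<real>\<^sub>\<le>\<^sub>0" if zz: "z \<in> f ` closed_segment (P (i, j)) (P (i, j + 1))" for z
        proof -
          obtain p where p: "p \<in> closed_segment (P (i, j)) (P (i, j + 1))" "z = f p" using zz by blast
          show ?thesis using re[OF p(1)] by (auto simp: p(2) complex_nonpos_Reals_iff)
        qed
        then show "continuous_on (f ` closed_segment (P (i, j)) (P (i, j + 1))) Ln"
          by (intro continuous_intros) auto
        fix p assume "p \<in> closed_segment (P (i, j)) (P (i, j + 1))"
        then have "f p \<noteq> 0" using re[of p] by auto
        then show "exp (Ln (f p)) = 1 * f p" by simp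
      qed auto
      moreover have Ln: "Ln (- f (P (i, j))) = Ln (f (P (i, j))) + \<i> * pi"
        "Ln (- f (P (i, j + 1))) = Ln (f (P (i, j + 1))) - \<i> * pi"
        using True im by (subst Ln_minus; auto simp: f_def P_def complex_eq_iff)+
      ultimately have "L (P (i, j + 1)) - Ln (- f (P (i, j + 1)))
         = (L (P (i, j)) - Ln (f (P (i, j)))) + \<i> * pi" by (simp only:) simp
      also have "\<dots> = L (P (i, j)) - Ln (- f (P (i, j))) + 2 * pi * \<i>"
        unfolding Ln by simp
      finally have "L (P (i, j + 1)) - Ln (- f (P (i, j + 1)))
         = L (P (i, j)) - Ln (- f (P (i, j))) + 2 * pi * \<i>" .
      then have "Im (L (P (i, j + 1)) - Ln (- f (P (i, j + 1))))
         = Im (L (P (i, j)) - Ln (- f (P (i, j)))) + 2 * pi" by (simp only:) simp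
      then have "\<kappa> (i, j + 1) = (Im (L (P (i, j)) - Ln (- f (P (i, j)))) + 2 * pi) / (2 * pi)"
        unfolding \<kappa>_def by (simp only:)
      also have "\<dots> = \<kappa> (i, j) + 1"
        unfolding \<kappa>_def by (simp only: add_divide_distrib) simp
      finally show ?thesis using True by simp
    qed
  qed
qed

fun transport :: "('v \<Rightarrow> 'v \<Rightarrow> 'a \<Rightarrow> 'a) \<Rightarrow> 'v list \<Rightarrow> 'a \<Rightarrow> 'a" where
  "transport T (a # b # l) f = transport T (b # l) (T a b f)"
| "transport T l f = f"

lemma transport_append: "transport T (xs @ v # ys) f = transport T (v # ys) (transport T (xs @ [v]) f)"
proof (induction xs arbitrary: f)
  case IH: (Cons a xs)
  show ?case
  proof (cases xs)
    case (Cons b xs')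
    then show ?thesis using IH[of "T a b f"] by simp
  qed simp
qed simp

lemma transport_rev:
  assumes inv: "\<And>a b f. E a b \<Longrightarrow> T b a (T a b f) = f"
  shows "successively E l \<Longrightarrow> transport T (rev l) (transport T l f) = f"
proof (induction l arbitrary: f)
  case IH: (Cons a l)
  show ?case
  proof (cases l)
    case l: (Cons b l')
    have E: "E a b" "successively E l" using IH.prems by (simp_all add: l)
    have "transport T (rev (a # l)) (transport T (a # l) f)
        = transport T (rev l' @ b # [a]) (transport T l (T a b f))" by (simp add: l)
    also have "\<dots> = T b a (transport T (rev l) (transport T l (T a b f)))"
      unfolding transport_append[of T "rev l'" b "[a]"] by (simp add: l)
    also have "\<dots> = f" by (simp only: IH.IH[OF E(2)] inv[OF E(1)])
    finally show ?thesis .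
  qed simp
qed simp

text \<open>Walking back undoes the transport.\<close>

lemma transport_inj:
  assumes "\<And>a b f. E a b \<Longrightarrow> T b a (T a b f) = f" "successively E l"
    "transport T l f = transport T l g"
  shows "f = g"
proof -
  have "f = transport T (rev l) (transport T l f)"
    by (rule transport_rev[of E, symmetric]) (use assms(1,2) in blast)+
  also have "\<dots> = g"
    unfolding assms(3) by (rule transport_rev[of E]) (use assms(1,2) in blast)+
  finally show ?thesis .
qed

text \<open>A closed walk with nontrivial transport, of least length and then with the smallest coordinates,
  does not revisit a vertex, and at its rightmost, then topmost vertex it turns around a square. If the
  square belongs to the complex, the walk can be pushed across it. Otherwise the walk crosses exactly
  once the ray to the right that starts in the missing square, so the function of
  \<open>crossing_potential\<close> would not return to its initial value.\<close>

context
  fixes Q :: "(int \<times> int) set" and T :: "int \<times> int \<Rightarrow> int \<times> int \<Rightarrow> 'a \<Rightarrow> 'a"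
  assumes finite: "finite Q" and sc: "simply_connected (realization Q)"
    and inv: "\<And>a b f. lattice_edge Q a b \<Longrightarrow> T b a (T a b f) = f"
    and flat: "\<And>m n f. (m, n) \<in> Q \<Longrightarrow>
       T (m + 1, n) (m + 1, n + 1) (T (m, n) (m + 1, n) f)
       = T (m, n + 1) (m + 1, n + 1) (T (m, n) (m, n + 1) f)"
begin

lemma flat_corner:
  assumes "(m, n) \<in> Q"
  shows "T (m + 1, n) (m + 1, n + 1) (T (m, n) (m + 1, n)
      (T (m, n + 1) (m, n) (T (m + 1, n + 1) (m, n + 1) f))) = f"
    "T (m, n + 1) (m + 1, n + 1) (T (m, n) (m, n + 1)
      (T (m + 1, n) (m, n) (T (m + 1, n + 1) (m + 1, n) f))) = f"
proof -
  have "lattice_edge Q (m + 1, n + 1) (m, n + 1)" "lattice_edge Q (m, n + 1) (m, n)"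
    "lattice_edge Q (m + 1, n + 1) (m + 1, n)" "lattice_edge Q (m + 1, n) (m, n)"
    using assms by (auto simp: lattice_edge_def share_square_def corners_def intro!: bexI[of _ "(m, n)"])
  note e = this
  show "T (m + 1, n) (m + 1, n + 1) (T (m, n) (m + 1, n)
      (T (m, n + 1) (m, n) (T (m + 1, n + 1) (m, n + 1) f))) = f"
    unfolding flat[OF assms] inv[OF e(2)] inv[OF e(1)] ..
  show "T (m, n + 1) (m + 1, n + 1) (T (m, n) (m, n + 1)
      (T (m + 1, n) (m, n) (T (m + 1, n + 1) (m + 1, n) f))) = f"
    unfolding flat[OF assms, symmetric] inv[OF e(4)] inv[OF e(3)] ..
qed

lemma lattice_edge_cases:
  assumes "lattice_edge Q a b"
  obtains i j where "a = (i, j)" "b = (i + 1, j)" | i j where "a = (i + 1, j)" "b = (i, j)"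
    | i j where "a = (i, j)" "b = (i, j + 1)" | i j where "a = (i, j + 1)" "b = (i, j)"
proof -
  obtain i j k l where ab: "a = (i, j)" "b = (k, l)" by (cases a, cases b)
  have "\<bar>i - k\<bar> + \<bar>j - l\<bar> = 1" using assms by (simp add: ab lattice_edge_def)
  then consider "k = i + 1" "l = j" | "i = k + 1" "l = j" | "k = i" "l = j + 1" | "k = i" "j = l + 1"
    by linarith
  then show thesis
    using that(1)[of i j] that(2)[of k j] that(3)[of i j] that(4)[of i l] ab by cases simp_all
qed

lemma closed_walk_transport_at_extreme:
  assumes walk: "successively (lattice_edge Q) (v # m @ [v])" and "m \<noteq> []"
    and extreme: "\<And>x. x \<in> set m \<Longrightarrow> fst x < fst v \<or> fst x = fst v \<and> snd x \<le> snd v"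
    and shorter: "\<And>l f. length l < length (v # m @ [v]) \<Longrightarrow> l \<noteq> [] \<Longrightarrow> hd l = last l \<Longrightarrow>
        successively (lattice_edge Q) l \<Longrightarrow> transport T l f = f"
    and lower: "\<And>f. (fst v - 1, snd v - 1) \<in> Q \<Longrightarrow>
        successively (lattice_edge Q) ((fst v - 1, snd v - 1) # m @ [(fst v - 1, snd v - 1)]) \<Longrightarrow>
        transport T ((fst v - 1, snd v - 1) # m @ [(fst v - 1, snd v - 1)]) f = f"
  shows "transport T (v # m @ [v]) f = f"
proof (cases "distinct (v # m)")
  case False
  then obtain A B C c where dec: "v # m = A @ [c] @ B @ [c] @ C"
    using not_distinct_decomp by metis
  then have l: "v # m @ [v] = A @ c # (B @ c # (C @ [v]))" by (metis append_Cons append_assoc append_Nil)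
  have s: "successively (lattice_edge Q) (c # B @ [c])"
    "successively (lattice_edge Q) (A @ c # (C @ [v]))"
    using walk unfolding l
    by (auto simp: successively_append_iff successively_Cons hd_append split: if_splits)
  have hdA: "hd (A @ c # ys) = v" for ys using dec by (cases A) auto
  have len: "length (v # m @ [v]) = length A + length B + length C + 3" unfolding l by simp
  have t1: "transport T (c # B @ [c]) g = g" for g
    by (rule shorter[OF _ _ _ s(1)]) (use len in auto)
  have t2: "transport T (A @ c # (C @ [v])) f = f"
    by (rule shorter[OF _ _ _ s(2)]) (use len in \<open>simp_all add: hdA\<close>)
  have "transport T (A @ c # (B @ c # (C @ [v]))) f
      = transport T (c # (C @ [v])) (transport T ((c # B) @ [c]) (transport T (A @ [c]) f))"
    using transport_append[of T A c "B @ c # (C @ [v])"] transport_append[of T "c # B" c "C @ [v]"] by simp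
  also have "\<dots> = transport T (A @ c # (C @ [v])) f"
    using t1 transport_append[of T A c "C @ [v]"] by simp
  finally show ?thesis unfolding l t2 .
next
  case distinct: True
  define b d where "b = hd m" and "d = last m"
  have bd: "b \<in> set m" "d \<in> set m" using \<open>m \<noteq> []\<close> by (auto simp: b_def d_def)
  have walk': "lattice_edge Q v b" "successively (lattice_edge Q) m" "lattice_edge Q d v"
    using walk \<open>m \<noteq> []\<close> by (auto simp: successively_append_iff successively_Cons b_def d_def)
  have near: "x = (fst v - 1, snd v) \<or> x = (fst v, snd v - 1)"
    if "x \<in> set m" "lattice_edge Q v x" for x
    using extreme[OF that(1)] that distinct
    by (cases rule: lattice_edge_cases[OF that(2)]) auto
  have ends: "transport T (v # m @ [v]) f = T d v (transport T m (T v b f))" for v f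
  proof -
    have "transport T (m @ [v]) g = T d v (transport T m g)" for g
    proof -
      have m: "butlast m @ [d] = m" using \<open>m \<noteq> []\<close> by (simp add: d_def)
      then have mv: "m @ [v] = butlast m @ d # [v]" by (metis append_Cons append_Nil append_assoc)
      show ?thesis using transport_append[of T "butlast m" d "[v]" g, folded mv] unfolding m by simp
    qed
    moreover have "transport T (v # m @ [v]) f = transport T (m @ [v]) (T v b f)"
      using \<open>m \<noteq> []\<close> by (cases m) (auto simp: b_def)
    ultimately show ?thesis by simp
  qed
  show ?thesis
  proof (cases "b = d")
    case True
    then have "m = [b]" using distinct \<open>m \<noteq> []\<close> by (cases m) (auto simp: b_def d_def split: if_splits)
    then show ?thesis using inv[OF walk'(1)] True unfolding ends by simp
  next
    case False
    then have opts: "b = (fst v - 1, snd v) \<and> d = (fst v, snd v - 1) \<or>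
       b = (fst v, snd v - 1) \<and> d = (fst v - 1, snd v)"
      using near[OF bd(1) walk'(1)] near[OF bd(2) lattice_edge_sym[OF walk'(3)]] by auto
    obtain i j where v: "v = (i + 1, j + 1)" by (metis diff_add_cancel surj_pair)
    show ?thesis
    proof (cases "(i, j) \<in> Q")
      case True
      let ?w = "(i, j)"
      have e: "lattice_edge Q ?w b" "lattice_edge Q ?w d"
        using opts True by (auto simp: v lattice_edge_def share_square_def corners_def intro!: bexI[of _ "(i, j)"])
      note e' = e[THEN lattice_edge_sym]
      have "successively (lattice_edge Q) (?w # m @ [?w])"
        using walk' e e' \<open>m \<noteq> []\<close> by (auto simp: successively_append_iff successively_Cons b_def d_def)
      then have "T d ?w (transport T m (T ?w b g)) = g" for g
        using lower True unfolding v ends by simp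
      then have t: "transport T m (T ?w b g) = T ?w d g" for g
        using inv[OF e'(2), of "transport T m (T ?w b g)"] by simp
      have "transport T (v # m @ [v]) f = T d v (T ?w d (T b ?w (T v b f)))"
        unfolding ends t[symmetric] inv[OF e'(1)] ..
      also have "\<dots> = f" using opts flat_corner[OF True, of f] by (auto simp: v)
      finally show ?thesis .
    next
      case False
      obtain \<kappa> :: "int \<times> int \<Rightarrow> real" where \<kappa>:
        "\<And>i j. lattice_edge Q (i, j) (i + 1, j) \<Longrightarrow> \<kappa> (i + 1, j) = \<kappa> (i, j)"
        "\<And>i' j'. lattice_edge Q (i', j') (i', j' + 1) \<Longrightarrow>
           \<kappa> (i', j' + 1) = \<kappa> (i', j') + (if j' = j \<and> i < i' then 1 else 0)"
        using crossing_potential[OF finite sc False] by blast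
      have "\<kappa> (hd l) = \<kappa> (last l)" if "l \<noteq> []" "successively (lattice_edge Q) l" "set l \<subseteq> set m" for l
        using that
      proof (induction l)
        case (Cons x l)
        show ?case
        proof (cases l)
          case (Cons y l')
          have xy: "x \<in> set m" "y \<in> set m" "lattice_edge Q x y" using Cons Cons.prems by auto
          then have "x \<noteq> v" "y \<noteq> v" using distinct by auto
          then have "\<kappa> x = \<kappa> y"
            using extreme[OF xy(1)] extreme[OF xy(2)] lattice_edge_sym[OF xy(3)] xy(3)
            by (cases rule: lattice_edge_cases[OF xy(3)]) (auto simp: \<kappa> v)
          then show ?thesis using Cons.IH Cons Cons.prems by auto
        qed simp
      qed simp
      then have "\<kappa> b = \<kappa> d" using walk'(2) \<open>m \<noteq> []\<close> by (auto simp: b_def d_def)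
      moreover have "lattice_edge Q (i, j + 1) (i + 1, j + 1)" "lattice_edge Q (i + 1, j) (i + 1, j + 1)"
        using opts walk'(1,3) lattice_edge_sym[OF walk'(1)] lattice_edge_sym[OF walk'(3)]
        by (auto simp: v)
      ultimately show ?thesis using opts \<kappa>(1)[of i "j + 1"] \<kappa>(2)[of "i + 1" j] by (auto simp: v)
    qed
  qed
qed

lemma closed_walk_transport:
  assumes "l \<noteq> []" "hd l = last l" "successively (lattice_edge Q) l"
  shows "transport T l f = f"
proof -
  define V where "V = (\<Union>s\<in>Q. corners s)"
  have "finite V" using finite by (auto simp: V_def corners_def)
  define M where "M = Min ((\<lambda>a. fst a + snd a) ` V)"
  have M: "M \<le> fst a + snd a" if "a \<in> V" for a
    unfolding M_def using \<open>finite V\<close> that by (intro Min_le) auto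
  define weight where "weight = (\<lambda>l::(int \<times> int) list. sum_list (map (\<lambda>a. nat (fst a + snd a - M)) (tl l)))"
  have edge_V: "a \<in> V" "b \<in> V" if "lattice_edge Q a b" for a b
    using that by (auto simp: lattice_edge_def share_square_def V_def)
  show ?thesis using assms
  proof (induction l arbitrary: f rule: wf_induct_rule[OF wf_measures[of "[length, weight]"]])
    case (1 l)
    note IH = "1.IH" and ne = "1.prems"(1) and closed = "1.prems"(2) and walk = "1.prems"(3)
    have "\<exists>v\<in>set l. \<forall>x\<in>set l. fst x < fst v \<or> fst x = fst v \<and> snd x \<le> snd v"
    proof -
      define A where "A = Max (fst ` set l)"
      have "A \<in> fst ` set l" unfolding A_def using ne by (intro Max_in) auto
      define B where "B = Max (snd ` {x \<in> set l. fst x = A})"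
      have "B \<in> snd ` {x \<in> set l. fst x = A}" unfolding B_def
        using \<open>A \<in> fst ` set l\<close> by (intro Max_in) auto
      then obtain v where v: "v \<in> set l" "fst v = A" "snd v = B" by auto
      have B: "snd x \<le> B" if "x \<in> set l" "fst x = A" for x
        unfolding B_def using that by (intro Max_ge) auto
      have A: "fst x \<le> A" if "x \<in> set l" for x
        unfolding A_def using that by (intro Max_ge) auto
      have "fst x < fst v \<or> fst x = fst v \<and> snd x \<le> snd v" if "x \<in> set l" for x
        using A[OF that] B[OF that] v by linarith
      then show ?thesis using v(1) by blast
    qed
    then obtain v where v: "v \<in> set l"
      "\<And>x. x \<in> set l \<Longrightarrow> fst x < fst v \<or> fst x = fst v \<and> snd x \<le> snd v" by blast
    have core: "transport T (v # m @ [v]) f = f"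
      if w: "successively (lattice_edge Q) (v # m @ [v])" and "set m \<subseteq> set l"
        and len: "length (v # m @ [v]) = length l" and wt: "weight (v # m @ [v]) = weight l" for m f
    proof -
      have "m \<noteq> []" using w by (auto simp: lattice_edge_def)
      then show ?thesis
      proof (rule closed_walk_transport_at_extreme[OF w])
        show "fst x < fst v \<or> fst x = fst v \<and> snd x \<le> snd v" if "x \<in> set m" for x
          using v that \<open>set m \<subseteq> set l\<close> by blast
        show "transport T l' f = f" if "length l' < length (v # m @ [v])" "l' \<noteq> []" "hd l' = last l'"
          "successively (lattice_edge Q) l'" for l' f
          using that len by (intro IH) auto
        let ?w = "(fst v - 1, snd v - 1)"
        show "transport T (?w # m @ [?w]) f = f" if "?w \<in> Q" "successively (lattice_edge Q) (?w # m @ [?w])" for f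
        proof (rule IH)
          have "?w \<in> V" using that(1) by (auto simp: V_def corners_def intro!: bexI[of _ ?w])
          then have "weight (?w # m @ [?w]) < weight (v # m @ [v])"
            using M[of ?w] by (simp add: weight_def)
          then show "(?w # m @ [?w], l) \<in> measures [length, weight]"
            using len wt by simp
        qed (use that in auto)
      qed
    qed
    show ?case
    proof (cases "length l = 1")
      case True
      then show ?thesis by (auto simp: length_Suc_conv)
    next
      case False
      show ?thesis
      proof (cases "hd l = v")
        case True
        then obtain l' where l: "l = v # l'" using ne by (cases l) auto
        with False have "l' \<noteq> []" by auto
        then have "last l' = v" using closed l by simp
        then have "l = v # butlast l' @ [v]" using append_butlast_last_id[OF \<open>l' \<noteq> []\<close>] l by simp
        then obtain m where "l = v # m @ [v]" by blast
        then show ?thesis using core[of m f] walk by auto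
      next
        case no: False
        \<comment> \<open>Rotating the walk to start at the extreme vertex conjugates the transport.\<close>
        obtain xs ys where l: "l = xs @ v # ys" using v(1) by (metis split_list)
        have "xs \<noteq> []" using no l by auto
        then obtain a xs' where xs: "xs = a # xs'" by (cases xs) auto
        have "ys \<noteq> []" using closed no l xs by auto
        then have "last ys = a" using closed l xs by simp
        then have "ys = butlast ys @ [a]" using append_butlast_last_id[OF \<open>ys \<noteq> []\<close>] by simp
        then obtain ys' where ys: "ys = ys' @ [a]" by blast
        define m where "m = ys' @ a # xs'"
        have ll: "l = a # xs' @ v # ys' @ [a]" using l xs ys by simp
        have w1: "successively (lattice_edge Q) (a # xs' @ [v])"
          "successively (lattice_edge Q) (v # ys' @ [a])"
          using walk unfolding ll
          by (auto simp: successively_append_iff successively_Cons hd_append split: if_splits)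
        have w2: "successively (lattice_edge Q) (v # m @ [v])"
          using w1
          by (auto simp: m_def successively_append_iff successively_Cons hd_append split: if_splits)
        have m_sub: "set m \<subseteq> set l" by (auto simp: m_def ll)
        have split: "transport T l f = transport T (v # ys' @ [a]) (transport T (a # xs' @ [v]) f)"
          using transport_append[of T "a # xs'" v "ys' @ [a]" f] by (simp add: ll)
        have "transport T (a # xs' @ [v]) (transport T (v # ys' @ [a]) g) = g" for g
          using core[OF w2 m_sub, of g] transport_append[of T "v # ys'" a "xs' @ [v]" g]
          by (simp add: m_def ll weight_def)
        then have "transport T (a # xs' @ [v]) (transport T l f) = transport T (a # xs' @ [v]) f"
          unfolding split by simp
        then show ?thesis
          by (rule transport_inj[where E = "lattice_edge Q" and T = T, rotated 2])
            (rule inv w1(1) | assumption)+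
      qed
    qed
  qed
qed

text \<open>The transport from a fixed base vertex of each component is well defined, since two walks
  with the same ends differ by a closed walk.\<close>

theorem discrete_monodromy:
  assumes "I f0" and "\<And>a b f. lattice_edge Q a b \<Longrightarrow> I f \<Longrightarrow> I (T a b f)"
  obtains X where "\<And>a. I (X a)" "\<And>a b. lattice_edge Q a b \<Longrightarrow> X b = T a b (X a)"
proof -
  define W where "W = (\<lambda>a b l. l \<noteq> [] \<and> hd l = a \<and> last l = b \<and> successively (lattice_edge Q) l)"
  have Wapp: "W a c (l @ tl l')" if "W a b l" "W b c l'" for a b c l l'
  proof -
    note w = that
    obtain k where l': "l' = b # k" using w(2) unfolding W_def by (cases l') auto
    show ?thesis using w unfolding W_def l'
      by (cases k) (auto simp: successively_append_iff successively_Cons)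
  qed
  have Wrev: "W b a (rev l)" if "W a b l" for a b l
  proof -
    have "successively (\<lambda>x y. lattice_edge Q y x) l"
      using that unfolding W_def by (auto elim!: successively_mono intro: lattice_edge_sym)
    then show ?thesis using that unfolding W_def by (auto simp: hd_rev last_rev)
  qed
  have Wedge: "W a b [a, b]" if "lattice_edge Q a b" for a b using that by (simp add: W_def)
  have Wtr: "transport T (l @ tl l') f = transport T l' (transport T l f)" if "W a b l" "W b c l'" for a b c l l' f
  proof -
    note w = that
    have "l = butlast l @ [b]" using w(1) unfolding W_def by auto
    then obtain k where l: "l = k @ [b]" by blast
    obtain k' where l': "l' = b # k'" using w(2) unfolding W_def by (cases l') auto
    show ?thesis using transport_append[of T k b k' f] by (simp add: l l')
  qed
  have indep: "transport T l f = transport T l' f" if "W a b l" "W a b l'" for a b l l' f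
  proof -
    have w: "W b b (rev l @ tl l')" by (rule Wapp[OF Wrev[OF that(1)] that(2)])
    have "transport T l' f = transport T l' (transport T (rev l) (transport T l f))"
      using that(1) unfolding W_def
      by (subst transport_rev[where E = "lattice_edge Q" and T = T, OF inv]) auto
    also have "\<dots> = transport T (rev l @ tl l') (transport T l f)"
      by (rule Wtr[OF Wrev[OF that(1)] that(2), symmetric])
    also have "\<dots> = transport T l f"
      by (rule closed_walk_transport) (use w in \<open>auto simp: W_def\<close>)
    finally show ?thesis by simp
  qed
  define base where "base = (\<lambda>a. SOME b. \<exists>l. W b a l)"
  have base: "\<exists>l. W (base a) a l" for a
  proof -
    have "W a a [a]" by (simp add: W_def)
    then have "\<exists>b l. W b a l" by blast
    then show ?thesis unfolding base_def by (rule someI_ex)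
  qed
  define path where "path = (\<lambda>a. SOME l. W (base a) a l)"
  have path: "W (base a) a (path a)" for a
    unfolding path_def using base by (rule someI_ex)
  have inv_I: "I (transport T l f)" if "successively (lattice_edge Q) l" "I f" for l f
    using that
  proof (induction l arbitrary: f)
    case (Cons a l)
    then show ?case by (cases l) (auto intro: assms(2))
  qed simp
  define X where "X = (\<lambda>a. transport T (path a) f0)"
  show thesis
  proof (rule that[of X])
    show "I (X a)" for a using path[of a] assms(1) unfolding X_def W_def by (blast intro: inv_I)
    fix a b assume e: "lattice_edge Q a b"
    have "(\<exists>l. W c a l) \<longleftrightarrow> (\<exists>l. W c b l)" for c
      using Wapp[OF _ Wedge[OF e], of c] Wapp[OF _ Wedge[OF lattice_edge_sym[OF e]], of c] by blast
    then have bb: "base a = base b" unfolding base_def by simp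
    have "transport T (path b) f0 = transport T (path a @ tl [a, b]) f0"
      by (rule indep[OF path]) (use Wapp[OF path Wedge[OF e]] bb in simp)
    also have "\<dots> = T a b (transport T (path a) f0)"
      using Wtr[OF path Wedge[OF e]] by simp
    finally show "X b = T a b (X a)" by (simp add: X_def)
  qed
qed

end

section \<open>Moving frames on the sphere\<close>

text \<open>A frame consists of a point of the sphere, a unit tangent vector at it and the tangent vector at a
  left right angle to it. Going ahead and turning left are described relative to the frame itself, so
  that they compose like the instructions of a route, independently of where the route starts.\<close>

type_synonym frame = "(real^3) \<times> (real^3) \<times> (real^3)"

definition move :: "real \<Rightarrow> frame \<Rightarrow> frame" where
  "move \<rho> F = (case F of (x, t, n) \<Rightarrow>
     (cos \<rho> *\<^sub>R x + sin \<rho> *\<^sub>R t, cos \<rho> *\<^sub>R t - sin \<rho> *\<^sub>R x, n))"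

definition turn :: "real \<Rightarrow> frame \<Rightarrow> frame" where
  "turn \<alpha> F = (case F of (x, t, n) \<Rightarrow>
     (x, cos \<alpha> *\<^sub>R t + sin \<alpha> *\<^sub>R n, cos \<alpha> *\<^sub>R n - sin \<alpha> *\<^sub>R t))"

definition is_frame :: "frame \<Rightarrow> bool" where
  "is_frame F = (case F of (x, t, n) \<Rightarrow> norm x = 1 \<and> norm t = 1 \<and> t \<bullet> x = 0 \<and> n = cross3 x t)"

lemma turn_turn: "turn \<alpha> (turn \<beta> F) = turn (\<alpha> + \<beta>) F"
  by (auto simp: turn_def cos_add sin_add algebra_simps split: prod.splits)

lemma move_move: "move \<alpha> (move \<beta> F) = move (\<alpha> + \<beta>) F"
  by (auto simp: move_def cos_add sin_add algebra_simps split: prod.splits)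

lemma turn_0 [simp]: "turn 0 F = F"
  by (auto simp: turn_def split: prod.splits)

lemma move_0 [simp]: "move 0 F = F"
  by (auto simp: move_def split: prod.splits)

lemma turn_cong: "cos \<alpha> = cos \<beta> \<Longrightarrow> sin \<alpha> = sin \<beta> \<Longrightarrow> turn \<alpha> F = turn \<beta> F"
  by (simp add: turn_def)

lemma move_minus: "move (- \<rho>) F = turn pi (move \<rho> (turn (- pi) F))"
  by (auto simp: turn_def move_def split: prod.splits)

lemma norm_orthogonal_comb:
  fixes x t :: "'a::real_inner"
  assumes "norm x = 1" "norm t = 1" "t \<bullet> x = 0" "a\<^sup>2 + b\<^sup>2 = 1"
  shows "norm (a *\<^sub>R x + b *\<^sub>R t) = 1"
proof -
  have "(norm (a *\<^sub>R x + b *\<^sub>R t))\<^sup>2 = a\<^sup>2 * (norm x)\<^sup>2 + b\<^sup>2 * (norm t)\<^sup>2"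
    using assms(3) unfolding power2_norm_eq_inner
    by (simp add: inner_add_left inner_add_right inner_commute power2_eq_square)
  then have "(norm (a *\<^sub>R x + b *\<^sub>R t))\<^sup>2 = 1" using assms by simp
  then show ?thesis by (simp add: abs_square_eq_1)
qed

lemma is_frame_move:
  assumes "is_frame F"
  shows "is_frame (move \<rho> F)"
proof -
  obtain x t n where F: "F = (x, t, n)" by (cases F)
  have f: "norm x = 1" "norm t = 1" "t \<bullet> x = 0" "n = cross3 x t"
    using assms by (auto simp: is_frame_def F)
  have "x \<bullet> x = 1" "t \<bullet> t = 1" using f by (simp_all add: norm_eq_1)
  moreover have "norm (cos \<rho> *\<^sub>R t + (- sin \<rho>) *\<^sub>R x) = 1"
    using f by (intro norm_orthogonal_comb) (auto simp: inner_commute)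
  moreover have "norm (cos \<rho> *\<^sub>R x + sin \<rho> *\<^sub>R t) = 1"
    using f by (intro norm_orthogonal_comb) auto
  moreover have "cross3 (cos \<rho> *\<^sub>R x + sin \<rho> *\<^sub>R t) (cos \<rho> *\<^sub>R t - sin \<rho> *\<^sub>R x) = cross3 x t"
  proof -
    have "cross3 (cos \<rho> *\<^sub>R x + sin \<rho> *\<^sub>R t) (cos \<rho> *\<^sub>R t - sin \<rho> *\<^sub>R x)
        = (cos \<rho> * cos \<rho>) *\<^sub>R cross3 x t + (sin \<rho> * sin \<rho>) *\<^sub>R cross3 x t"
      using cross_skew[of t x]
      by (simp add: cross_add_left Cross3.right_diff_distrib cross_mult_left cross_mult_right)
    also have "\<dots> = (cos \<rho> * cos \<rho> + sin \<rho> * sin \<rho>) *\<^sub>R cross3 x t"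
      by (simp only: scaleR_add_left)
    finally show ?thesis by (simp only: sin_cos_squared_add3 scaleR_one)
  qed
  ultimately show ?thesis
    using f by (simp add: is_frame_def move_def F inner_add_left inner_add_right inner_diff_left inner_diff_right inner_commute)
qed

lemma is_frame_turn:
  assumes "is_frame F"
  shows "is_frame (turn \<alpha> F)"
proof -
  obtain x t n where F: "F = (x, t, n)" by (cases F)
  have f: "norm x = 1" "norm t = 1" "t \<bullet> x = 0" "n = cross3 x t"
    using assms by (auto simp: is_frame_def F)
  have xx: "x \<bullet> x = 1" "t \<bullet> t = 1" using f by (simp_all add: norm_eq_1)
  have nx: "n \<bullet> x = 0" "n \<bullet> t = 0" by (simp_all add: f(4) dot_cross_self)
  have nn: "norm n = 1"
    using norm_cross_dot[of x t] f by (simp add: inner_commute abs_square_eq_1)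
  have "norm (cos \<alpha> *\<^sub>R t + sin \<alpha> *\<^sub>R n) = 1"
    using f nn nx by (intro norm_orthogonal_comb) auto
  moreover have "cross3 x n = - t"
    using f xx by (simp add: Lagrange inner_commute)
  then have "cross3 x (cos \<alpha> *\<^sub>R t + sin \<alpha> *\<^sub>R n) = cos \<alpha> *\<^sub>R n - sin \<alpha> *\<^sub>R t"
    using f by (simp add: cross_add_right cross_mult_right)
  ultimately show ?thesis
    using f nx by (simp add: is_frame_def turn_def F inner_add_left)
qed

text \<open>The legs of a right triangle and its hypotenuse are two routes from one acute angle to the other. The
  assumptions are the rules for a right spherical triangle with the hypotenuse \<open>D\<close>, the legs \<open>a\<close> and
  \<open>b\<close>, and the angles \<open>\<phi>\<close> and \<open>\<phi>'\<close>; the sign of a leg is the sign of the angle opposite to it.\<close>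

lemma right_triangle:
  assumes cD: "cos D = cos a * cos b" and N: "sin D \<noteq> 0"
    and \<phi>: "sin D * cos \<phi> = sin a * cos b" "sin D * sin \<phi> = sin b"
    and \<phi>': "sin D * cos \<phi>' = sin b * cos a" "sin D * sin \<phi>' = sin a"
  shows "move b (turn (pi / 2) (move a F)) = turn \<phi>' (move D (turn \<phi> F))"
proof -
  obtain x t n where F: "F = (x, t, n)" by (cases F)
  let ?N = "sin D"
  have "?N\<^sup>2 = 1 - (cos D)\<^sup>2" by (simp add: sin_squared_eq)
  then have N2: "?N * ?N = 1 - cos a * cos a * (cos b * cos b)"
    by (simp add: cD power2_eq_square mult_ac)
  have sq: "sin a * sin a = 1 - cos a * cos a" "sin b * sin b = 1 - cos b * cos b"
    using sin_squared_eq[of a] sin_squared_eq[of b] by (simp_all add: power2_eq_square)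
  have cancel: "y = z" if "?N * ?N * y = ?N * ?N * z" for y z using that N by simp
  have e1: "cos \<phi>' * cos D * cos \<phi> - sin \<phi>' * sin \<phi> = - sin b * sin a"
  proof (rule cancel)
    have "?N * ?N * (cos \<phi>' * cos D * cos \<phi> - sin \<phi>' * sin \<phi>)
       = (?N * cos \<phi>') * (?N * cos \<phi>) * cos D - (?N * sin \<phi>') * (?N * sin \<phi>)"
      by (simp add: algebra_simps)
    also have "\<dots> = - sin b * sin a * (1 - cos a * cos a * (cos b * cos b))"
      unfolding \<phi> \<phi>' cD by (simp add: algebra_simps)
    finally show "?N * ?N * (cos \<phi>' * cos D * cos \<phi> - sin \<phi>' * sin \<phi>) = ?N * ?N * (- sin b * sin a)"
      unfolding N2 by simp
  qed
  have e2: "cos \<phi>' * cos D * sin \<phi> + sin \<phi>' * cos \<phi> = cos b"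
  proof (rule cancel)
    have "?N * ?N * (cos \<phi>' * cos D * sin \<phi> + sin \<phi>' * cos \<phi>)
       = (?N * cos \<phi>') * (?N * sin \<phi>) * cos D + (?N * sin \<phi>') * (?N * cos \<phi>)"
      by (simp add: algebra_simps)
    also have "\<dots> = cos b * ((sin b * sin b) * (cos a * cos a) + sin a * sin a)"
      unfolding \<phi> \<phi>' cD by (simp add: algebra_simps)
    also have "\<dots> = ?N * ?N * cos b" unfolding sq N2 by (simp add: algebra_simps)
    finally show "?N * ?N * (cos \<phi>' * cos D * sin \<phi> + sin \<phi>' * cos \<phi>) = ?N * ?N * cos b" .
  qed
  have e3: "cos \<phi>' * sin \<phi> + sin \<phi>' * cos D * cos \<phi> = cos a"
  proof (rule cancel)
    have "?N * ?N * (cos \<phi>' * sin \<phi> + sin \<phi>' * cos D * cos \<phi>)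
       = (?N * cos \<phi>') * (?N * sin \<phi>) + (?N * sin \<phi>') * (?N * cos \<phi>) * cos D"
      by (simp add: algebra_simps)
    also have "\<dots> = cos a * (sin b * sin b + (sin a * sin a) * (cos b * cos b))"
      unfolding \<phi> \<phi>' cD by (simp add: algebra_simps)
    also have "\<dots> = ?N * ?N * cos a" unfolding sq N2 by (simp add: algebra_simps)
    finally show "?N * ?N * (cos \<phi>' * sin \<phi> + sin \<phi>' * cos D * cos \<phi>) = ?N * ?N * cos a" .
  qed
  have "cos \<phi>' * cos \<phi> = sin \<phi>' * cos D * sin \<phi>"
  proof (rule cancel)
    have "?N * ?N * (cos \<phi>' * cos \<phi>) = (?N * cos \<phi>') * (?N * cos \<phi>)" by (simp add: algebra_simps)
    also have "\<dots> = (?N * sin \<phi>') * (?N * sin \<phi>) * cos D"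
      unfolding \<phi> \<phi>' cD by (simp add: algebra_simps)
    finally show "?N * ?N * (cos \<phi>' * cos \<phi>) = ?N * ?N * (sin \<phi>' * cos D * sin \<phi>)"
      by (simp add: algebra_simps)
  qed
  then have e4: "cos \<phi>' * cos \<phi> - sin \<phi>' * cos D * sin \<phi> = 0" by simp
  have "turn \<phi>' (move D (turn \<phi> F)) =
    (cos D *\<^sub>R x + (sin D * cos \<phi>) *\<^sub>R t + (sin D * sin \<phi>) *\<^sub>R n,
     (- (sin D * cos \<phi>')) *\<^sub>R x + (cos \<phi>' * cos D * cos \<phi> - sin \<phi>' * sin \<phi>) *\<^sub>R t
       + (cos \<phi>' * cos D * sin \<phi> + sin \<phi>' * cos \<phi>) *\<^sub>R n,
     (sin D * sin \<phi>') *\<^sub>R x - (cos \<phi>' * sin \<phi> + sin \<phi>' * cos D * cos \<phi>) *\<^sub>R t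
       + (cos \<phi>' * cos \<phi> - sin \<phi>' * cos D * sin \<phi>) *\<^sub>R n)"
    by (simp add: F turn_def move_def algebra_simps)
  also have "\<dots> = move b (turn (pi / 2) (move a F))"
    unfolding e1 e2 e3 e4 unfolding \<phi> \<phi>' cD by (simp add: F turn_def move_def algebra_simps)
  finally show ?thesis ..
qed

definition reflect :: "frame \<Rightarrow> frame" where
  "reflect F = (case F of (x, t, n) \<Rightarrow> (x, t, - n))"

lemma reflect_simps:
  "reflect (turn \<alpha> F) = turn (- \<alpha>) (reflect F)" "reflect (move \<rho> F) = move \<rho> (reflect F)"
  "reflect (reflect F) = F"
  by (auto simp: reflect_def turn_def move_def split: prod.splits)

lemma right_triangle_mirror:
  assumes "cos D = cos a * cos b" "sin D \<noteq> 0"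
    and "sin D * cos \<phi> = sin a * cos b" "sin D * sin \<phi> = sin b"
    and "sin D * cos \<phi>' = sin b * cos a" "sin D * sin \<phi>' = sin a"
  shows "move b (turn (- pi / 2) (move a F)) = turn (- \<phi>') (move D (turn (- \<phi>) F))"
  using arg_cong[OF right_triangle[OF assms, of "reflect F"], of reflect] by (simp add: reflect_simps)

text \<open>Both routes along the sides of the kite agree with the route along the diagonal, which has one of
  the triangles on either side.\<close>

lemma kite_closes:
  assumes N: "sin D \<noteq> 0"
    and ab: "cos D = cos a * cos b" and cd: "cos D = cos d * cos c"
    and \<phi>: "sin D * cos \<phi> = sin a * cos b" "sin D * sin \<phi> = sin b"
    and \<phi>': "sin D * cos \<phi>' = sin b * cos a" "sin D * sin \<phi>' = sin a"
    and \<psi>: "sin D * cos \<psi> = sin d * cos c" "sin D * sin \<psi> = sin c"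
    and \<psi>': "sin D * cos \<psi>' = sin c * cos d" "sin D * sin \<psi>' = sin d"
  shows "move b (turn (pi / 2) (move a F))
    = turn (\<phi>' + \<psi>') (move c (turn (- pi / 2) (move d (turn (\<phi> + \<psi>) F))))"
  unfolding right_triangle[OF ab N \<phi> \<phi>'] right_triangle_mirror[OF cd N \<psi> \<psi>']
  by (simp add: turn_turn)

lemma frame_eqI:
  assumes "is_frame F" "is_frame G" "fst F = fst G" "fst (move D F) = fst (move D G)" "sin D \<noteq> 0"
  shows "F = G"
  using assms by (auto simp: is_frame_def move_def split: prod.splits)

text \<open>The direction to the opposite vertex of the kite is at the angle \<open>\<phi>\<close> from the first frame and at the
  angle \<open>- \<psi>\<close> from the second.\<close>

lemma kite_angle_between_frames:
  assumes N: "sin D \<noteq> 0"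
    and ab: "cos D = cos a * cos b" and cd: "cos D = cos d * cos c"
    and \<phi>: "sin D * cos \<phi> = sin a * cos b" "sin D * sin \<phi> = sin b"
    and \<phi>': "sin D * cos \<phi>' = sin b * cos a" "sin D * sin \<phi>' = sin a"
    and \<psi>: "sin D * cos \<psi> = sin d * cos c" "sin D * sin \<psi> = sin c"
    and \<psi>': "sin D * cos \<psi>' = sin c * cos d" "sin D * sin \<psi>' = sin d"
    and F: "is_frame F" and G: "is_frame G" and "fst F = fst G"
    and w: "fst (move b (turn (pi / 2) (move a F))) = fst (move c (turn (- pi / 2) (move d G)))"
  shows "G = turn (\<phi> + \<psi>) F"
proof -
  have t: "fst (turn \<alpha> H) = fst H" for \<alpha> H by (simp add: turn_def split: prod.splits)
  have "turn \<phi> F = turn (- \<psi>) G"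
  proof (rule frame_eqI[OF is_frame_turn[OF F] is_frame_turn[OF G] _ _ N])
    show "fst (turn \<phi> F) = fst (turn (- \<psi>) G)" using assms by (simp add: t)
    show "fst (move D (turn \<phi> F)) = fst (move D (turn (- \<psi>) G))"
      using w unfolding right_triangle[OF ab N \<phi> \<phi>'] right_triangle_mirror[OF cd N \<psi> \<psi>'] t .
  qed
  then have "turn \<psi> (turn \<phi> F) = G" by (simp add: turn_turn)
  then show ?thesis by (simp add: turn_turn add.commute)
qed

text \<open>Both frames assign the same coordinates to the two points and hence to their cross product. These
  three vectors form a basis, because the scalar product of the two points is \<open>cos R cos r\<close>, which is
  neither \<open>1\<close> nor \<open>- 1\<close>.\<close>

lemma frame_from_two_points:
  fixes y t n y' t' n' :: "real^3"
  assumes f: "is_frame (y, t, n)" "is_frame (y', t', n')"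
    and p: "cos R *\<^sub>R y - sin R *\<^sub>R n = cos R *\<^sub>R y' - sin R *\<^sub>R n'" (is "?p = ?p'")
    and w: "cos r *\<^sub>R y + sin r *\<^sub>R t = cos r *\<^sub>R y' + sin r *\<^sub>R t'" (is "?w = ?w'")
    and R: "sin R \<noteq> 0" and D: "(cos R * cos r)\<^sup>2 < 1"
  shows "(y, t, n) = (y', t', n')"
proof -
  have cr: "cross3 (cos R *\<^sub>R y - sin R *\<^sub>R n) (cos r *\<^sub>R y + sin r *\<^sub>R t)
      = (sin R * sin r) *\<^sub>R y - (sin R * cos r) *\<^sub>R t + (cos R * sin r) *\<^sub>R n"
    if "is_frame (y, t, n)" for y t n :: "real^3"
  proof -
    have g: "norm y = 1" "norm t = 1" "t \<bullet> y = 0" "n = cross3 y t"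
      using that by (auto simp: is_frame_def)
    have s: "y \<bullet> y = 1" "t \<bullet> t = 1" using g by (simp_all add: norm_eq_1)
    have yn: "cross3 y n = - t" unfolding g(4) using g s by (simp add: Lagrange inner_commute)
    have tn: "cross3 t n = y" unfolding g(4) using g s by (simp add: Lagrange inner_commute)
    have ny: "cross3 n y = t" "cross3 n t = - y" using yn tn cross_skew[of n y] cross_skew[of n t] by simp_all
    show ?thesis
      by (simp add: Cross3.left_diff_distrib cross_add_right cross_mult_left cross_mult_right ny g(4)[symmetric]
          algebra_simps)
  qed
  define a b c where "a = y - y'" and "b = t - t'" and "c = n - n'"
  have 1: "cos R *\<^sub>R a = sin R *\<^sub>R c" using p by (simp add: a_def c_def algebra_simps)
  have 2: "cos r *\<^sub>R a = - (sin r *\<^sub>R b)" using w by (simp add: a_def b_def algebra_simps)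
  then have bt: "sin r *\<^sub>R b = - (cos r *\<^sub>R a)" by simp
  have 3: "(sin R * sin r) *\<^sub>R a - (sin R * cos r) *\<^sub>R b + (cos R * sin r) *\<^sub>R c = 0"
    using cr[OF f(1)] cr[OF f(2)] unfolding p w by (simp add: a_def b_def c_def algebra_simps)
  have "0 = (sin R * sin r) *\<^sub>R ((sin R * sin r) *\<^sub>R a - (sin R * cos r) *\<^sub>R b + (cos R * sin r) *\<^sub>R c)"
    by (simp only: 3 scaleR_zero_right)
  also have "\<dots> = (sin R * sin R * sin r * sin r) *\<^sub>R a - (sin R * sin R * cos r) *\<^sub>R (sin r *\<^sub>R b)
      + (cos R * sin r * sin r) *\<^sub>R (sin R *\<^sub>R c)"
    by (simp add: algebra_simps)
  also have "\<dots> = (sin R * sin R * (sin r * sin r + cos r * cos r) + cos R * cos R * (sin r * sin r)) *\<^sub>R a"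
  proof -
    have "(S * S * s * s) *\<^sub>R a - (S * S * c) *\<^sub>R (- (c *\<^sub>R a)) + (C * s * s) *\<^sub>R (C *\<^sub>R a)
        = (S * S * (s * s + c * c) + C * C * (s * s)) *\<^sub>R a" for S s C c :: real
      by (simp add: algebra_simps)
    then show ?thesis unfolding 1[symmetric] bt .
  qed
  also have "sin R * sin R * (sin r * sin r + cos r * cos r) + cos R * cos R * (sin r * sin r) = 1 - (cos R * cos r)\<^sup>2"
  proof -
    have s: "sin R * sin R = 1 - cos R * cos R" "sin r * sin r = 1 - cos r * cos r"
      using sin_squared_eq[of R] sin_squared_eq[of r] by (simp_all add: power2_eq_square)
    show ?thesis unfolding s by (simp add: algebra_simps power2_eq_square)
  qed
  finally have a: "a = 0" using D by simp
  then have c: "c = 0" using 1 R by simp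
  have "b = 0"
  proof (cases "sin r = 0")
    case True
    then have "cos r \<noteq> 0" using sin_cos_squared_add[of r] by auto
    then show ?thesis using 3 a c R by simp
  next
    case False
    then show ?thesis using 2 a by simp
  qed
  with a c show ?thesis by (simp add: a_def b_def c_def)
qed

lemma tangent_rot_turn: "is_frame (p, u, n) \<Longrightarrow> tangent_rot p u a = fst (snd (turn a (p, u, n)))"
  by (simp add: tangent_rot_def turn_def is_frame_def)

lemma tangent_rot_eq_iff:
  assumes "is_frame (p, u, n)"
  shows "tangent_rot p u a = tangent_rot p u b \<longleftrightarrow> cos a = cos b \<and> sin a = sin b"
proof
  have f: "u \<bullet> u = 1" "norm p = 1" "u \<bullet> p = 0" using assms by (auto simp: is_frame_def norm_eq_1)
  have un: "u \<bullet> cross3 p u = 0" by (simp add: dot_cross_self)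
  have "norm (cross3 p u) = 1"
    using norm_cross_dot[of p u] f by (simp add: inner_commute norm_eq_1 abs_square_eq_1)
  then have nn: "cross3 p u \<bullet> cross3 p u = 1" by (simp add: norm_eq_1)
  have i: "tangent_rot p u c \<bullet> u = cos c" "tangent_rot p u c \<bullet> cross3 p u = sin c" for c
    using f un nn by (simp_all add: tangent_rot_def inner_add_left inner_add_right inner_commute)
  assume "tangent_rot p u a = tangent_rot p u b"
  then show "cos a = cos b \<and> sin a = sin b" using i by metis
qed (simp add: tangent_rot_def)

lemma cos_eq_1_0_pi: "cos (x::real) = 1 \<Longrightarrow> 0 \<le> x \<Longrightarrow> x \<le> pi \<Longrightarrow> x = 0"
  by (metis cos_zero cos_inj_pi order_refl pi_ge_zero)

lemma cos_eq_minus1_0_2pi: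
  assumes "cos (x::real) = -1" "0 \<le> x" "x \<le> 2 * pi"
  shows "x = pi"
proof -
  have "cos (x - pi) = 1" using assms by simp
  then have "cos \<bar>x - pi\<bar> = 1" by simp
  from cos_eq_1_0_pi[OF this] assms show ?thesis by simp
qed

text \<open>The sum can only be \<open>0\<close>, \<open>2\<pi>\<close> or \<open>4\<pi>\<close>. It is \<open>0\<close> if the four directions agree and \<open>4\<pi>\<close> if each of
  them is opposite to the next, and in neither case they are in counter-clockwise order.\<close>

lemma ccw_order_iff_sum:
  assumes f: "is_frame (p, u0, n)"
    and u: "u1 = tangent_rot p u0 a" "u2 = tangent_rot p u0 (a + b)" "u3 = tangent_rot p u0 (a + b + c)"
    and range: "a \<in> {0..pi}" "b \<in> {0..pi}" "c \<in> {0..pi}" "d \<in> {0..pi}"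
    and closed: "cos (a + b + c + d) = 1"
  shows "ccw_order p u0 u1 u2 u3 \<longleftrightarrow> a + b + c + d = 2 * pi"
proof
  note eq = tangent_rot_eq_iff[OF f]
  have u0: "u0 = tangent_rot p u0 0" by (simp add: tangent_rot_def)
  assume sum: "a + b + c + d = 2 * pi"
  have "\<not> (u1 = u0 \<and> u2 = u0 \<and> u3 = u0)"
  proof
    assume "u1 = u0 \<and> u2 = u0 \<and> u3 = u0"
    then have c1: "cos a = 1" "cos (a + b) = 1" "cos (a + b + c) = 1"
      using u u0 eq[of _ 0] by auto
    then have "a = 0" using range by (intro cos_eq_1_0_pi) auto
    with c1 have "b = 0" using range by (intro cos_eq_1_0_pi) auto
    with c1 \<open>a = 0\<close> have "c = 0" using range by (intro cos_eq_1_0_pi) auto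
    then show False using sum range \<open>a = 0\<close> \<open>b = 0\<close> pi_gt_zero by simp
  qed
  then show "ccw_order p u0 u1 u2 u3"
    unfolding ccw_order_def using range sum
    by (intro conjI exI[of _ a] exI[of _ "a + b"] exI[of _ "a + b + c"] u) auto
next
  note eq = tangent_rot_eq_iff[OF f]
  assume ord: "ccw_order p u0 u1 u2 u3"
  obtain k :: int where k: "a + b + c + d = of_int k * (2 * pi)"
    using closed unfolding cos_one_2pi_int by (auto simp: mult.assoc)
  have "0 \<le> a + b + c + d" "a + b + c + d \<le> 4 * pi" using range by auto
  then have "0 \<le> real_of_int k" "real_of_int k \<le> 2"
    using pi_gt_zero unfolding k by (auto simp: zero_le_mult_iff)
  then have "k = 0 \<or> k = 1 \<or> k = 2" by linarith
  moreover have "k \<noteq> 0"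
  proof
    assume "k = 0"
    then have "a = 0" "b = 0" "c = 0" using k range by auto
    then have "u1 = u0 \<and> u2 = u0 \<and> u3 = u0" using u by (simp add: tangent_rot_def)
    then show False using ord by (simp add: ccw_order_def)
  qed
  moreover have "k \<noteq> 2"
  proof
    assume "k = 2"
    then have ab: "a = pi" "b = pi" "c = pi" using k range by auto
    obtain x y z where xyz: "0 \<le> x" "x \<le> y" "y \<le> z" "z \<le> 2 * pi"
      "u1 = tangent_rot p u0 x" "u2 = tangent_rot p u0 y" "u3 = tangent_rot p u0 z"
      using ord unfolding ccw_order_def by blast
    have "cos x = cos a" "cos y = cos (a + b)" "cos z = cos (a + b + c)"
      using xyz u eq by metis+
    then have cs: "cos x = -1" "cos y = 1" "cos z = -1" unfolding ab by (simp_all add: cos_add)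
    have "x = pi" "z = pi" using cos_eq_minus1_0_2pi cs xyz by auto
    then have "y = pi" using xyz by simp
    then show False using cs by simp
  qed
  ultimately show "a + b + c + d = 2 * pi" using k by auto
qed

section \<open>Directions and squares of the lattice\<close>

text \<open>Directions are numbered counter-clockwise and modulo \<open>4\<close>, so that one statement covers all four
  positions of a square at a vertex.\<close>

definition dir :: "nat \<Rightarrow> int \<times> int" where
  "dir k = (if k mod 4 = 0 then (1, 0) else if k mod 4 = 1 then (0, 1)
     else if k mod 4 = 2 then (- 1, 0) else (0, - 1))"

text \<open>The square at \<open>v\<close> between the directions \<open>k\<close> and \<open>k + 1\<close>, given by its lower left corner.\<close>

definition quadrant :: "int \<times> int \<Rightarrow> nat \<Rightarrow> int \<times> int" where
  "quadrant v k = v + (if k mod 4 = 0 then (0, 0) else if k mod 4 = 1 then (- 1, 0)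
     else if k mod 4 = 2 then (- 1, - 1) else (0, - 1))"

definition diag :: "int \<times> int \<Rightarrow> nat \<Rightarrow> int \<times> int" where
  "diag v k = v + dir k + dir (k + 1)"

lemma less_4_cases:
  assumes "k < (4::nat)" "P 0" "P 1" "P 2" "P 3"
  shows "P k"
proof -
  have "k = 0 \<or> k = 1 \<or> k = 2 \<or> k = 3" using assms(1) by linarith
  then show ?thesis using assms by auto
qed

lemma mod_4_cases:
  assumes "P 0" "P 1" "P 2" "P (3::nat)" "\<And>k. P k \<Longrightarrow> P (k + 4)"
  shows "P k"
proof (induction k rule: less_induct)
  case (less k)
  show ?case
  proof (cases "k < 4")
    case True
    then show ?thesis by (rule less_4_cases) (use assms in auto)
  next
    case False
    then show ?thesis using less.IH[of "k - 4"] assms(5)[of "k - 4"] by simp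
  qed
qed

lemma dir_4 [simp]: "dir (k + 4) = dir k" and quadrant_4 [simp]: "quadrant v (k + 4) = quadrant v k"
  by (simp_all add: dir_def quadrant_def)

lemma dir_add_4: "dir (k + 4 + j) = dir (k + j)"
  and quadrant_add_4: "quadrant v (k + 4 + j) = quadrant v (k + j)"
proof -
  have "(k + 4 + j) mod 4 = (k + j) mod 4" by presburger
  then show "dir (k + 4 + j) = dir (k + j)" "quadrant v (k + 4 + j) = quadrant v (k + j)"
    by (simp_all add: dir_def quadrant_def)
qed

text \<open>A square in quadrant \<open>k\<close> of \<open>v\<close> lies in quadrant \<open>k + 2\<close> of the opposite vertex.\<close>

lemma diag_swap:
  "quadrant (diag v k) (k + 2) = quadrant v k" "diag (diag v k) (k + 2) = v"
  "diag v k + dir (k + 3) = v + dir k" "diag v k + dir (k + 2) = v + dir (k + 1)"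
proof -
  have "quadrant (diag v k) (k + 2) = quadrant v k \<and> diag (diag v k) (k + 2) = v \<and>
    diag v k + dir (k + 3) = v + dir k \<and> diag v k + dir (k + 2) = v + dir (k + 1)"
  proof (induction k rule: mod_4_cases)
    case (5 k)
    have "diag w (k + 4) = diag w k" "diag w (k + 4 + 2) = diag w (k + 2)" for w
      using dir_add_4[of k 2] dir_add_4[of k "2 + 1"] dir_add_4[of k 0] dir_add_4[of k 1]
      by (simp_all only: diag_def add.assoc add_0_right)
    then show ?case using 5 by (simp only: dir_add_4 quadrant_add_4 dir_4 quadrant_4)
  qed (cases v; simp add: dir_def quadrant_def diag_def)+
  then show "quadrant (diag v k) (k + 2) = quadrant v k" "diag (diag v k) (k + 2) = v"
    "diag v k + dir (k + 3) = v + dir k" "diag v k + dir (k + 2) = v + dir (k + 1)" by auto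
qed

lemma quadrant_corners:
  "v \<in> corners (quadrant v k)" "v + dir k \<in> corners (quadrant v k)"
  "v + dir (k + 1) \<in> corners (quadrant v k)" "diag v k \<in> corners (quadrant v k)"
proof -
  have "v \<in> corners (quadrant v k) \<and> v + dir k \<in> corners (quadrant v k) \<and>
    v + dir (k + 1) \<in> corners (quadrant v k) \<and> diag v k \<in> corners (quadrant v k)"
  proof (induction k rule: mod_4_cases)
    case (5 k)
    then show ?case using 5 by (simp only: diag_def dir_add_4 dir_4 quadrant_4)
  qed (cases v; simp add: dir_def quadrant_def diag_def corners_def)+
  then show "v \<in> corners (quadrant v k)" "v + dir k \<in> corners (quadrant v k)"
  "v + dir (k + 1) \<in> corners (quadrant v k)" "diag v k \<in> corners (quadrant v k)" by auto
qed

abbreviation even_vertex :: "int \<times> int \<Rightarrow> bool" where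
  "even_vertex v \<equiv> even (fst v + snd v)"

lemma even_vertex_dir: "even_vertex (v + dir k) \<longleftrightarrow> \<not> even_vertex v"
  by (auto simp: dir_def)

lemma even_vertex_diag: "even_vertex (diag v k) \<longleftrightarrow> even_vertex v"
  unfolding diag_def even_vertex_dir by simp

lemma G_vertices_iff: "v \<in> G_vertices Q \<longleftrightarrow> even_vertex v \<and> (\<exists>s\<in>Q. v \<in> corners s)"
  by (cases v) (auto simp: G_vertices_def)

lemma Gstar_vertices_iff: "v \<in> Gstar_vertices Q \<longleftrightarrow> \<not> even_vertex v \<and> (\<exists>s\<in>Q. v \<in> corners s)"
  by (cases v) (auto simp: Gstar_vertices_def)

lemma quadrant_vertices:
  assumes "quadrant v k \<in> Q" "even_vertex v"
  shows "v \<in> G_vertices Q" "diag v k \<in> G_vertices Q"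
    "v + dir k \<in> Gstar_vertices Q" "v + dir (k + 1) \<in> Gstar_vertices Q"
  using assms quadrant_corners[of v k] even_vertex_dir[of v k] even_vertex_dir[of v "k + 1"] even_vertex_diag[of v k]
  unfolding G_vertices_iff Gstar_vertices_iff by blast+

lemma share_square_quadrant:
  assumes "quadrant v k \<in> Q"
  shows "share_square Q (v + dir k) v" "share_square Q (v + dir (k + 1)) v"
    "share_square Q (v + dir k) (diag v k)" "share_square Q (v + dir (k + 1)) (diag v k)"
  using assms quadrant_corners[of v k] unfolding share_square_def by blast+

lemma neighboring_iff:
  assumes "even_vertex v"
  shows "neighboring Q v w \<longleftrightarrow> (\<exists>k<4. w = diag v k \<and> quadrant v k \<in> Q)"
proof
  assume n: "neighboring Q v w"
  then obtain s where s: "s \<in> Q" "v \<in> corners s" "w \<in> corners s"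
    and d: "\<bar>fst v - fst w\<bar> = 1" "\<bar>snd v - snd w\<bar> = 1"
    by (auto simp: neighboring_def share_square_def)
  obtain a b c d' where vw: "v = (a, b)" "w = (c, d')" by (cases v, cases w)
  have "fst s = min a c" "snd s = min b d'" using s d by (auto simp: vw corners_def)
  then have se: "s = (min a c, min b d')" by (simp add: prod_eq_iff)
  have "(c = a + 1 \<or> c = a - 1) \<and> (d' = b + 1 \<or> d' = b - 1)" using d by (auto simp: vw)
  then have "w = diag v 0 \<and> s = quadrant v 0 \<or> w = diag v 1 \<and> s = quadrant v 1 \<or>
     w = diag v 2 \<and> s = quadrant v 2 \<or> w = diag v 3 \<and> s = quadrant v 3"
    by (elim conjE disjE) (simp_all add: se vw diag_def dir_def quadrant_def)
  then show "\<exists>k<4. w = diag v k \<and> quadrant v k \<in> Q"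
    using s(1) by (elim disjE) (auto intro: exI[of _ 0] exI[of _ 1] exI[of _ 2] exI[of _ 3])
next
  assume "\<exists>k<4. w = diag v k \<and> quadrant v k \<in> Q"
  then obtain k where k: "k < 4" "w = diag v k" "quadrant v k \<in> Q" by blast
  have "\<bar>fst v - fst (diag v k)\<bar> = 1 \<and> \<bar>snd v - snd (diag v k)\<bar> = 1"
    by (rule less_4_cases[OF k(1)]) (simp_all add: diag_def dir_def)
  moreover have "share_square Q v (diag v k)"
    using quadrant_corners[of v k] k(3) unfolding share_square_def by blast
  ultimately show "neighboring Q v w"
    using quadrant_vertices[OF k(3) assms] by (simp add: neighboring_def k(2))
qed

lemma inj_on_diag: "inj_on (diag v) {..<4}"
proof (rule inj_onI)
  fix j k assume "j \<in> {..<4::nat}" "k \<in> {..<4}" "diag v j = diag v k"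
  then show "j = k"
  proof -
    have "dir j + dir (j + 1) = dir k + dir (k + 1)" using \<open>diag v j = diag v k\<close> by (simp add: diag_def add.assoc)
    moreover have "j = 0 \<or> j = 1 \<or> j = 2 \<or> j = 3" "k = 0 \<or> k = 1 \<or> k = 2 \<or> k = 3"
      using \<open>j \<in> _\<close> \<open>k \<in> _\<close> by auto
    ultimately show ?thesis by (elim disjE) (simp_all add: dir_def)
  qed
qed

lemma neighbors_eq:
  assumes "even_vertex v"
  shows "neighbors Q v = diag v ` {k. k < 4 \<and> quadrant v k \<in> Q}"
  unfolding neighbors_def neighboring_iff[OF assms] by auto

lemma card_neighbors:
  assumes "even_vertex v"
  shows "card (neighbors Q v) = card {k. k < 4 \<and> quadrant v k \<in> Q}"
  unfolding neighbors_eq[OF assms]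
  by (rule card_image) (rule inj_on_subset[OF inj_on_diag], auto)

lemma inner_vertices_iff:
  "v \<in> inner_vertices Q \<longleftrightarrow> even_vertex v \<and> (\<forall>k<4. quadrant v k \<in> Q)"
proof
  assume v: "v \<in> inner_vertices Q"
  then have e: "even_vertex v" and c: "card {k. k < 4 \<and> quadrant v k \<in> Q} = card {..<4::nat}"
    using card_neighbors[of v Q] by (auto simp: inner_vertices_def G_vertices_iff)
  then have "{k. k < 4 \<and> quadrant v k \<in> Q} = {..<4::nat}"
    by (intro card_subset_eq) auto
  then show "even_vertex v \<and> (\<forall>k<4. quadrant v k \<in> Q)" using e by blast
next
  assume a: "even_vertex v \<and> (\<forall>k<4. quadrant v k \<in> Q)"
  then have "{k. k < 4 \<and> quadrant v k \<in> Q} = {..<4::nat}" by auto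
  then have "card (neighbors Q v) = 4" using card_neighbors[of v Q] a by simp
  moreover have "v \<in> G_vertices Q" using a quadrant_vertices(1)[of v 0 Q] by simp
  ultimately show "v \<in> inner_vertices Q" by (simp add: inner_vertices_def)
qed

lemma inner_or_boundary:
  assumes "v \<in> G_vertices Q"
  shows "v \<in> inner_vertices Q \<or> v \<in> boundary_vertices Q"
proof -
  have "card {k. k < 4 \<and> quadrant v k \<in> Q} \<le> card {..<4::nat}"
    by (rule card_mono) auto
  then have "card (neighbors Q v) \<le> card {..<4::nat}"
    using assms card_neighbors[of v Q] by (simp add: G_vertices_iff)
  then show ?thesis using assms by (auto simp: inner_vertices_def boundary_vertices_def)
qed

lemma sum_neighbors_inner:
  assumes "v \<in> inner_vertices Q"
  shows "(\<Sum>w\<in>neighbors Q v. f w :: real) = f (diag v 0) + f (diag v 1) + f (diag v 2) + f (diag v 3)"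
proof -
  have "{k. k < 4 \<and> quadrant v k \<in> Q} = {..<4::nat}" and e: "even_vertex v"
    using assms by (auto simp: inner_vertices_iff)
  then have "(\<Sum>w\<in>neighbors Q v. f w) = (\<Sum>k<4. f (diag v k))"
    by (simp add: neighbors_eq sum.reindex[OF inj_on_diag])
  then show ?thesis by (simp add: eval_nat_numeral)
qed

text \<open>The directions are partial sums of the angles. If some quadrant is missing, its angle is free, and
  it is chosen to complete the sum to a full turn.\<close>

lemma partial_sums_of_angles:
  assumes "(\<forall>k<4. P k) \<Longrightarrow> \<theta> 0 + \<theta> 1 + \<theta> 2 + \<theta> 3 = 2 * pi"
  shows "\<exists>\<alpha>. \<forall>k<(4::nat). P k \<longrightarrow> cos (\<alpha> ((k + 1) mod 4)) = cos (\<alpha> k + \<theta> k) \<and>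
    sin (\<alpha> ((k + 1) mod 4)) = sin (\<alpha> k + \<theta> k)"
proof -
  obtain \<eta> :: "nat \<Rightarrow> real" where \<eta>: "\<And>k. k < 4 \<Longrightarrow> P k \<Longrightarrow> \<eta> k = \<theta> k"
    and sum: "\<eta> 0 + \<eta> 1 + \<eta> 2 + \<eta> 3 = 2 * pi"
  proof (cases "\<forall>k<4. P k")
    case True
    then show ?thesis using that[of \<theta>] assms by auto
  next
    case False
    then obtain j where j: "j < 4" "\<not> P j" by blast
    define \<eta> where "\<eta> = \<theta>(j := 2 * pi - (\<theta> 0 + \<theta> 1 + \<theta> 2 + \<theta> 3 - \<theta> j))"
    have sum: "\<eta> 0 + \<eta> 1 + \<eta> 2 + \<eta> 3 = 2 * pi"
      by (rule less_4_cases[OF j(1), where P = "\<lambda>i. j = i \<longrightarrow> \<eta> 0 + \<eta> 1 + \<eta> 2 + \<eta> 3 = 2 * pi", rule_format])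
        (auto simp: \<eta>_def)
    show ?thesis
    proof (rule that[of \<eta>])
      fix k assume "P k"
      then show "\<eta> k = \<theta> k" using j by (auto simp: \<eta>_def)
    qed (fact sum)
  qed
  define \<alpha> where "\<alpha> = (\<lambda>k. \<Sum>i<k. \<eta> i)"
  have "cos (\<alpha> ((k + 1) mod 4)) = cos (\<alpha> k + \<eta> k) \<and> sin (\<alpha> ((k + 1) mod 4)) = sin (\<alpha> k + \<eta> k)"
    if "k < 4" for k
  proof (cases "k = 3")
    case True
    have "\<alpha> k + \<eta> k = 2 * pi" using sum by (simp add: \<alpha>_def True eval_nat_numeral)
    then show ?thesis using True by (simp add: \<alpha>_def)
  next
    case False
    then show ?thesis using that by (simp add: \<alpha>_def)
  qed
  then show ?thesis using \<eta> by metis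
qed

section \<open>Ring patterns and their angles\<close>

text \<open>The distance from the center of \<open>v\<close> to its touching point in direction \<open>k\<close>: inner circles touch
  in horizontal directions and outer circles in vertical ones.\<close>

definition rad :: "(int \<times> int \<Rightarrow> real) \<Rightarrow> (int \<times> int \<Rightarrow> real) \<Rightarrow> int \<times> int \<Rightarrow> nat \<Rightarrow> real" where
  "rad r R v k = (if even k then r v else R v)"

lemma rad_add_2: "rad r R v (k + 2) = rad r R v k" "rad r R v (k + 3) = rad r R v (k + 1)"
  "rad r R v (k + 4) = rad r R v k"
  by (simp_all add: rad_def)

definition quarter_turn :: "nat \<Rightarrow> frame \<Rightarrow> frame" where
  "quarter_turn k = turn (real k * (pi / 2))"

lemma quarter_turn_add: "quarter_turn j (quarter_turn k F) = quarter_turn (j + k) F"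
  by (simp only: quarter_turn_def turn_turn of_nat_add distrib_right)

lemma quarter_turn_4: "quarter_turn (k + 4) F = quarter_turn k F"
proof -
  have "real (k + 4) * (pi / 2) = real k * (pi / 2) + 2 * pi" by (simp add: algebra_simps)
  then show ?thesis unfolding quarter_turn_def by (intro turn_cong) (simp_all only: cos_periodic sin_periodic)
qed

lemma quarter_turn_simps:
  "quarter_turn 0 F = F" "quarter_turn 1 (x, t, n) = (x, n, - t)"
  "quarter_turn 2 (x, t, n) = (x, - t, - n)" "quarter_turn 3 (x, t, n) = (x, - n, t)"
proof -
  show "quarter_turn 0 F = F" "quarter_turn 2 (x, t, n) = (x, - t, - n)"
    and q1: "quarter_turn 1 (x, t, n) = (x, n, - t)" for t n
    by (simp_all add: quarter_turn_def turn_def)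
  have q3: "quarter_turn 3 F = quarter_turn 1 (quarter_turn 1 (quarter_turn 1 F))" for F
    unfolding quarter_turn_add by (simp add: numeral_3_eq_3)
  show "quarter_turn 3 (x, t, n) = (x, - n, t)"
    unfolding q3 q1 by simp
qed

lemma fst_turn [simp]: "fst (turn \<alpha> F) = fst F" and fst_quarter_turn [simp]: "fst (quarter_turn k F) = fst F"
  by (simp_all add: quarter_turn_def turn_def split: prod.splits)

lemma is_frame_quarter_turn: "is_frame F \<Longrightarrow> is_frame (quarter_turn k F)"
  by (simp add: quarter_turn_def is_frame_turn)

lemma inner_fst_move: "is_frame F \<Longrightarrow> fst (move \<rho> F) \<bullet> fst F = cos \<rho>"
  by (auto simp: is_frame_def move_def inner_add_left norm_eq_1 split: prod.splits)

lemma norm_fst_frame: "is_frame F \<Longrightarrow> norm (fst F) = 1"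
  by (auto simp: is_frame_def split: prod.splits)

lemma fst_move_minus: "fst (move (- \<rho>) F) = fst (move \<rho> (quarter_turn 2 F))"
  by (cases F) (simp add: quarter_turn_simps move_def)

definition point_frame :: "(int \<times> int \<Rightarrow> real^3) \<Rightarrow> (int \<times> int \<Rightarrow> real^3) \<Rightarrow> int \<times> int \<Rightarrow> frame" where
  "point_frame l t x = (l x, t x, cross3 (l x) (t x))"

lemma is_frame_point_frame:
  "is_frame (point_frame l t x) \<longleftrightarrow> l x \<in> sphere 0 1 \<and> unit_tangent (l x) (t x)"
  by (auto simp: is_frame_def point_frame_def unit_tangent_def)

lemma fst_point_frame [simp]: "fst (point_frame l t x) = l x"
  by (simp add: point_frame_def)

text \<open>The conditions on the four rings around a touching point are one condition in terms of the frame
  turned by multiples of a right angle.\<close>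

lemma rings_touch_iff:
  "rings_touch Q p r R l t \<longleftrightarrow> (\<forall>x\<in>Gstar_vertices Q. unit_tangent (l x) (t x) \<and>
     (\<forall>k. share_square Q x (x + dir k) \<longrightarrow>
        p (x + dir k) = fst (move (rad r R (x + dir k) k) (quarter_turn k (point_frame l t x)))))"
proof -
  have all4: "(\<forall>k. P k) \<longleftrightarrow> P 0 \<and> P 2 \<and> P 1 \<and> P 3" if "\<And>k. P k \<Longrightarrow> P (k + 4)" for P :: "nat \<Rightarrow> bool"
  proof
    assume "P 0 \<and> P 2 \<and> P 1 \<and> P 3"
    then show "\<forall>k. P k" using mod_4_cases[of P] that by blast
  qed blast
  have "(\<forall>k. share_square Q x (x + dir k) \<longrightarrow>
        p (x + dir k) = fst (move (rad r R (x + dir k) k) (quarter_turn k (point_frame l t x))))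
    \<longleftrightarrow> (share_square Q (fst x, snd x) (fst x + 1, snd x) \<longrightarrow> p (fst x + 1, snd x) = sph_exp (l x) (r (fst x + 1, snd x)) (t x)) \<and>
        (share_square Q (fst x, snd x) (fst x - 1, snd x) \<longrightarrow> p (fst x - 1, snd x) = sph_exp (l x) (r (fst x - 1, snd x)) (- t x)) \<and>
        (share_square Q (fst x, snd x) (fst x, snd x + 1) \<longrightarrow> p (fst x, snd x + 1) = sph_exp (l x) (R (fst x, snd x + 1)) (cross3 (l x) (t x))) \<and>
        (share_square Q (fst x, snd x) (fst x, snd x - 1) \<longrightarrow> p (fst x, snd x - 1) = sph_exp (l x) (R (fst x, snd x - 1)) (- cross3 (l x) (t x)))"
    for x
    apply (subst all4)
     apply (simp add: quarter_turn_4 rad_add_2)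
    apply (cases x)
    apply (simp add: dir_def rad_def point_frame_def quarter_turn_simps quarter_turn_simps(2)[unfolded One_nat_def] move_def sph_exp_def)
    done
  then show ?thesis
    unfolding rings_touch_def Let_def by auto
qed

lemma rings_touchD:
  assumes "rings_touch Q p r R l t" "x \<in> Gstar_vertices Q"
  shows "unit_tangent (l x) (t x)"
    "share_square Q x (x + dir k) \<Longrightarrow>
      p (x + dir k) = fst (move (rad r R (x + dir k) k) (quarter_turn k (point_frame l t x)))"
  using assms unfolding rings_touch_iff by blast+

lemma dir_opposite: "dir k + dir (k + 2) = 0"
proof (induction k rule: mod_4_cases)
  case (5 k)
  then show ?case by (simp only: dir_add_4 dir_4)
qed (simp_all add: dir_def zero_prod_def)

locale ring_data =
  fixes q :: real and Q :: "(int \<times> int) set" and r R :: "int \<times> int \<Rightarrow> real"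
  assumes q: "0 < q" "q < 1" and radii: "\<And>v. v \<in> G_vertices Q \<Longrightarrow> ring_radii q (r v) (R v)"
begin

abbreviation \<theta> :: "int \<times> int \<Rightarrow> int \<times> int \<Rightarrow> real" where
  "\<theta> v w \<equiv> kite_angle (r v) (R v) (r w) (R w)"

abbreviation \<Delta> :: "int \<times> int \<Rightarrow> int \<times> int \<Rightarrow> real" where
  "\<Delta> v w \<equiv> kite_diagonal q (r v) (r w)"

text \<open>The right angle of the triangle is at the touching point that \<open>v\<close> sees in direction \<open>k\<close>, and
  \<open>w\<close> is its third vertex.\<close>

definition half_angle :: "int \<times> int \<Rightarrow> int \<times> int \<Rightarrow> nat \<Rightarrow> real" where
  "half_angle v w k = (if even k then inner_kite_angle (r v) (R w) else arctan_tan_over (r w) (sin (R v)))"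

lemma half_angle_sum: "half_angle v w k + half_angle v w (k + 1) = \<theta> v w"
  "half_angle v w (k + 1) + half_angle v w k = \<theta> v w"
  by (simp_all add: half_angle_def kite_angle_def)

lemma half_angle:
  assumes "v \<in> G_vertices Q" "w \<in> G_vertices Q"
  shows "sin (\<Delta> v w) * cos (half_angle v w k) = sin (rad r R v k) * cos (rad r R w (k + 1))"
    "sin (\<Delta> v w) * sin (half_angle v w k) = sin (rad r R w (k + 1))"
    "cos (\<Delta> v w) = cos (rad r R v k) * cos (rad r R w (k + 1))"
  using kite_angle_parts[OF q radii[OF assms(1)] radii[OF assms(2)]]
    cos_kite_diagonal[OF q radii[OF assms(1)] radii[OF assms(2)]]
  by (simp_all add: half_angle_def rad_def)

lemma \<Delta>_commute: "\<Delta> v w = \<Delta> w v"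
  by (simp add: kite_diagonal_def mult_ac)

lemma sin_\<Delta>: "v \<in> G_vertices Q \<Longrightarrow> w \<in> G_vertices Q \<Longrightarrow> sin (\<Delta> v w) \<noteq> 0"
  by (rule less_imp_neq[symmetric], rule sin_kite_diagonal[OF q radii radii])

text \<open>An odd direction \<open>k\<close> exchanges the two triangles of the kite.\<close>

lemma kite_hypotheses:
  fixes v w :: "int \<times> int" and k :: nat
  assumes vw: "v \<in> G_vertices Q" "w \<in> G_vertices Q"
  defines "a \<equiv> rad r R v k" and "b \<equiv> rad r R w (k + 1)" and "d \<equiv> rad r R v (k + 1)" and "c \<equiv> rad r R w k"
  shows "sin (\<Delta> v w) \<noteq> 0" "cos (\<Delta> v w) = cos a * cos b" "cos (\<Delta> v w) = cos d * cos c"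
    "sin (\<Delta> v w) * cos (half_angle v w k) = sin a * cos b" "sin (\<Delta> v w) * sin (half_angle v w k) = sin b"
    "sin (\<Delta> v w) * cos (half_angle w v (k + 1)) = sin b * cos a" "sin (\<Delta> v w) * sin (half_angle w v (k + 1)) = sin a"
    "sin (\<Delta> v w) * cos (half_angle v w (k + 1)) = sin d * cos c" "sin (\<Delta> v w) * sin (half_angle v w (k + 1)) = sin c"
    "sin (\<Delta> v w) * cos (half_angle w v k) = sin c * cos d" "sin (\<Delta> v w) * sin (half_angle w v k) = sin d"
  using sin_\<Delta>[OF vw] half_angle[OF vw, of k] half_angle[OF vw, of "k + 1"]
    half_angle[OF vw(2,1), of k] half_angle[OF vw(2,1), of "k + 1"]
  unfolding \<Delta>_commute[of w v] a_def b_def c_def d_def add.assoc one_add_one rad_add_2 by simp_all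

lemma kite:
  assumes "v \<in> G_vertices Q" "w \<in> G_vertices Q"
  shows "move (rad r R w (k + 1)) (turn (pi / 2) (move (rad r R v k) F))
    = turn (\<theta> w v) (move (rad r R w k) (turn (- pi / 2) (move (rad r R v (k + 1)) (turn (\<theta> v w) F))))"
  using kite_closes[OF kite_hypotheses(1)[OF assms] kite_hypotheses(2-11)[OF assms, of k], of F]
  unfolding half_angle_sum .

lemma \<theta>_range: "v \<in> G_vertices Q \<Longrightarrow> w \<in> G_vertices Q \<Longrightarrow> \<theta> v w \<in> {0..pi}"
  by (rule kite_angle_range[OF q radii radii])

end

locale touching_rings = ring_data +
  fixes p l t
  assumes touch: "rings_touch Q p r R l t" and points: "\<And>x. x \<in> Gstar_vertices Q \<Longrightarrow> l x \<in> sphere 0 1"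
begin

abbreviation X :: "int \<times> int \<Rightarrow> frame" where "X \<equiv> point_frame l t"

lemma frame_X: "x \<in> Gstar_vertices Q \<Longrightarrow> is_frame (X x)"
  unfolding is_frame_point_frame using points rings_touchD(1)[OF touch] by blast

text \<open>The frame at the center of \<open>v\<close> that looks towards the touching point in direction \<open>k\<close>, with
  the sign of the radius: for a negative radius it looks away from this point.\<close>

definition center_frame :: "int \<times> int \<Rightarrow> nat \<Rightarrow> frame" where
  "center_frame v k = move (- rad r R v k) (quarter_turn k (X (v + dir k)))"

lemma move_center_frame: "move (rad r R v k) (center_frame v k) = quarter_turn k (X (v + dir k))"
  by (simp add: center_frame_def move_move)

lemma center_frame_4: "center_frame v (k + 4) = center_frame v k"
  by (simp add: center_frame_def quarter_turn_4 rad_add_2)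

lemma frame_center_frame: "v + dir k \<in> Gstar_vertices Q \<Longrightarrow> is_frame (center_frame v k)"
  unfolding center_frame_def by (intro is_frame_move is_frame_quarter_turn frame_X)

lemma fst_center_frame:
  assumes "v + dir k \<in> Gstar_vertices Q" "share_square Q (v + dir k) v"
  shows "fst (center_frame v k) = p v"
proof -
  have v: "v + dir k + dir (k + 2) = v"
    by (simp only: dir_opposite add.assoc add_0_right)
  have "p v = fst (move (rad r R v (k + 2)) (quarter_turn (k + 2) (X (v + dir k))))"
    using rings_touchD(2)[OF touch assms(1), of "k + 2"] assms(2) unfolding v by blast
  then show ?thesis
    unfolding center_frame_def fst_move_minus quarter_turn_add rad_add_2 by (simp add: add.commute)
qed

lemma center_frame_step:
  assumes "quadrant v k \<in> Q" "even_vertex v"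
  shows "center_frame v (k + 1) = turn (\<theta> v (diag v k)) (center_frame v k)"
proof -
  let ?w = "diag v k"
  note vert = quadrant_vertices[OF assms]
  note share = share_square_quadrant[OF assms(1)]
  have w1: "?w = v + dir k + dir (k + 1)" by (simp add: diag_def)
  have w2: "?w = v + dir (k + 1) + dir k" by (simp add: diag_def add.commute add.left_commute)
  show ?thesis
    unfolding half_angle_sum(1)[of v ?w k, symmetric]
  proof (rule kite_angle_between_frames[OF kite_hypotheses(1)[OF vert(1,2)] kite_hypotheses(2-11)[OF vert(1,2), of k]])
    show "is_frame (center_frame v k)" "is_frame (center_frame v (k + 1))"
      using vert frame_center_frame by blast+
    show "fst (center_frame v k) = fst (center_frame v (k + 1))"
      using fst_center_frame vert share by metis
    have "turn (pi / 2) = quarter_turn 1" by (simp add: quarter_turn_def fun_eq_iff)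
    then have a: "fst (move (rad r R ?w (k + 1)) (turn (pi / 2) (move (rad r R v k) (center_frame v k))))
       = p ?w"
      using rings_touchD(2)[OF touch vert(3), of "k + 1"] share(3)
      unfolding move_center_frame by (simp add: quarter_turn_add w1)
    have "turn (- pi / 2) (quarter_turn (k + 1) F) = quarter_turn k F" for F
    proof -
      have "- pi / 2 + real (k + 1) * (pi / 2) = real k * (pi / 2)"
        unfolding of_nat_add of_nat_1 distrib_right by linarith
      then show ?thesis by (simp only: quarter_turn_def turn_turn)
    qed
    then have b: "fst (move (rad r R ?w k) (turn (- pi / 2) (move (rad r R v (k + 1)) (center_frame v (k + 1)))))
       = p ?w"
      using rings_touchD(2)[OF touch vert(4), of k] share(4)
      unfolding move_center_frame by (simp add: w2)
    show "fst (move (rad r R ?w (k + 1)) (turn (pi / 2) (move (rad r R v k) (center_frame v k))))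
      = fst (move (rad r R ?w k) (turn (- pi / 2) (move (rad r R v (k + 1)) (center_frame v (k + 1)))))"
      unfolding a b ..
  qed
qed

end

text \<open>A negative radius puts the touching point on the other side of the center, at the same distance.\<close>

lemma touching_direction_iff:
  assumes f: "is_frame (p, u, n)" and \<rho>: "\<bar>\<rho>\<bar> \<le> pi / 2"
  shows "touching_direction p \<bar>\<rho>\<bar> (fst (move \<rho> (p, u, n))) d u' \<longleftrightarrow>
    u' = (if \<rho> = 0 then d else if 0 < \<rho> then u else - u)"
proof (cases "\<rho> = 0")
  case False
  define w where "w = (if 0 < \<rho> then u else - u)"
  have x: "fst (move \<rho> (p, u, n)) = sph_exp p \<bar>\<rho>\<bar> w"
    using False by (auto simp: move_def sph_exp_def w_def)
  have w: "unit_tangent p w" using f by (auto simp: is_frame_def unit_tangent_def w_def)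
  have "0 < sin \<bar>\<rho>\<bar>" using False \<rho> by (intro sin_gt_zero) auto
  then have inj: "sph_exp p \<bar>\<rho>\<bar> w = sph_exp p \<bar>\<rho>\<bar> u' \<longleftrightarrow> w = u'" by (simp add: sph_exp_def)
  have "touching_direction p \<bar>\<rho>\<bar> (sph_exp p \<bar>\<rho>\<bar> w) d u' \<longleftrightarrow> u' = w"
    using False w by (simp only: touching_direction_def inj abs_eq_0 if_False) auto
  then show ?thesis unfolding x using False by (simp add: w_def)
qed (simp add: touching_direction_def)

context touching_rings
begin

text \<open>Four steps around the vertex lead back to the first frame.\<close>

lemma angles_close_up:
  assumes v: "v \<in> inner_vertices Q"
  shows "cos (\<theta> v (diag v 0) + \<theta> v (diag v 1) + \<theta> v (diag v 2) + \<theta> v (diag v 3)) = 1"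
proof -
  have Qv: "quadrant v 0 \<in> Q" "quadrant v 1 \<in> Q" "quadrant v 2 \<in> Q" "quadrant v 3 \<in> Q" and e: "even_vertex v"
    using v by (auto simp: inner_vertices_iff)
  let ?F = "center_frame v 0"
  have "center_frame v 4 = turn (\<theta> v (diag v 0) + \<theta> v (diag v 1) + \<theta> v (diag v 2) + \<theta> v (diag v 3)) ?F"
    using center_frame_step[OF Qv(1) e] center_frame_step[OF Qv(2) e] center_frame_step[OF Qv(3) e] center_frame_step[OF Qv(4) e]
    by (simp add: turn_turn eval_nat_numeral add_ac)
  then have eq: "turn (\<theta> v (diag v 0) + \<theta> v (diag v 1) + \<theta> v (diag v 2) + \<theta> v (diag v 3)) ?F = turn 0 ?F"
    using center_frame_4[of v 0] by simp
  obtain a b c where F: "?F = (a, b, c)" by (cases ?F)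
  have "is_frame ?F" using quadrant_vertices(3)[OF Qv(1) e] by (rule frame_center_frame)
  then have f: "is_frame (a, b, c)" by (simp add: F)
  have "tangent_rot a b (\<theta> v (diag v 0) + \<theta> v (diag v 1) + \<theta> v (diag v 2) + \<theta> v (diag v 3)) = tangent_rot a b 0"
    unfolding tangent_rot_turn[OF f] using eq by (simp add: F)
  then show ?thesis unfolding tangent_rot_eq_iff[OF f] by simp
qed

text \<open>For a negative radius the directions to the inner touching points are opposite to those of the
  frames, so the angles between the directions are \<open>\<pi> - \<theta>\<close>, in the opposite order. They add up to
  \<open>2\<pi>\<close> just if the angles \<open>\<theta>\<close> do.\<close>

lemma ordered_at_inner_vertex_iff:
  assumes v: "v \<in> inner_vertices Q"
  shows "(\<exists>u0 u1 u2 u3.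
        touching_direction (p v) \<bar>r v\<bar> (l (v + dir 0)) (t (v + dir 0)) u0 \<and>
        touching_direction (p v) (R v) (l (v + dir 1)) 0 u1 \<and>
        touching_direction (p v) \<bar>r v\<bar> (l (v + dir 2)) (- t (v + dir 2)) u2 \<and>
        touching_direction (p v) (R v) (l (v + dir 3)) 0 u3 \<and>
        (if r v \<ge> 0 then ccw_order (p v) u0 u1 u2 u3 else ccw_order (p v) u3 u2 u1 u0))
    \<longleftrightarrow> \<theta> v (diag v 0) + \<theta> v (diag v 1) + \<theta> v (diag v 2) + \<theta> v (diag v 3) = 2 * pi"
    (is "?lhs \<longleftrightarrow> ?a + ?b + ?c + ?d = 2 * pi")
proof -
  have Qv: "quadrant v k \<in> Q" if "k < 4" for k using v that by (auto simp: inner_vertices_iff)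
  have e: "even_vertex v" using v by (auto simp: inner_vertices_iff)
  have vG: "v \<in> G_vertices Q" using quadrant_vertices(1)[OF Qv[of 0] e] by simp
  have rv: "\<bar>r v\<bar> \<le> pi / 2" "0 < R v" "R v \<le> pi / 2" using radii[OF vG] by (auto simp: ring_radii_def)
  have range: "\<theta> v (diag v k) \<in> {0..pi}" if "k < 4" for k
    using quadrant_vertices[OF Qv[OF that] e] by (intro \<theta>_range) auto
  define u where "u = (\<lambda>k. fst (snd (center_frame v k)))"
  define n where "n = (\<lambda>k. snd (snd (center_frame v k)))"
  have F: "center_frame v k = (p v, u k, n k)" "is_frame (p v, u k, n k)" if "k < 4" for k
  proof -
    note vert = quadrant_vertices[OF Qv[OF that] e]
    show c: "center_frame v k = (p v, u k, n k)"
      using fst_center_frame[OF vert(3) share_square_quadrant(1)[OF Qv[OF that]]]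
      by (simp add: u_def n_def prod_eq_iff)
    show "is_frame (p v, u k, n k)" using frame_center_frame[OF vert(3)] unfolding c .
  qed
  have lx: "l (v + dir k) = fst (move (rad r R v k) (p v, u k, n k))" if "k < 4" for k
    unfolding F(1)[OF that, symmetric] move_center_frame by simp
  define \<sigma> where "\<sigma> = (\<lambda>w::real^3. if r v \<ge> 0 then w else - w)"
  have td_even: "touching_direction (p v) \<bar>r v\<bar> (l (v + dir k)) d u' \<longleftrightarrow> u' = \<sigma> (u k)"
    if k: "k < 4" "even k" "r v = 0 \<Longrightarrow> d = u k" for k d u'
  proof -
    have "rad r R v k = r v" using k by (simp add: rad_def)
    then show ?thesis
      unfolding lx[OF k(1)] using touching_direction_iff[OF F(2)[OF k(1)] rv(1), of d u'] k(3)
      by (auto simp: \<sigma>_def)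
  qed
  have td_odd: "touching_direction (p v) (R v) (l (v + dir k)) 0 u' \<longleftrightarrow> u' = u k" if k: "k < 4" "odd k" for k u'
  proof -
    have "rad r R v k = R v" using k by (simp add: rad_def)
    then show ?thesis
      unfolding lx[OF k(1)] using touching_direction_iff[OF F(2)[OF k(1)], of "R v" 0 u'] rv by auto
  qed
  have d02: "t (v + dir 0) = u 0" "- t (v + dir 2) = u 2" if "r v = 0"
  proof -
    have "center_frame v 0 = quarter_turn 0 (X (v + dir 0))" "center_frame v 2 = quarter_turn 2 (X (v + dir 2))"
      using that by (simp_all add: center_frame_def rad_def)
    then show "t (v + dir 0) = u 0" "- t (v + dir 2) = u 2"
      unfolding u_def by (simp_all add: point_frame_def quarter_turn_simps)
  qed
  have lhs: "?lhs \<longleftrightarrow> (if r v \<ge> 0 then ccw_order (p v) (\<sigma> (u 0)) (u 1) (\<sigma> (u 2)) (u 3)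
      else ccw_order (p v) (u 3) (\<sigma> (u 2)) (u 1) (\<sigma> (u 0)))"
    using td_even[of 0 "t (v + dir 0)"] td_even[of 2 "- t (v + dir 2)"] td_odd[of 1] td_odd[of 3] d02
    by simp
  have step: "center_frame v (k + 1) = turn (\<theta> v (diag v k)) (center_frame v k)" if "k < 4" for k
    by (rule center_frame_step[OF Qv[OF that] e])
  have F1: "center_frame v 1 = turn ?a (center_frame v 0)" using step[of 0] by simp
  have F2: "center_frame v 2 = turn (?a + ?b) (center_frame v 0)"
    using step[of 1] F1 by (simp add: turn_turn numeral_2_eq_2 add.commute)
  have F3: "center_frame v 3 = turn (?a + ?b + ?c) (center_frame v 0)"
    using step[of 2] F2 by (simp add: turn_turn numeral_3_eq_3 numeral_2_eq_2 add_ac)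
  have rot: "fst (snd (turn \<alpha> (center_frame v k))) = tangent_rot (p v) (u k) \<alpha>" if "k < 4" for \<alpha> k
    using tangent_rot_turn[OF F(2)[OF that]] F(1)[OF that] by simp
  show ?thesis
  proof (cases "r v \<ge> 0")
    case True
    have "u 1 = tangent_rot (p v) (u 0) ?a" "u 2 = tangent_rot (p v) (u 0) (?a + ?b)"
      "u 3 = tangent_rot (p v) (u 0) (?a + ?b + ?c)"
      using rot[of 0] F1 F2 F3 by (simp_all add: u_def)
    from ccw_order_iff_sum[OF F(2) this range[of 0] range[of 1] range[of 2] range[of 3] angles_close_up[OF v]]
    show ?thesis unfolding lhs using True by (simp add: \<sigma>_def)
  next
    case False
    have F0: "center_frame v 0 = turn (- (?a + ?b + ?c)) (center_frame v 3)"
      unfolding F3 by (simp add: turn_turn)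
    have R0: "u 0 = tangent_rot (p v) (u 3) (- (?a + ?b + ?c))"
      "u 1 = tangent_rot (p v) (u 3) (- (?b + ?c))" "u 2 = tangent_rot (p v) (u 3) (- ?c)"
      using rot[of 3] F1 F2 F0 by (simp_all add: u_def turn_turn algebra_simps)
    have neg: "- tangent_rot (p v) w \<alpha> = tangent_rot (p v) w (\<alpha> + pi)" for w \<alpha>
      by (simp add: tangent_rot_def)
    have per: "tangent_rot (p v) w (\<alpha> + 2 * pi) = tangent_rot (p v) w \<alpha>" for w \<alpha>
      by (simp add: tangent_rot_def)
    have u: "\<sigma> (u 2) = tangent_rot (p v) (u 3) (pi - ?c)"
      "u 1 = tangent_rot (p v) (u 3) ((pi - ?c) + (pi - ?b))"
      "\<sigma> (u 0) = tangent_rot (p v) (u 3) ((pi - ?c) + (pi - ?b) + (pi - ?a))"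
      using False neg[of "u 3" "- ?c"] neg[of "u 3" "- (?a + ?b + ?c)"]
        per[of "u 3" "- (?b + ?c)"] per[of "u 3" "- (?a + ?b + ?c) + pi"] R0
      by (simp_all add: \<sigma>_def algebra_simps)
    have "cos ((pi - ?c) + (pi - ?b) + (pi - ?a) + (pi - ?d)) = cos (?a + ?b + ?c + ?d)"
    proof -
      have "(pi - ?c) + (pi - ?b) + (pi - ?a) + (pi - ?d) = - (?a + ?b + ?c + ?d) + 2 * pi + 2 * pi" by simp
      then show ?thesis by (simp only: cos_periodic cos_minus)
    qed
    then have closed: "cos ((pi - ?c) + (pi - ?b) + (pi - ?a) + (pi - ?d)) = 1"
      using angles_close_up[OF v] by simp
    have "pi - ?c \<in> {0..pi}" "pi - ?b \<in> {0..pi}" "pi - ?a \<in> {0..pi}" "pi - ?d \<in> {0..pi}"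
      using range[of 0] range[of 1] range[of 2] range[of 3] by auto
    from ccw_order_iff_sum[OF F(2) u this closed]
    have "ccw_order (p v) (u 3) (\<sigma> (u 2)) (u 1) (\<sigma> (u 0)) \<longleftrightarrow>
      (pi - ?c) + (pi - ?b) + (pi - ?a) + (pi - ?d) = 2 * pi" by simp
    then show ?thesis unfolding lhs using False by auto
  qed
qed

lemma touching_points_ordered_iff:
  "touching_points_ordered Q p r R l t \<longleftrightarrow>
    (\<forall>v\<in>inner_vertices Q. (\<Sum>w\<in>neighbors Q v. \<theta> v w) = 2 * pi)"
proof -
  have d: "v + dir 0 = (fst v + 1, snd v)" "v + dir 1 = (fst v, snd v + 1)"
    "v + dir 2 = (fst v - 1, snd v)" "v + dir 3 = (fst v, snd v - 1)" for v
    by (cases v; simp add: dir_def)+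
  show ?thesis
    unfolding touching_points_ordered_def
    using ordered_at_inner_vertex_iff sum_neighbors_inner
    unfolding d by fastforce
qed

text \<open>The incidence and orthogonality conditions follow from the touching condition: at a touching
  point the two centers of a kite are seen at right angles.\<close>

lemma center_inner_point:
  assumes "x \<in> Gstar_vertices Q" "share_square Q x (x + dir k)"
  shows "p (x + dir k) \<bullet> l x = cos (rad r R (x + dir k) k)"
  using inner_fst_move[OF is_frame_quarter_turn[OF frame_X[OF assms(1)]], of "rad r R (x + dir k) k" k]
  unfolding rings_touchD(2)[OF touch assms] by simp

lemma point_on_circle:
  assumes "x \<in> Gstar_vertices Q" "share_square Q x (x + dir k)" "x + dir k \<in> G_vertices Q"
  shows "l x \<in> sph_circle (p (x + dir k)) (rad r R (x + dir k) k)"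
proof -
  have "\<bar>rad r R (x + dir k) k\<bar> \<le> pi"
    using radii[OF assms(3)] pi_gt_zero unfolding rad_def ring_radii_def by auto
  then have "arccos (cos \<bar>rad r R (x + dir k) k\<bar>) = \<bar>rad r R (x + dir k) k\<bar>"
    by (intro arccos_cos) auto
  then show ?thesis
    using points[OF assms(1)] center_inner_point[OF assms(1,2)] by (simp add: sph_circle_def)
qed

lemma G_vertex_quadrant:
  assumes "v \<in> G_vertices Q"
  obtains k where "k < 4" "quadrant v k \<in> Q" "even_vertex v"
proof -
  obtain s where s: "s \<in> Q" "v \<in> corners s" "even_vertex v" using assms by (auto simp: G_vertices_iff)
  then have "s = quadrant v 0 \<or> s = quadrant v 1 \<or> s = quadrant v 2 \<or> s = quadrant v 3"
    by (cases v; cases s) (auto simp: corners_def quadrant_def)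
  then show thesis using s that[of 0] that[of 1] that[of 2] that[of 3] by auto
qed

lemma center_unit:
  assumes "v \<in> G_vertices Q"
  shows "p v \<in> sphere 0 1"
proof -
  obtain k where k: "k < 4" "quadrant v k \<in> Q" "even_vertex v" using G_vertex_quadrant[OF assms] .
  have "norm (fst (center_frame v k)) = 1"
    using norm_fst_frame frame_center_frame quadrant_vertices(3)[OF k(2,3)] by blast
  then show ?thesis
    using fst_center_frame quadrant_vertices(3)[OF k(2,3)] share_square_quadrant(1)[OF k(2)] by simp
qed

lemma orthogonal_at_point:
  assumes x: "x \<in> Gstar_vertices Q" and v: "share_square Q x (x + dir k)" "x + dir k \<in> G_vertices Q"
    and w: "share_square Q x (x + dir (k + 1))" "x + dir (k + 1) \<in> G_vertices Q"
  shows "orthogonal_circles (p (x + dir k)) (rad r R (x + dir k) k)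
    (p (x + dir (k + 1))) (rad r R (x + dir (k + 1)) (k + 1))"
    "orthogonal_circles (p (x + dir (k + 1))) (rad r R (x + dir (k + 1)) (k + 1))
      (p (x + dir k)) (rad r R (x + dir k) k)"
proof -
  let ?F = "quarter_turn k (X x)"
  obtain a b c where F: "?F = (a, b, c)" by (cases ?F)
  have f: "is_frame (a, b, c)" using is_frame_quarter_turn[OF frame_X[OF x], of k] by (simp add: F)
  have a: "a = l x" using arg_cong[OF F, of fst] by simp
  have cr: "c = cross3 a b" and bc: "b \<bullet> c = 0"
    using f by (auto simp: is_frame_def dot_cross_self)
  have pv: "p (x + dir k) = cos (rad r R (x + dir k) k) *\<^sub>R a + sin (rad r R (x + dir k) k) *\<^sub>R b"
    using rings_touchD(2)[OF touch x v(1)] by (simp add: F move_def)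
  have "quarter_turn (k + 1) (X x) = quarter_turn 1 ?F" by (simp add: quarter_turn_add add.commute)
  then have "quarter_turn (k + 1) (X x) = (a, c, - b)" by (simp only: F quarter_turn_simps)
  then have pw: "p (x + dir (k + 1)) = cos (rad r R (x + dir (k + 1)) (k + 1)) *\<^sub>R a
      + sin (rad r R (x + dir (k + 1)) (k + 1)) *\<^sub>R c"
    using rings_touchD(2)[OF touch x w(1)] by (simp add: move_def)
  have "a \<bullet> a = 1" "b \<bullet> a = 0" "c \<bullet> a = 0"
    using f by (auto simp: is_frame_def norm_eq_1 dot_cross_self)
  then have o: "cross3 (p (x + dir k)) (l x) \<bullet> cross3 (p (x + dir (k + 1))) (l x) = 0"
    unfolding dot_cross pv pw a[symmetric] using bc
    by (simp add: inner_add_left inner_add_right inner_commute)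
  have on: "l x \<in> sph_circle (p (x + dir k)) (rad r R (x + dir k) k)"
    "l x \<in> sph_circle (p (x + dir (k + 1))) (rad r R (x + dir (k + 1)) (k + 1))"
    using point_on_circle x v w by blast+
  show "orthogonal_circles (p (x + dir k)) (rad r R (x + dir k) k)
    (p (x + dir (k + 1))) (rad r R (x + dir (k + 1)) (k + 1))"
    "orthogonal_circles (p (x + dir (k + 1))) (rad r R (x + dir (k + 1)) (k + 1))
      (p (x + dir k)) (rad r R (x + dir k) k)"
    unfolding orthogonal_circles_def using on o by (auto simp: inner_commute)
qed

lemma orthogonal: "rings_orthogonal Q p r R"
  unfolding rings_orthogonal_def
proof (intro allI impI)
  have main: "orthogonal_circles (p v) (R v) (p (diag v k)) (r (diag v k))"
    if "quadrant v k \<in> Q" "even_vertex v" for v k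
  proof -
    note vert = quadrant_vertices[OF that]
    note share = share_square_quadrant[OF that(1)]
    have v: "v + dir k + dir (k + 2) = v" "v + dir (k + 1) + dir (k + 3) = v"
      using dir_opposite[of k] dir_opposite[of "k + 1"] by (simp_all add: add.assoc numeral_3_eq_3)
    have w: "v + dir k + dir (k + 1) = diag v k" "v + dir (k + 1) + dir (k + 4) = diag v k"
      by (simp_all add: diag_def add.commute add.left_commute)
    show ?thesis
    proof (cases "even k")
      case True
      have k: "k + 3 + 1 = k + 4" by simp
      show ?thesis
        using orthogonal_at_point(1)[OF vert(4), of "k + 3"] vert share True
        unfolding k v w by (simp add: rad_def)
    next
      case False
      have k: "k + 1 + 1 = k + 2" by simp
      show ?thesis
        using orthogonal_at_point(2)[OF vert(3), of "k + 1"] vert share False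
        unfolding k v w by (simp add: rad_def)
    qed
  qed
  fix v w assume "neighboring Q v w"
  moreover from this have e: "even_vertex v" "even_vertex w" by (auto simp: neighboring_def G_vertices_iff)
  ultimately show "orthogonal_circles (p v) (R v) (p w) (r w) \<and> orthogonal_circles (p w) (R w) (p v) (r v)"
    using main neighboring_iff[OF e(1)] neighboring_iff[OF e(2), of Q v] neighboring_sym by metis
qed

lemma incident: "rings_incident Q p r R l"
  unfolding rings_incident_def
proof (intro allI impI)
  fix m n assume x: "(m, n) \<in> Gstar_vertices Q"
  have on: "l (m, n) \<in> sph_circle (p ((m, n) + dir k)) (rad r R ((m, n) + dir k) k)"
    if "share_square Q (m, n) ((m, n) + dir k)" for k
  proof -
    have "(m, n) + dir k \<in> G_vertices Q"
      using that x even_vertex_dir[of "(m, n)" k] unfolding G_vertices_iff Gstar_vertices_iff share_square_def by blast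
    then show ?thesis by (rule point_on_circle[OF x that])
  qed
  show "(\<forall>v\<in>{(m + 1, n), (m - 1, n)}. share_square Q (m, n) v \<longrightarrow> l (m, n) \<in> sph_circle (p v) (r v)) \<and>
    (\<forall>v\<in>{(m, n + 1), (m, n - 1)}. share_square Q (m, n) v \<longrightarrow> l (m, n) \<in> sph_circle (p v) (R v))"
    using on[of 0] on[of 1] on[of 2] on[of 3] by (auto simp: dir_def rad_def)
qed

theorem pattern_if_inner_sums:
  assumes "\<And>v. v \<in> G_vertices Q \<Longrightarrow> \<bar>r v\<bar> \<le> R v"
    and "\<forall>v\<in>inner_vertices Q. (\<Sum>w\<in>neighbors Q v. \<theta> v w) = 2 * pi"
  shows "orthogonal_ring_pattern Q p r R l"
  unfolding orthogonal_ring_pattern_def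
proof (intro conjI ballI exI[of _ t])
  show "touching_points_ordered Q p r R l t" unfolding touching_points_ordered_iff by (rule assms(2))
  fix v assume v: "v \<in> G_vertices Q"
  show "spherical_ring (p v) (r v) (R v)"
    using center_unit[OF v] assms(1)[OF v] radii[OF v] pi_gt_zero
    unfolding spherical_ring_def ring_radii_def by auto
qed (use points orthogonal incident touch in auto)

end

lemma pattern_inner_sums:
  assumes "0 < q" "q < 1" "\<And>v. v \<in> G_vertices Q \<Longrightarrow> ring_radii q (r v) (R v)"
    and pat: "orthogonal_ring_pattern Q p r R l" and v: "v \<in> inner_vertices Q"
  shows "(\<Sum>w\<in>neighbors Q v. kite_angle (r v) (R v) (r w) (R w)) = 2 * pi"
proof -
  obtain t where t: "rings_touch Q p r R l t" "touching_points_ordered Q p r R l t"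
    using pat by (auto simp: orthogonal_ring_pattern_def)
  interpret touching_rings q Q r R p l t
    by unfold_locales (use assms t in \<open>auto simp: orthogonal_ring_pattern_def\<close>)
  show ?thesis using t(2) v unfolding touching_points_ordered_iff by blast
qed

section \<open>Existence\<close>

lemma quadrant_mod: "quadrant v (k mod 4) = quadrant v k" and diag_mod: "diag v (k mod 4) = diag v k"
proof -
  show "quadrant v (k mod 4) = quadrant v k" by (simp only: quadrant_def mod_mod_trivial)
  have "(k mod 4 + 1) mod 4 = (k + 1) mod 4" by presburger
  then show "diag v (k mod 4) = diag v k" by (simp only: diag_def dir_def mod_mod_trivial)
qed

definition direction_index :: "int \<times> int \<Rightarrow> nat" where
  "direction_index d = (if d = (1, 0) then 0 else if d = (0, 1) then 1 else if d = (- 1, 0) then 2 else 3)"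

text \<open>The number \<open>\<alpha> v k\<close> is the direction in which \<open>v\<close> is to see its touching point \<open>k\<close>, measured from an
  arbitrary reference direction. The conditions on its sine and cosine express equality modulo \<open>2\<pi>\<close>.\<close>

locale vertex_directions = ring_data +
  fixes \<alpha> :: "int \<times> int \<Rightarrow> nat \<Rightarrow> real"
  assumes \<alpha>_4: "\<alpha> v (k + 4) = \<alpha> v k"
    and \<alpha>_step: "v \<in> G_vertices Q \<Longrightarrow> quadrant v k \<in> Q \<Longrightarrow>
      cos (\<alpha> v (k + 1)) = cos (\<alpha> v k + \<theta> v (diag v k)) \<and> sin (\<alpha> v (k + 1)) = sin (\<alpha> v k + \<theta> v (diag v k))"
begin

definition to_point :: "int \<times> int \<Rightarrow> nat \<Rightarrow> frame \<Rightarrow> frame" where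
  "to_point v k F = turn (- (real k * (pi / 2))) (move (rad r R v k) (turn (\<alpha> v k) F))"

definition from_point :: "int \<times> int \<Rightarrow> nat \<Rightarrow> frame \<Rightarrow> frame" where
  "from_point v k F = turn (- \<alpha> v k) (move (- rad r R v k) (quarter_turn k F))"

lemma from_to_point: "from_point v k (to_point v k F) = F" "to_point v k (from_point v k F) = F"
  by (simp_all add: to_point_def from_point_def quarter_turn_def turn_turn move_move)

lemma from_point_4: "from_point v (k + 4) F = from_point v k F"
  by (simp only: from_point_def \<alpha>_4 rad_add_2 quarter_turn_4)

lemma is_frame_point: "is_frame F \<Longrightarrow> is_frame (to_point v k F)" "is_frame F \<Longrightarrow> is_frame (from_point v k F)"
  unfolding to_point_def from_point_def
  by (intro is_frame_turn is_frame_move is_frame_quarter_turn; assumption)+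

text \<open>The two sides lead from \<open>v\<close> to the opposite vertex of a kite along its two pairs of sides.\<close>

lemma transport_around_kite:
  assumes Qv: "quadrant v k \<in> Q" and e: "even_vertex v"
  shows "from_point (diag v k) (k + 3) (to_point v k F) = from_point (diag v k) (k + 2) (to_point v (k + 1) F)"
proof -
  let ?w = "diag v k"
  note vert = quadrant_vertices[OF Qv e]
  let ?a = "rad r R v k" and ?b = "rad r R ?w (k + 1)" and ?c = "rad r R ?w k" and ?d = "rad r R v (k + 1)"
  have q3: "quarter_turn (k + 3) (turn (- (real k * (pi / 2))) G) = turn (3 * (pi / 2)) G" for G
    unfolding quarter_turn_def turn_turn of_nat_add distrib_right by simp
  have q1: "quarter_turn (k + 2) (turn (- (real (k + 1) * (pi / 2))) G) = turn (pi / 2) G" for G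
    unfolding quarter_turn_def turn_turn of_nat_add distrib_right by simp
  have "3 * (pi / 2) = pi + pi / 2" by simp
  then have "from_point ?w (k + 3) (to_point v k F)
      = turn (- \<alpha> ?w (k + 3)) (turn pi (move ?b (turn (pi / 2) (move ?a (turn (\<alpha> v k) F)))))"
    unfolding from_point_def to_point_def q3 rad_add_2 move_minus turn_turn by simp
  also have "\<dots> = turn (- \<alpha> ?w (k + 3)) (turn pi (turn (\<theta> ?w v) (move ?c (turn (- pi / 2)
      (move ?d (turn (\<theta> v ?w) (turn (\<alpha> v k) F)))))))"
    unfolding kite[OF vert(1,2)] ..
  also have "turn (\<theta> v ?w) (turn (\<alpha> v k) F) = turn (\<alpha> v (k + 1)) F"
    unfolding turn_turn using \<alpha>_step[OF vert(1) Qv] by (intro turn_cong) (simp_all add: add.commute)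
  also have "turn (- \<alpha> ?w (k + 3)) (turn pi (turn (\<theta> ?w v) G)) = turn (- \<alpha> ?w (k + 2)) (turn pi G)" for G
  proof -
    have "quadrant ?w (k + 2) \<in> Q" "diag ?w (k + 2) = v" using Qv diag_swap by auto
    from \<alpha>_step[OF vert(2) this(1)] this(2)
    have s: "cos (\<alpha> ?w (k + 3)) = cos (\<alpha> ?w (k + 2) + \<theta> ?w v)" "sin (\<alpha> ?w (k + 3)) = sin (\<alpha> ?w (k + 2) + \<theta> ?w v)"
      by (simp_all add: numeral_3_eq_3)
    have "cos ((pi + \<theta> ?w v) - \<alpha> ?w (k + 3)) = cos ((pi + \<theta> ?w v) - (\<alpha> ?w (k + 2) + \<theta> ?w v))"
      "sin ((pi + \<theta> ?w v) - \<alpha> ?w (k + 3)) = sin ((pi + \<theta> ?w v) - (\<alpha> ?w (k + 2) + \<theta> ?w v))"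
      unfolding cos_diff[of "pi + \<theta> ?w v"] sin_diff[of "pi + \<theta> ?w v"] s by simp_all
    then show ?thesis unfolding turn_turn by (intro turn_cong) (simp_all add: algebra_simps)
  qed
  also have "turn (- \<alpha> ?w (k + 2)) (turn pi (move ?c (turn (- pi / 2) (move ?d (turn (\<alpha> v (k + 1)) F)))))
      = from_point ?w (k + 2) (to_point v (k + 1) F)"
  proof -
    have "- pi + pi / 2 = - pi / 2" by simp
    then show ?thesis
      unfolding from_point_def to_point_def q1 rad_add_2 move_minus turn_turn by simp
  qed
  finally show ?thesis .
qed

text \<open>A step starts or ends at the center of a ring, which is a vertex with an even coordinate sum.\<close>

definition step :: "int \<times> int \<Rightarrow> int \<times> int \<Rightarrow> frame \<Rightarrow> frame" where
  "step a b = (if even_vertex a then to_point a (direction_index (b - a)) else from_point b (direction_index (a - b)))"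

lemma step_inverse:
  assumes "lattice_edge Q a b"
  shows "step b a (step a b F) = F"
proof -
  have "\<bar>fst a - fst b\<bar> + \<bar>snd a - snd b\<bar> = 1" using assms by (simp add: lattice_edge_def)
  then have "even_vertex b \<longleftrightarrow> \<not> even_vertex a" by presburger
  then show ?thesis by (auto simp: step_def from_to_point)
qed

lemma step_flat:
  assumes "(m, n) \<in> Q"
  shows "step (m + 1, n) (m + 1, n + 1) (step (m, n) (m + 1, n) F)
    = step (m, n + 1) (m + 1, n + 1) (step (m, n) (m, n + 1) F)"
proof (cases "even (m + n)")
  case True
  have e: "quadrant (m, n) 0 = (m, n)" "diag (m, n) 0 = (m + 1, n + 1)"
    by (simp_all add: quadrant_def diag_def dir_def)
  show ?thesis
    using transport_around_kite[of "(m, n)" 0 F] assms True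
    by (simp add: e step_def direction_index_def numeral_2_eq_2)
next
  case False
  have e: "quadrant (m + 1, n) 1 = (m, n)" "diag (m + 1, n) 1 = (m, n + 1)"
    by (simp_all add: quadrant_def diag_def dir_def)
  have "from_point (m, n + 1) 0 (to_point (m + 1, n) 1 (from_point (m + 1, n) 2 F)) = from_point (m, n + 1) 3 F"
  proof -
    have k: "(1::nat) + 3 = 0 + 4" "(1::nat) + 2 = 3" "(1::nat) + 1 = 2" by simp_all
    have "quadrant (m + 1, n) 1 \<in> Q" "even_vertex (m + 1, n)" unfolding e using assms False by simp_all
    from transport_around_kite[OF this, of "from_point (m + 1, n) 2 F"] show ?thesis
      unfolding e k from_point_4 from_to_point .
  qed
  then have "to_point (m + 1, n) 1 (from_point (m + 1, n) 2 F) = to_point (m, n + 1) 0 (from_point (m, n + 1) 3 F)"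
    by (metis from_to_point(2))
  then show ?thesis using False by (simp add: step_def direction_index_def)
qed

text \<open>The transport along the edges is trivial around every square, so it defines frames at all
  vertices. Their points are the centers and touching points.\<close>

lemma pattern_from_directions:
  assumes fin: "finite Q" and sc: "simply_connected (realization Q)"
    and rR: "\<And>v. v \<in> G_vertices Q \<Longrightarrow> \<bar>r v\<bar> \<le> R v"
    and sums: "\<forall>v\<in>inner_vertices Q. (\<Sum>w\<in>neighbors Q v. \<theta> v w) = 2 * pi"
  shows "\<exists>p l. orthogonal_ring_pattern Q p r R l"
proof -
  let ?e = "\<lambda>i. axis i 1 :: real^3"
  have f0: "is_frame (?e 1, ?e 2, cross3 (?e 1) (?e 2))"
    by (simp add: is_frame_def inner_axis_axis)
  have "is_frame (step a b F)" if "is_frame F" for a b F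
    using that by (simp add: step_def is_frame_point)
  then obtain X where X: "\<And>a. is_frame (X a)" "\<And>a b. lattice_edge Q a b \<Longrightarrow> X b = step a b (X a)"
    using discrete_monodromy[where T = step and I = is_frame, OF fin sc step_inverse step_flat f0] by blast
  define l where "l = (\<lambda>x. fst (X x))"
  define t where "t = (\<lambda>x. fst (snd (X x)))"
  have pf: "point_frame l t x = X x" for x
    using X(1)[of x] by (cases "X x") (simp add: point_frame_def l_def t_def is_frame_def)
  have touch: "rings_touch Q l r R l t"
    unfolding rings_touch_iff
  proof (intro ballI conjI allI impI)
    fix x assume x: "x \<in> Gstar_vertices Q"
    show "unit_tangent (l x) (t x)"
      using X(1)[of x] unfolding pf[of x, symmetric] is_frame_point_frame by blast
    fix k assume s: "share_square Q x (x + dir k)"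
    have "lattice_edge Q x (x + dir k)" using s by (auto simp: lattice_edge_def dir_def)
    then have "X (x + dir k) = step x (x + dir k) (X x)" by (rule X(2))
    also have "\<dots> = from_point (x + dir k) (k + 2) (X x)"
    proof -
      have "direction_index (- dir k) = (k + 2) mod 4"
      proof (induction k rule: mod_4_cases)
        case (5 k)
        have "(k + 4 + 2) mod 4 = (k + 2) mod 4" by presburger
        then show ?case using 5 by (simp only: dir_4)
      qed (simp_all add: dir_def direction_index_def)
      moreover have "from_point v (j mod 4) F = from_point v j F" for v j F
      proof (induction j rule: mod_4_cases)
        case (5 j)
        then show ?case by (simp only: from_point_4 mod_add_self2)
      qed simp_all
      moreover have "\<not> even_vertex x" using x by (simp add: Gstar_vertices_iff)
      ultimately show ?thesis by (simp add: step_def)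
    qed
    finally have "l (x + dir k) = fst (move (- rad r R (x + dir k) (k + 2)) (quarter_turn (k + 2) (X x)))"
      by (simp add: l_def from_point_def)
    also have "\<dots> = fst (move (rad r R (x + dir k) k) (quarter_turn (k + 4) (X x)))"
    proof -
      have "2 + (k + 2) = k + 4" by simp
      then show ?thesis by (simp only: fst_move_minus quarter_turn_add rad_add_2)
    qed
    finally show "l (x + dir k) = fst (move (rad r R (x + dir k) k) (quarter_turn k (point_frame l t x)))"
      by (simp only: quarter_turn_4 pf)
  qed
  interpret touching_rings q Q r R l l t
    by unfold_locales (use touch X(1) norm_fst_frame in \<open>auto simp: l_def\<close>)
  have "orthogonal_ring_pattern Q l r R l" by (rule pattern_if_inner_sums[OF rR sums])
  then show ?thesis by blast
qed

end

theorem (in ring_data) pattern_exists: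
  assumes fin: "finite Q" and sc: "simply_connected (realization Q)"
    and rR: "\<And>v. v \<in> G_vertices Q \<Longrightarrow> \<bar>r v\<bar> \<le> R v"
    and sums: "\<forall>v\<in>inner_vertices Q. (\<Sum>w\<in>neighbors Q v. \<theta> v w) = 2 * pi"
  shows "\<exists>p l. orthogonal_ring_pattern Q p r R l"
proof -
  have "\<exists>\<alpha>. v \<in> G_vertices Q \<longrightarrow> (\<forall>k<(4::nat). quadrant v k \<in> Q \<longrightarrow>
    cos (\<alpha> ((k + 1) mod 4)) = cos (\<alpha> k + \<theta> v (diag v k)) \<and>
    sin (\<alpha> ((k + 1) mod 4)) = sin (\<alpha> k + \<theta> v (diag v k)))" for v
  proof (cases "v \<in> G_vertices Q")
    case True
    have "\<theta> v (diag v 0) + \<theta> v (diag v 1) + \<theta> v (diag v 2) + \<theta> v (diag v 3) = 2 * pi"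
      if "\<forall>k<4. quadrant v k \<in> Q"
    proof -
      have "v \<in> inner_vertices Q" using that True by (simp add: inner_vertices_iff G_vertices_iff)
      then show ?thesis using sums sum_neighbors_inner[of v Q "\<theta> v"] by simp
    qed
    from partial_sums_of_angles[where P = "\<lambda>k. quadrant v k \<in> Q" and \<theta> = "\<lambda>k. \<theta> v (diag v k)", OF this]
    show ?thesis by blast
  qed simp
  then have "\<exists>\<alpha>. \<forall>v. v \<in> G_vertices Q \<longrightarrow> (\<forall>k<(4::nat). quadrant v k \<in> Q \<longrightarrow>
    cos (\<alpha> v ((k + 1) mod 4)) = cos (\<alpha> v k + \<theta> v (diag v k)) \<and>
    sin (\<alpha> v ((k + 1) mod 4)) = sin (\<alpha> v k + \<theta> v (diag v k)))"
    by (intro choice allI)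
  then obtain \<alpha> where \<alpha>: "\<And>v k. v \<in> G_vertices Q \<Longrightarrow> k < (4::nat) \<Longrightarrow> quadrant v k \<in> Q \<Longrightarrow>
    cos (\<alpha> v ((k + 1) mod 4)) = cos (\<alpha> v k + \<theta> v (diag v k)) \<and>
    sin (\<alpha> v ((k + 1) mod 4)) = sin (\<alpha> v k + \<theta> v (diag v k))" by blast
  interpret vertex_directions q Q r R "\<lambda>v k. \<alpha> v (k mod 4)"
  proof unfold_locales
    fix v :: "int \<times> int" and k :: nat
    show "\<alpha> v ((k + 4) mod 4) = \<alpha> v (k mod 4)" by simp
    assume "v \<in> G_vertices Q" "quadrant v k \<in> Q"
    then show "cos (\<alpha> v ((k + 1) mod 4)) = cos (\<alpha> v (k mod 4) + \<theta> v (diag v k)) \<and>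
      sin (\<alpha> v ((k + 1) mod 4)) = sin (\<alpha> v (k mod 4) + \<theta> v (diag v k))"
      using \<alpha>[of v "k mod 4"] unfolding quadrant_mod diag_mod mod_add_left_eq by simp
  qed
  show ?thesis by (rule pattern_from_directions[OF fin sc rR sums])
qed

section \<open>Uniqueness\<close>

definition rotate_frame :: "real^3^3 \<Rightarrow> frame \<Rightarrow> frame" where
  "rotate_frame A F = (case F of (x, t, n) \<Rightarrow> (A *v x, A *v t, A *v n))"

lemma rotate_frame_simps:
  "rotate_frame A (move \<rho> F) = move \<rho> (rotate_frame A F)"
  "rotate_frame A (turn \<alpha> F) = turn \<alpha> (rotate_frame A F)"
  "fst (rotate_frame A F) = A *v fst F"
  by (auto simp: rotate_frame_def move_def turn_def matrix_vector_right_distrib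
      matrix_vector_mult_diff_distrib matrix_vector_mult_scaleR split: prod.splits)

lemma rotate_quarter_turn: "rotate_frame A (quarter_turn k F) = quarter_turn k (rotate_frame A F)"
  by (simp add: quarter_turn_def rotate_frame_simps)

lemma is_frame_rotate_frame:
  assumes "rotation_matrix A" "is_frame F"
  shows "is_frame (rotate_frame A F)"
proof -
  have "orthogonal_transformation ((*v) A)"
    using assms(1) by (simp add: rotation_matrix_def orthogonal_transformation_matrix)
  then have "norm (A *v x) = norm x" "(A *v x) \<bullet> (A *v y) = x \<bullet> y" for x y
    using orthogonal_transformation_norm[of "(*v) A"] by (auto simp: orthogonal_transformation_def)
  then show ?thesis
    using assms(2) cross_rotation_matrix[OF assms(1)]
    by (auto simp: is_frame_def rotate_frame_def split: prod.splits)
qed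

text \<open>The rows of the matrix are the frame, so it turns the frame into the standard basis.\<close>

lemma frame_matrix:
  assumes "is_frame (x, t, n)"
  defines "P \<equiv> vector [x, t, n] :: real^3^3"
  shows "rotation_matrix P" "P *v x = axis 1 1" "P *v t = axis 2 1" "P *v n = axis 3 1"
proof -
  have f: "x \<bullet> x = 1" "t \<bullet> t = 1" "t \<bullet> x = 0" "n = cross3 x t"
    using assms(1) by (auto simp: is_frame_def norm_eq_1)
  have nx: "n \<bullet> x = 0" "n \<bullet> t = 0" by (simp_all add: f(4) dot_cross_self)
  have nn: "n \<bullet> n = 1" unfolding f(4) dot_cross using f by (simp add: inner_commute)
  have rows: "P $ 1 = x" "P $ 2 = t" "P $ 3 = n" by (simp_all add: P_def)
  have o: "x \<bullet> t = 0" "x \<bullet> n = 0" "t \<bullet> n = 0" using f(3) nx by (simp_all add: inner_commute)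
  have mv: "P *v y = vector [x \<bullet> y, t \<bullet> y, n \<bullet> y]" for y
    by (simp add: vec_eq_iff forall_3 matrix_vector_mul_component rows)
  show "P *v x = axis 1 1" "P *v t = axis 2 1" "P *v n = axis 3 1"
    unfolding mv using f(1-3) nx nn o by (simp_all add: vec_eq_iff forall_3 axis_def)
  have "orthogonal_matrix P"
    unfolding orthogonal_matrix_orthonormal_rows
    using f(1-3) nx nn o by (simp add: forall_3 row_def rows vec_nth_inverse norm_eq_1 orthogonal_def)
  moreover have "det P = 1"
  proof -
    have "cross3 t n = x" unfolding f(4) using f(1-3) by (simp add: Lagrange)
    then show ?thesis using dot_cross_det[of x t n] f(1) by (simp add: P_def)
  qed
  ultimately show "rotation_matrix P" by (simp add: rotation_matrix_def)
qed

lemma rotation_between_frames: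
  assumes "is_frame F" "is_frame F'"
  shows "\<exists>A. rotation_matrix A \<and> rotate_frame A F = F'"
proof -
  obtain x t n x' t' n' where F: "F = (x, t, n)" "F' = (x', t', n')" by (cases F, cases F')
  define P P' where "P = (vector [x, t, n] :: real^3^3)" and "P' = (vector [x', t', n'] :: real^3^3)"
  note P = frame_matrix[OF assms(1)[unfolded F], folded P_def] and P' = frame_matrix[OF assms(2)[unfolded F], folded P'_def]
  let ?A = "transpose P' ** P"
  have orth: "orthogonal_matrix P" "orthogonal_matrix P'" and det: "det P = 1" "det P' = 1"
    using P(1) P'(1) by (auto simp: rotation_matrix_def)
  have "rotation_matrix ?A"
    using orth det by (simp add: rotation_matrix_def orthogonal_matrix_mul orthogonal_matrix_transpose det_mul det_transpose)
  moreover have "transpose P' *v (P' *v y) = y" for y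
    using orth(2) by (simp add: matrix_vector_mul_assoc orthogonal_matrix_def)
  then have "?A *v x = x'" "?A *v t = t'" "?A *v n = n'"
    using P P' by (metis matrix_vector_mul_assoc)+
  ultimately show ?thesis by (auto simp: F rotate_frame_def)
qed

lemma corners_adjacent:
  assumes "x \<in> corners s" "u \<in> corners s" "even_vertex u \<longleftrightarrow> \<not> even_vertex x"
  shows "\<exists>k. u = x + dir k"
proof -
  have "u = x + dir 0 \<or> u = x + dir 1 \<or> u = x + dir 2 \<or> u = x + dir 3"
    using assms by (cases x; cases u; cases s) (auto simp: corners_def dir_def)
  then show ?thesis by blast
qed

lemma corner_horizontal_vertical:
  assumes "y \<in> corners s"
  shows "\<exists>i\<in>{1, 3}. y + dir i \<in> corners s" "\<exists>j\<in>{0, 2}. y + dir j \<in> corners s"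
  using assms by (cases y; cases s; auto simp: corners_def dir_def)+

text \<open>Squares of \<open>S\<close> and of its complement in \<open>Q\<close> can meet only in lattice points. Such a point is not
  interior, as otherwise the other two squares around it would connect them. So the two sets of
  squares would separate the interior.\<close>

lemma connected_interior_imp_edge_connected:
  assumes fin: "finite Q" and conn: "connected (interior (realization Q))"
    and S: "S \<subseteq> Q" "S \<noteq> {}"
    and closed: "\<And>s s'. s \<in> S \<Longrightarrow> s' \<in> Q \<Longrightarrow> \<bar>fst s - fst s'\<bar> + \<bar>snd s - snd s'\<bar> = 1 \<Longrightarrow> s' \<in> S"
  shows "S = Q"
proof (rule ccontr)
  assume "S \<noteq> Q"
  define N where "N = Q - S"
  have N: "N \<noteq> {}" "N \<subseteq> Q" using S \<open>S \<noteq> Q\<close> by (auto simp: N_def)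
  have cl: "closed (realization Z)" if "Z \<subseteq> Q" for Z
    unfolding realization_def using finite_subset[OF that fin]
    by (intro closed_UN) (auto intro!: closed_Times)
  have meets: "realization Z \<inter> interior (realization Q) \<noteq> {}" if Z: "Z \<subseteq> Q" "Z \<noteq> {}" for Z
  proof -
    obtain m n where mn: "(m, n) \<in> Z" using Z(2) by (cases "SOME z. z \<in> Z") (metis some_in_eq)
    have sub: "{real_of_int m<..<of_int m + 1} \<times> {real_of_int n<..<of_int n + 1} \<subseteq> realization Q"
      using square_subset_realization[of m n Q] mn Z(1) by fastforce
    have "open ({real_of_int m<..<of_int m + 1} \<times> {real_of_int n<..<of_int n + 1})"
      by (intro open_Times) auto
    then have "(real_of_int m + 1/2, real_of_int n + 1/2) \<in> interior (realization Q)"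
      using sub by (intro interiorI[of "{real_of_int m<..<of_int m + 1} \<times> {real_of_int n<..<of_int n + 1}"]) auto
    moreover have "(real_of_int m + 1/2, real_of_int n + 1/2) \<in> realization Z"
      using square_subset_realization[OF mn] by auto
    ultimately show ?thesis by blast
  qed
  have un: "interior (realization Q) \<subseteq> realization S \<union> realization N"
    using interior_subset[of "realization Q"] S(1) unfolding realization_def N_def by blast
  have "realization S \<inter> realization N \<inter> interior (realization Q) = {}"
  proof (rule ccontr)
    assume "\<not> ?thesis"
    then obtain x y where z: "(x, y) \<in> realization S" "(x, y) \<in> realization N" "(x, y) \<in> interior (realization Q)"
      by auto
    obtain a b where s: "(a, b) \<in> S" "of_int a \<le> x" "x \<le> of_int a + 1" "of_int b \<le> y" "y \<le> of_int b + 1"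
      using z(1) by (auto simp: realization_def)
    obtain c d where s': "(c, d) \<in> N" "of_int c \<le> x" "x \<le> of_int c + 1" "of_int d \<le> y" "y \<le> of_int d + 1"
      using z(2) by (auto simp: realization_def)
    have "\<bar>a - c\<bar> \<le> 1" "\<bar>b - d\<bar> \<le> 1" using s s' by linarith+
    moreover have "\<bar>a - c\<bar> + \<bar>b - d\<bar> \<noteq> 1" using closed[OF s(1), of "(c, d)"] s'(1) by (auto simp: N_def)
    moreover have "(a, b) \<noteq> (c, d)" using s(1) s'(1) by (auto simp: N_def)
    ultimately have diff: "\<bar>a - c\<bar> = 1" "\<bar>b - d\<bar> = 1" by auto
    \<comment> \<open>The two squares meet only in the corner \<open>(x, y)\<close>, which is interior, so the square \<open>(a, d)\<close>
      belongs to the complex as well, and it has an edge in common with both.\<close>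
    obtain e where e: "e > 0" "ball (x, y) e \<subseteq> realization Q" using z(3) unfolding mem_interior by blast
    define \<epsilon> where "\<epsilon> = min (1/2) (e / 3)"
    have \<epsilon>: "0 < \<epsilon>" "\<epsilon> < 1" "2 * \<epsilon> < e" using e(1) by (auto simp: \<epsilon>_def)
    define dx where "dx = (if a < c then - \<epsilon> else \<epsilon>)"
    define dy where "dy = (if d < b then - \<epsilon> else \<epsilon>)"
    have "dist (x, y) (x + dx, y + dy) \<le> \<bar>dx\<bar> + \<bar>dy\<bar>"
      using norm_Pair_le[of "- dx" "- dy"] by (simp add: dist_norm)
    also have "\<dots> < e" using \<epsilon> by (simp add: dx_def dy_def)
    finally have "(x + dx, y + dy) \<in> realization Q" using e(2) by auto
    then obtain m n where mn: "(m, n) \<in> Q" "of_int m \<le> x + dx" "x + dx \<le> of_int m + 1"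
      "of_int n \<le> y + dy" "y + dy \<le> of_int n + 1"
      by (auto simp: realization_def)
    have "m = a"
    proof (cases "a < c")
      case True
      then have "c = a + 1" using diff by linarith
      then have "x = of_int a + 1" using s s' by simp
      then have "of_int m < real_of_int a + 1" "real_of_int a < of_int m + 1"
        using mn(2,3) \<epsilon> True by (auto simp: dx_def)
      then show ?thesis by linarith
    next
      case False
      then have "a = c + 1" using diff by linarith
      then have "x = of_int a" using s s' by simp
      then have "of_int m < real_of_int a + 1" "real_of_int a < of_int m + 1"
        using mn(2,3) \<epsilon> False by (auto simp: dx_def)
      then show ?thesis by linarith
    qed
    moreover have "n = d"
    proof (cases "d < b")
      case True
      then have "b = d + 1" using diff by linarith
      then have "y = of_int d + 1" using s s' by simp
      then have "of_int n < real_of_int d + 1" "real_of_int d < of_int n + 1"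
        using mn(4,5) \<epsilon> True by (auto simp: dy_def)
      then show ?thesis by linarith
    next
      case False
      then have "d = b + 1" using diff by linarith
      then have "y = of_int d" using s s' by simp
      then have "of_int n < real_of_int d + 1" "real_of_int d < of_int n + 1"
        using mn(4,5) \<epsilon> False by (auto simp: dy_def)
      then show ?thesis by linarith
    qed
    ultimately have "(a, d) \<in> Q" using mn(1) by simp
    then have "(a, d) \<in> S" using closed[OF s(1), of "(a, d)"] diff by simp
    then have "(c, d) \<in> S" using closed[of "(a, d)" "(c, d)"] s'(1) N(2) diff by auto
    then show False using s'(1) by (simp add: N_def)
  qed
  then show False
    using conn un cl[OF S(1)] cl[OF N(2)] meets[OF S] meets[OF N(2) N(1)]
    unfolding connected_closed by blast
qed

text \<open>The vertical neighbor is seen at an outer radius, which is never \<open>0\<close>, while the radius \<open>c\<close> of the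
  horizontal one may vanish.\<close>

lemma frame_from_neighbors:
  assumes f: "is_frame F" "is_frame F'" and i: "i \<in> {1, 3}" and j: "j \<in> {0, 2}"
    and u: "fst (move a (quarter_turn i F)) = fst (move a (quarter_turn i F'))"
    and w: "fst (move c (quarter_turn j F)) = fst (move c (quarter_turn j F'))"
    and a: "sin a \<noteq> 0"
  shows "F = F'"
proof -
  obtain y t n y' t' n' where F: "F = (y, t, n)" "F' = (y', t', n')" by (cases F, cases F')
  define R where "R = (if i = 1 then - a else a)"
  define r where "r = (if j = 0 then c else - c)"
  have "fst (move a (quarter_turn i (y, t, n))) = cos R *\<^sub>R y - sin R *\<^sub>R n" for y t n
    using i unfolding R_def by (elim insertE) (simp_all only: quarter_turn_simps, simp_all add: move_def)
  moreover have "fst (move c (quarter_turn j (y, t, n))) = cos r *\<^sub>R y + sin r *\<^sub>R t" for y t n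
    using j unfolding r_def by (elim insertE) (simp_all only: quarter_turn_simps, simp_all add: move_def)
  moreover have R: "sin R \<noteq> 0" using a by (simp add: R_def)
  moreover have "(cos R * cos r)\<^sup>2 < 1"
  proof -
    have "(cos R)\<^sup>2 < 1" using R by (simp add: cos_squared_eq)
    moreover have "(cos R)\<^sup>2 * (cos r)\<^sup>2 \<le> (cos R)\<^sup>2 * 1"
      by (intro mult_left_mono) (auto simp: abs_square_le_1)
    ultimately show ?thesis by (simp add: power_mult_distrib)
  qed
  ultimately show ?thesis
    using frame_from_two_points[of y t n y' t' n' R r] f u w unfolding F by simp
qed

lemma touch_rotate_center:
  assumes touch: "rings_touch Q p r R l t" "rings_touch Q p' r R l' t'"
    and x: "x \<in> Gstar_vertices Q" and eq: "point_frame l' t' x = rotate_frame A (point_frame l t x)"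
    and s: "share_square Q x (x + dir k)"
  shows "p' (x + dir k) = A *v p (x + dir k)"
  unfolding rings_touchD(2)[OF touch(1) x s] rings_touchD(2)[OF touch(2) x s] eq
    rotate_quarter_turn[symmetric] rotate_frame_simps(1)[symmetric] rotate_frame_simps(3) ..

text \<open>If two patterns differ by a rotation at one touching point of a square, they do so at the two centers
  in this square, and hence at its other touching point. Squares with a common edge have a common
  touching point.\<close>

theorem pattern_unique_up_to_rotation:
  assumes q: "0 < q" "q < 1" and radii: "\<And>v. v \<in> G_vertices Q \<Longrightarrow> ring_radii q (r v) (R v)"
    and fin: "finite Q" and conn: "connected (interior (realization Q))"
    and touch: "rings_touch Q p r R l t" "rings_touch Q p' r R l' t'"
    and points: "\<And>x. x \<in> Gstar_vertices Q \<Longrightarrow> l x \<in> sphere 0 1" "\<And>x. x \<in> Gstar_vertices Q \<Longrightarrow> l' x \<in> sphere 0 1"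
  shows "\<exists>A. rotation_matrix A \<and> (\<forall>v\<in>G_vertices Q. p' v = A *v p v) \<and> (\<forall>x\<in>Gstar_vertices Q. l' x = A *v l x)"
proof (cases "Q = {}")
  case True
  then have "G_vertices Q = {}" "Gstar_vertices Q = {}" by (auto simp: G_vertices_def Gstar_vertices_def)
  moreover have "rotation_matrix (mat 1 :: real^3^3)"
    by (simp add: rotation_matrix_def orthogonal_matrix_id)
  ultimately show ?thesis by blast
next
  case False
  let ?X = "point_frame l t" and ?X' = "point_frame l' t'"
  have frames: "is_frame (?X x)" "is_frame (?X' x)" if "x \<in> Gstar_vertices Q" for x
    using points that rings_touchD(1)[OF touch(1) that] rings_touchD(1)[OF touch(2) that]
    unfolding is_frame_point_frame by auto
  have star: "x \<in> Gstar_vertices Q" if "s \<in> Q" "x \<in> corners s" "\<not> even_vertex x" for s x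
    using that by (auto simp: Gstar_vertices_iff)
  have odd_corner: "\<exists>x\<in>corners s. \<not> even_vertex x" for s
    by (cases s) (auto simp: corners_def intro: exI)
  obtain s0 where s0: "s0 \<in> Q" using False by blast
  obtain x0 where x0: "x0 \<in> corners s0" "\<not> even_vertex x0" using odd_corner by blast
  obtain A where A: "rotation_matrix A" "rotate_frame A (?X x0) = ?X' x0"
    using rotation_between_frames frames[OF star[OF s0 x0]] by blast
  define agree where "agree = (\<lambda>s. (\<forall>x\<in>corners s. \<not> even_vertex x \<longrightarrow> ?X' x = rotate_frame A (?X x)) \<and>
    (\<forall>v\<in>corners s. even_vertex v \<longrightarrow> p' v = A *v p v))"
  have spread: "agree s" if s: "s \<in> Q" and x: "x \<in> corners s" "\<not> even_vertex x" and eq: "?X' x = rotate_frame A (?X x)" for s x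
  proof -
    have centers: "p' v = A *v p v" if v: "v \<in> corners s" "even_vertex v" for v
    proof -
      obtain k where k: "v = x + dir k" using corners_adjacent[OF x(1) v(1)] v(2) x(2) by blast
      have "share_square Q x (x + dir k)" using s x(1) v(1) unfolding k share_square_def by blast
      then show ?thesis unfolding k using touch_rotate_center[OF touch star[OF s x] eq] by blast
    qed
    have "?X' y = rotate_frame A (?X y)" if y: "y \<in> corners s" "\<not> even_vertex y" for y
    proof -
      obtain i j where i: "i \<in> {1, 3}" "y + dir i \<in> corners s" and j: "j \<in> {0, 2}" "y + dir j \<in> corners s"
        using corner_horizontal_vertical[OF y(1)] by blast
      have e: "even_vertex (y + dir i)" "even_vertex (y + dir j)" using y(2) unfolding even_vertex_dir by simp_all
      have share: "share_square Q y (y + dir i)" "share_square Q y (y + dir j)"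
        using s y(1) i(2) j(2) unfolding share_square_def by blast+
      note ys = star[OF s y]
      have at: "fst (move (rad r R (y + dir k) k) (quarter_turn k (rotate_frame A (?X y))))
          = fst (move (rad r R (y + dir k) k) (quarter_turn k (?X' y)))"
        if "share_square Q y (y + dir k)" "p' (y + dir k) = A *v p (y + dir k)" for k
      proof -
        have "fst (move (rad r R (y + dir k) k) (quarter_turn k (?X' y))) = A *v p (y + dir k)"
          using rings_touchD(2)[OF touch(2) ys that(1)] that(2) by simp
        also have "p (y + dir k) = fst (move (rad r R (y + dir k) k) (quarter_turn k (?X y)))"
          by (rule rings_touchD(2)[OF touch(1) ys that(1)])
        finally show ?thesis
          unfolding rotate_quarter_turn[symmetric] rotate_frame_simps(1)[symmetric] rotate_frame_simps(3) by simp
      qed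
      have G: "y + dir i \<in> G_vertices Q" using s i(2) e(1) by (auto simp: G_vertices_iff)
      have "rad r R (y + dir i) i = R (y + dir i)" using i(1) by (auto simp: rad_def)
      then have "sin (rad r R (y + dir i) i) > 0"
        using radii[OF G] by (auto simp: ring_radii_def intro!: sin_gt_zero)
      then show ?thesis
        using frame_from_neighbors[OF is_frame_rotate_frame[OF A(1) frames(1)[OF ys]] frames(2)[OF ys] i(1) j(1)
            at[OF share(1) centers[OF i(2) e(1)]] at[OF share(2) centers[OF j(2) e(2)]]] by simp
    qed
    then show ?thesis using centers by (simp add: agree_def)
  qed
  have "{s \<in> Q. agree s} = Q"
  proof (rule connected_interior_imp_edge_connected[OF fin conn])
    show "{s \<in> Q. agree s} \<noteq> {}" using spread[OF s0 x0 A(2)[symmetric]] s0 by blast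
    fix s s' assume s: "s \<in> {s \<in> Q. agree s}" "s' \<in> Q" "\<bar>fst s - fst s'\<bar> + \<bar>snd s - snd s'\<bar> = 1"
    have "\<exists>x\<in>corners s. x \<in> corners s' \<and> \<not> even_vertex x"
    proof -
      obtain a b c d where ss: "s = (a, b)" "s' = (c, d)" by (cases s, cases s')
      have "(c = a + 1 \<and> d = b) \<or> (c = a - 1 \<and> d = b) \<or> (c = a \<and> d = b + 1) \<or> (c = a \<and> d = b - 1)"
        using s(3) by (auto simp: ss)
      then show ?thesis unfolding ss by (elim disjE conjE) (auto simp: corners_def)
    qed
    then obtain x where x: "x \<in> corners s" "x \<in> corners s'" "\<not> even_vertex x" by blast
    then have "?X' x = rotate_frame A (?X x)" using s(1) by (auto simp: agree_def)
    then show "s' \<in> {s \<in> Q. agree s}" using spread[OF s(2) x(2,3)] s(2) by blast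
  qed auto
  then have ag: "agree s" if "s \<in> Q" for s using that by blast
  have "p' v = A *v p v" if "v \<in> G_vertices Q" for v
    using that ag unfolding agree_def G_vertices_iff by blast
  moreover have "l' x = A *v l x" if "x \<in> Gstar_vertices Q" for x
  proof -
    have "?X' x = rotate_frame A (?X x)" using that ag unfolding agree_def Gstar_vertices_iff by blast
    from arg_cong[OF this, of fst] show ?thesis by (simp add: rotate_frame_simps)
  qed
  ultimately show ?thesis using A(1) by blast
qed

lemma rings_touch_cong:
  assumes "rings_touch Q p r R l t" "\<And>v. v \<in> G_vertices Q \<Longrightarrow> r' v = r v \<and> R' v = R v"
  shows "rings_touch Q p r' R' l t"
  unfolding rings_touch_iff
proof (intro ballI conjI allI impI)
  fix x assume x: "x \<in> Gstar_vertices Q"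
  show "unit_tangent (l x) (t x)" by (rule rings_touchD(1)[OF assms(1) x])
  fix k assume s: "share_square Q x (x + dir k)"
  have "x + dir k \<in> G_vertices Q"
    using s x even_vertex_dir[of x k] unfolding G_vertices_iff Gstar_vertices_iff share_square_def by blast
  then have "rad r' R' (x + dir k) k = rad r R (x + dir k) k" using assms(2) by (simp add: rad_def)
  then show "p (x + dir k) = fst (move (rad r' R' (x + dir k) k) (quarter_turn k (point_frame l t x)))"
    using rings_touchD(2)[OF assms(1) x s] by simp
qed

section \<open>Critical points and patterns\<close>

text \<open>Adding \<open>\<pi>\<close> for each neighbor turns the partial derivatives into sums of kite angles. At a
  negatively oriented boundary ring the opening angles are smaller than the kite angles by just this
  amount.\<close>

lemma critical_point_iff_angles:
  assumes q: "0 < q" "q < 1" and fin: "finite Q"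
    and \<beta>: "\<And>v. v \<in> G_vertices Q \<Longrightarrow> \<beta> v \<in> {0..2 * ell_K q}"
    and ring: "\<And>v. v \<in> G_vertices Q \<Longrightarrow> ring_of_beta q (\<beta> v) (r v) (R v)"
    and bounds: "\<And>v. v \<in> G_vertices Q \<Longrightarrow> \<bar>r v\<bar> \<le> R v \<and> 0 < R v \<and> R v \<le> pi / 2"
    and data: "prescribed_data q Q \<Theta> \<beta> \<Phi>"
  shows "critical_point (S_sph q Q \<Phi>) \<beta> \<longleftrightarrow>
    (\<forall>v\<in>inner_vertices Q. (\<Sum>w\<in>neighbors Q v. kite_angle (r v) (R v) (r w) (R w)) = 2 * pi) \<and>
    (\<forall>v\<in>boundary_vertices Q. nominal_angle Q r R v = \<Theta> v)"
proof -
  let ?g = "\<lambda>v w. ring_g q (\<beta> v - \<beta> w) - ring_g q (\<beta> v + \<beta> w)"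
  have nG: "w \<in> G_vertices Q" if "w \<in> neighbors Q v" for v w
    using that by (simp add: neighbors_def neighboring_def)
  have rad: "ring_radii q (r v) (R v)" "r v = pi / 2 - jacobi_am q (\<beta> v)" if "v \<in> G_vertices Q" for v
    using ring_of_beta_radii[OF q \<beta>[OF that] ring[OF that]] bounds[OF that] by auto
  have \<theta>: "kite_angle (r v) (R v) (r w) (R w) = pi + ?g v w"
    if "v \<in> G_vertices Q" "w \<in> G_vertices Q" for v w
    by (rule kite_angle_eq_ring_g[OF q \<beta>[OF that(2)]])
      (use ring[OF that(1)] ring[OF that(2)] rad(2)[OF that(2)] in \<open>auto simp: ring_of_beta_def\<close>)
  have sum_\<theta>: "(\<Sum>w\<in>neighbors Q v. kite_angle (r v) (R v) (r w) (R w))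
      = pi * real (card (neighbors Q v)) + (\<Sum>w\<in>neighbors Q v. ?g v w)" if "v \<in> G_vertices Q" for v
  proof -
    have "(\<Sum>w\<in>neighbors Q v. kite_angle (r v) (R v) (r w) (R w)) = (\<Sum>w\<in>neighbors Q v. pi + ?g v w)"
      by (rule sum.cong[OF refl]) (use \<theta> that nG in blast)
    then show ?thesis by (simp only: sum.distrib sum_constant) simp
  qed
  have inner: "(\<Sum>w\<in>neighbors Q v. ?g v w) + \<Phi> v = 0 \<longleftrightarrow>
      (\<Sum>w\<in>neighbors Q v. kite_angle (r v) (R v) (r w) (R w)) = 2 * pi"
    if "v \<in> inner_vertices Q" for v
  proof -
    have "v \<in> G_vertices Q" "card (neighbors Q v) = 4" using that by (auto simp: inner_vertices_def)
    moreover have "\<Phi> v = 2 * pi" using data that by (simp add: prescribed_data_def)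
    ultimately show ?thesis using sum_\<theta>[of v] by (simp only:) auto
  qed
  have boundary: "(\<Sum>w\<in>neighbors Q v. ?g v w) + \<Phi> v = 0 \<longleftrightarrow> nominal_angle Q r R v = \<Theta> v"
    if b: "v \<in> boundary_vertices Q" for v
  proof -
    have v: "v \<in> G_vertices Q" using b by (simp add: boundary_vertices_def)
    have s: "sin (r v) = jacobi_cn q (\<beta> v)" using ring[OF v] by (simp add: ring_of_beta_def)
    have Rw: "0 < R w" "R w \<le> pi / 2" if "w \<in> neighbors Q v" for w using bounds[OF nG[OF that]] by auto
    consider "jacobi_cn q (\<beta> v) > 0" "\<Phi> v = pi * real (card (neighbors Q v)) - \<Theta> v"
      | "jacobi_cn q (\<beta> v) < 0" "\<Phi> v = - \<Theta> v"
      using data b unfolding prescribed_data_def by blast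
    then show ?thesis
    proof cases
      case 1
      have "nominal_angle Q r R v = (\<Sum>w\<in>neighbors Q v. kite_angle (r v) (R v) (r w) (R w))"
        unfolding nominal_angle_def by (rule sum.cong[OF refl], rule opening_angle_eq(1)) (use Rw s 1 in auto)
      then show ?thesis using sum_\<theta>[OF v] 1(2) by auto
    next
      case 2
      have "nominal_angle Q r R v = (\<Sum>w\<in>neighbors Q v. kite_angle (r v) (R v) (r w) (R w) - pi)"
        unfolding nominal_angle_def by (rule sum.cong[OF refl], rule opening_angle_eq(2)) (use Rw s 2 in auto)
      also have "\<dots> = (\<Sum>w\<in>neighbors Q v. ?g v w)"
        by (rule sum.cong[OF refl]) (simp add: \<theta>[OF v nG])
      finally show ?thesis using 2(2) by auto
    qed
  qed
  have sub: "inner_vertices Q \<subseteq> G_vertices Q" "boundary_vertices Q \<subseteq> G_vertices Q"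
    by (auto simp: inner_vertices_def boundary_vertices_def)
  show ?thesis
    unfolding critical_point_S_sph_iff[OF q fin]
  proof (intro iffI conjI ballI)
    assume a: "\<forall>v\<in>G_vertices Q. (\<Sum>w\<in>neighbors Q v. ?g v w) + \<Phi> v = 0"
    show "(\<Sum>w\<in>neighbors Q v. kite_angle (r v) (R v) (r w) (R w)) = 2 * pi" if "v \<in> inner_vertices Q" for v
      using a inner[OF that] that sub(1) by blast
    show "nominal_angle Q r R v = \<Theta> v" if "v \<in> boundary_vertices Q" for v
      using a boundary[OF that] that sub(2) by blast
  next
    fix v assume a: "(\<forall>v\<in>inner_vertices Q. (\<Sum>w\<in>neighbors Q v. kite_angle (r v) (R v) (r w) (R w)) = 2 * pi) \<and>
      (\<forall>v\<in>boundary_vertices Q. nominal_angle Q r R v = \<Theta> v)" and v: "v \<in> G_vertices Q"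
    show "(\<Sum>w\<in>neighbors Q v. ?g v w) + \<Phi> v = 0"
      using inner_or_boundary[OF v]
    proof
      assume i: "v \<in> inner_vertices Q"
      show ?thesis using a i inner[OF i] by blast
    next
      assume i: "v \<in> boundary_vertices Q"
      show ?thesis using a i boundary[OF i] by blast
    qed
  qed
qed

theorem critical_point_iff_pattern:
  assumes q: "0 < q" "q < 1" and fin: "finite Q" and sc: "simply_connected (realization Q)"
    and \<beta>: "\<And>v. v \<in> G_vertices Q \<Longrightarrow> \<beta> v \<in> {0..2 * ell_K q}"
    and data: "prescribed_data q Q \<Theta> \<beta> \<Phi>"
  shows "critical_point (S_sph q Q \<Phi>) \<beta> \<longleftrightarrow>
         (\<exists>p r R l. orthogonal_ring_pattern Q p r R l \<and>
            (\<forall>v \<in> G_vertices Q. R v \<le> pi / 2 \<and> ring_of_beta q (\<beta> v) (r v) (R v)) \<and>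
            (\<forall>v \<in> boundary_vertices Q. nominal_angle Q r R v = \<Theta> v))"
proof
  assume crit: "critical_point (S_sph q Q \<Phi>) \<beta>"
  define r R where "r = (\<lambda>v. pi / 2 - jacobi_am q (\<beta> v))" and "R = (\<lambda>v. arccos (q * jacobi_sn q (\<beta> v)))"
  have ring: "ring_of_beta q (\<beta> v) (r v) (R v)" "ring_radii q (r v) (R v)" "\<bar>r v\<bar> \<le> R v"
    if "v \<in> G_vertices Q" for v
    unfolding r_def R_def using ring_of_beta_exists[OF q \<beta>[OF that]] .
  then have b: "\<bar>r v\<bar> \<le> R v \<and> 0 < R v \<and> R v \<le> pi / 2" if "v \<in> G_vertices Q" for v
    using that by (auto simp: ring_radii_def)
  have angles: "(\<forall>v\<in>inner_vertices Q. (\<Sum>w\<in>neighbors Q v. kite_angle (r v) (R v) (r w) (R w)) = 2 * pi) \<and>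
    (\<forall>v\<in>boundary_vertices Q. nominal_angle Q r R v = \<Theta> v)"
    using critical_point_iff_angles[OF q fin \<beta> ring(1) b data] crit by blast
  interpret ring_data q Q r R by unfold_locales (use q ring in auto)
  have "\<exists>p l. orthogonal_ring_pattern Q p r R l"
    by (rule pattern_exists[OF fin sc]) (use ring(3) angles in blast)+
  then obtain p l where "orthogonal_ring_pattern Q p r R l" by blast
  then show "\<exists>p r R l. orthogonal_ring_pattern Q p r R l \<and>
            (\<forall>v \<in> G_vertices Q. R v \<le> pi / 2 \<and> ring_of_beta q (\<beta> v) (r v) (R v)) \<and>
            (\<forall>v \<in> boundary_vertices Q. nominal_angle Q r R v = \<Theta> v)"
    using ring(1) b angles by blast
next
  assume "\<exists>p r R l. orthogonal_ring_pattern Q p r R l \<and>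
            (\<forall>v \<in> G_vertices Q. R v \<le> pi / 2 \<and> ring_of_beta q (\<beta> v) (r v) (R v)) \<and>
            (\<forall>v \<in> boundary_vertices Q. nominal_angle Q r R v = \<Theta> v)"
  then obtain p r R l where pat: "orthogonal_ring_pattern Q p r R l"
    and ring: "\<And>v. v \<in> G_vertices Q \<Longrightarrow> R v \<le> pi / 2 \<and> ring_of_beta q (\<beta> v) (r v) (R v)"
    and nom: "\<forall>v \<in> boundary_vertices Q. nominal_angle Q r R v = \<Theta> v" by blast
  have b: "\<bar>r v\<bar> \<le> R v \<and> 0 < R v \<and> R v \<le> pi / 2" if "v \<in> G_vertices Q" for v
    using pat ring[OF that] that by (auto simp: orthogonal_ring_pattern_def spherical_ring_def)
  have ring': "ring_of_beta q (\<beta> v) (r v) (R v)" if "v \<in> G_vertices Q" for v using ring[OF that] by simp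
  have rad: "ring_radii q (r v) (R v)" if "v \<in> G_vertices Q" for v
    using ring_of_beta_radii(1)[OF q \<beta>[OF that] ring'[OF that]] b[OF that] by blast
  have "(\<Sum>w\<in>neighbors Q v. kite_angle (r v) (R v) (r w) (R w)) = 2 * pi" if "v \<in> inner_vertices Q" for v
    by (rule pattern_inner_sums[OF q rad pat that])
  then show "critical_point (S_sph q Q \<Phi>) \<beta>"
    using critical_point_iff_angles[OF q fin \<beta> ring' b data] nom by blast
qed

text \<open>The parameter is determined by \<open>am b = \<pi>/2 - r\<close>.\<close>

lemma uniformizing_parameter:
  assumes q: "0 < q" "q < 1" and rR: "\<bar>r\<bar> \<le> R" "0 < R" "R \<le> pi / 2" and qr: "q * cos r = cos R"
  shows "\<exists>!b. b \<in> {0..2 * ell_K q} \<and> ring_of_beta q b r R"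
proof (rule ex1I)
  let ?b = "ell_int q (pi / 2 - r)"
  have am: "jacobi_am q ?b = pi / 2 - r" by (rule am_ell_int[OF q])
  have "?b \<in> {0..2 * ell_K q}"
    unfolding jacobi_am_range_iff[OF q] am using rR by (auto simp: abs_le_iff)
  moreover have "cos r = jacobi_sn q ?b" "sin r = jacobi_cn q ?b"
    by (simp_all add: jacobi_sn_def jacobi_cn_def am sin_diff cos_diff)
  moreover have "sin R = jacobi_dn q ?b"
  proof -
    have "(sin R)\<^sup>2 = 1 - q\<^sup>2 * (cos r)\<^sup>2" unfolding sin_squared_eq qr[symmetric] by (simp add: power_mult_distrib)
    moreover have "sin R > 0" using rR by (intro sin_gt_zero) auto
    ultimately have "sin R = sqrt (1 - q\<^sup>2 * (cos r)\<^sup>2)" by (intro real_sqrt_unique[symmetric]) auto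
    then show ?thesis using \<open>cos r = jacobi_sn q ?b\<close> by (simp add: jacobi_dn_def)
  qed
  ultimately show "?b \<in> {0..2 * ell_K q} \<and> ring_of_beta q ?b r R" using qr by (simp add: ring_of_beta_def)
  fix b assume b: "b \<in> {0..2 * ell_K q} \<and> ring_of_beta q b r R"
  then have "r = pi / 2 - jacobi_am q b" using ring_of_beta_radii(2)[OF q _ _ rR] by blast
  then have "jacobi_am q b = jacobi_am q ?b" unfolding am by simp
  then show "b = ?b" by (metis ell_int_am[OF q])
qed

theorem theorem5p1:
  fixes q :: real and Q :: "(int \<times> int) set"
  assumes "0 < q" and "q < 1"
    and "finite Q" and "simply_connected (realization Q)"
  shows
    "(\<forall>\<Theta> \<Phi> \<beta>. (\<forall>v \<in> G_vertices Q. \<beta> v \<in> {0 .. 2 * ell_K q}) \<longrightarrow> prescribed_data q Q \<Theta> \<beta> \<Phi> \<longrightarrow>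
        (critical_point (S_sph q Q \<Phi>) \<beta> \<longleftrightarrow>
         (\<exists>p r R l. orthogonal_ring_pattern Q p r R l \<and>
            (\<forall>v \<in> G_vertices Q. R v \<le> pi / 2 \<and> ring_of_beta q (\<beta> v) (r v) (R v)) \<and>
            (\<forall>v \<in> boundary_vertices Q. nominal_angle Q r R v = \<Theta> v))))
   \<and> (\<forall>p r R l. orthogonal_ring_pattern Q p r R l \<and>
            (\<forall>v \<in> G_vertices Q. R v \<le> pi / 2 \<and> q * cos (r v) = cos (R v)) \<longrightarrow>
        (\<forall>v \<in> G_vertices Q. \<exists>!b. b \<in> {0 .. 2 * ell_K q} \<and> ring_of_beta q b (r v) (R v)))
   \<and> (connected (interior (realization Q)) \<longrightarrow>
        (\<forall>\<beta> p r R l p' r' R' l'.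
            orthogonal_ring_pattern Q p r R l \<and> orthogonal_ring_pattern Q p' r' R' l' \<and>
            (\<forall>v \<in> G_vertices Q. \<beta> v \<in> {0 .. 2 * ell_K q} \<and>
               R v \<le> pi / 2 \<and> ring_of_beta q (\<beta> v) (r v) (R v) \<and>
               R' v \<le> pi / 2 \<and> ring_of_beta q (\<beta> v) (r' v) (R' v)) \<longrightarrow>
            (\<exists>A. rotation_matrix A \<and>
               (\<forall>v \<in> G_vertices Q. r' v = r v \<and> R' v = R v \<and> p' v = A *v p v) \<and>
               (\<forall>x \<in> Gstar_vertices Q. l' x = A *v l x))))
   \<and> (\<forall>\<Phi> \<beta> h. has_second_derivative (S_sph q Q \<Phi>) \<beta> h
        (1/2 * (\<Sum>(v,w)\<in>G_edges Q.
            (jacobi_dn q (\<beta> v - \<beta> w) + q * jacobi_cn q (\<beta> v - \<beta> w)) * (h v - h w)\<^sup>2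
          - (jacobi_dn q (\<beta> v + \<beta> w) + q * jacobi_cn q (\<beta> v + \<beta> w)) * (h v + h w)\<^sup>2)))"
proof (intro conjI allI impI)
  note q = assms(1,2)
  show "critical_point (S_sph q Q \<Phi>) \<beta> \<longleftrightarrow>
         (\<exists>p r R l. orthogonal_ring_pattern Q p r R l \<and>
            (\<forall>v \<in> G_vertices Q. R v \<le> pi / 2 \<and> ring_of_beta q (\<beta> v) (r v) (R v)) \<and>
            (\<forall>v \<in> boundary_vertices Q. nominal_angle Q r R v = \<Theta> v))"
    if "\<forall>v \<in> G_vertices Q. \<beta> v \<in> {0 .. 2 * ell_K q}" "prescribed_data q Q \<Theta> \<beta> \<Phi>" for \<Theta> \<Phi> \<beta>
    by (rule critical_point_iff_pattern[OF assms _ that(2)]) (use that(1) in blast)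
next
  note q = assms(1,2)
  fix p r R l
  assume "orthogonal_ring_pattern Q p r R l \<and>
            (\<forall>v \<in> G_vertices Q. R v \<le> pi / 2 \<and> q * cos (r v) = cos (R v))"
  then have "\<bar>r v\<bar> \<le> R v" "0 < R v" "R v \<le> pi / 2" "q * cos (r v) = cos (R v)" if "v \<in> G_vertices Q" for v
    using that unfolding orthogonal_ring_pattern_def spherical_ring_def by blast+
  then show "\<forall>v \<in> G_vertices Q. \<exists>!b. b \<in> {0 .. 2 * ell_K q} \<and> ring_of_beta q b (r v) (R v)"
    using uniformizing_parameter[OF q] by simp
next
  note q = assms(1,2)
  fix \<beta> :: "int \<times> int \<Rightarrow> real" and p r R l p' r' R' l'
  assume conn: "connected (interior (realization Q))"
    and "orthogonal_ring_pattern Q p r R l \<and> orthogonal_ring_pattern Q p' r' R' l' \<and>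
            (\<forall>v \<in> G_vertices Q. \<beta> v \<in> {0 .. 2 * ell_K q} \<and>
               R v \<le> pi / 2 \<and> ring_of_beta q (\<beta> v) (r v) (R v) \<and>
               R' v \<le> pi / 2 \<and> ring_of_beta q (\<beta> v) (r' v) (R' v))"
  then have pat: "orthogonal_ring_pattern Q p r R l" "orthogonal_ring_pattern Q p' r' R' l'"
    and ring: "\<And>v. v \<in> G_vertices Q \<Longrightarrow> \<beta> v \<in> {0 .. 2 * ell_K q} \<and>
               R v \<le> pi / 2 \<and> ring_of_beta q (\<beta> v) (r v) (R v) \<and>
               R' v \<le> pi / 2 \<and> ring_of_beta q (\<beta> v) (r' v) (R' v)" by blast+
  have sph: "\<bar>r v\<bar> \<le> R v" "0 < R v" "\<bar>r' v\<bar> \<le> R' v" "0 < R' v" if "v \<in> G_vertices Q" for v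
    using pat that unfolding orthogonal_ring_pattern_def spherical_ring_def by blast+
  have rad: "ring_radii q (r v) (R v)" "r' v = r v \<and> R' v = R v" if v: "v \<in> G_vertices Q" for v
  proof -
    have b: "\<beta> v \<in> {0..2 * ell_K q}" "ring_of_beta q (\<beta> v) (r v) (R v)" "R v \<le> pi / 2"
      "ring_of_beta q (\<beta> v) (r' v) (R' v)" "R' v \<le> pi / 2" using ring[OF v] by blast+
    note 1 = ring_of_beta_radii[OF q b(1,2) sph(1,2)[OF v] b(3)]
    note 2 = ring_of_beta_radii[OF q b(1,4) sph(3,4)[OF v] b(5)]
    show "ring_radii q (r v) (R v)" by (rule 1)
    show "r' v = r v \<and> R' v = R v" using 1 2 by simp
  qed
  obtain t t' where touch: "rings_touch Q p r R l t" "rings_touch Q p' r' R' l' t'"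
    using pat unfolding orthogonal_ring_pattern_def by blast
  have touch': "rings_touch Q p' r R l' t'" by (rule rings_touch_cong[OF touch(2)]) (simp add: rad(2))
  have points: "l x \<in> sphere 0 1" "l' x \<in> sphere 0 1" if "x \<in> Gstar_vertices Q" for x
    using pat that unfolding orthogonal_ring_pattern_def by blast+
  obtain A where "rotation_matrix A" "\<forall>v\<in>G_vertices Q. p' v = A *v p v" "\<forall>x\<in>Gstar_vertices Q. l' x = A *v l x"
    using pattern_unique_up_to_rotation[OF q rad(1) assms(3) conn touch(1) touch' points] by blast
  then show "\<exists>A. rotation_matrix A \<and>
               (\<forall>v \<in> G_vertices Q. r' v = r v \<and> R' v = R v \<and> p' v = A *v p v) \<and>
               (\<forall>x \<in> Gstar_vertices Q. l' x = A *v l x)" using rad(2) by blast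
next
  fix \<Phi> \<beta> h
  show "has_second_derivative (S_sph q Q \<Phi>) \<beta> h
        (1/2 * (\<Sum>(v,w)\<in>G_edges Q.
            (jacobi_dn q (\<beta> v - \<beta> w) + q * jacobi_cn q (\<beta> v - \<beta> w)) * (h v - h w)\<^sup>2
          - (jacobi_dn q (\<beta> v + \<beta> w) + q * jacobi_cn q (\<beta> v + \<beta> w)) * (h v + h w)\<^sup>2))"
    by (rule S_sph_second_derivative[OF assms(1,2)])
qed

end
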